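(* Let $X$ be a complex Banach space and $T\in\mathcal{B}(X)$. The following statements are equivalent: 1) a-Browder's theorem holds for $T$; 2) generalized a-Browder's theorem holds for $T$; 3) $T$ has SVEP at every $\lambda\notin\sigma_{gD\mathcal{W}+}(T)$; 4) $\sigma_{gD\mathcal{M}}(T)=\sigma_{gD\mathcal{W}+}(T)$.
   Context: $\mathcal{B}(X)$ is the algebra of bounded linear operators on $X$; $N(T)$, $R(T)$ are kernel and range. $(M,N)\in Red(T)$ means that $M,N$ are closed $T$-invariant subspaces with $X=M\oplus N$. $T$ is upper semi-Fredholm if $\dim N(T)<\infty$ and $R(T)$ is closed, with index $ind(T)=\dim N(T)-\operatorname{codim}R(T)$; upper semi-Weyl if moreover $ind(T)\le 0$. The ascent is $a(T)=\min\{p: N(T^p)=N(T^{p+1})\}$ ($\infty$ if no such $p$). $T$ is upper semi-Browder if it is upper semi-Fredholm with $a(T)<\infty$. $\sigma_{uW}(T)$ and $\sigma_{uB}(T)$ are the sets of $\lambda\in\mathbb{C}$ such that $T-\lambda I$ is not upper semi-Weyl, respectively not upper semi-Browder. a-Browder's theorem holds for $T$ if $\sigma_{uW}(T)=\sigma_{uB}(T)$. $T$ is upper semi B-Weyl if for some integer $n\ge 0$ the range $R(T^n)$ is closed and the restriction of $T$ to $R(T^n)$ is upper semi-Fredholm with index $\le 0$. $T$ is left Drazin invertible if $a(T)<\infty$ and $R(T^{a(T)+1})$ is closed. Generalized a-Browder's theorem holds for $T$ if the set of $\lambda$ such that $T-\lambda I$ is not upper semi B-Weyl equals $\sigma_{ap}(T)\setminus\Pi^a(T)$,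 where $\sigma_{ap}(T)$ is the approximate point spectrum and $\Pi^a(T)$ is the set of $\lambda\in\sigma_{ap}(T)$ such that $T-\lambda I$ is left Drazin invertible. $T$ is generalized Drazin bounded below (resp. generalized Drazin upper semi-Weyl) if there exists $(M,N)\in Red(T)$ such that $T_{|M}$ is bounded below (resp. upper semi-Fredholm with index $\le 0$) and $T_{|N}$ is quasi-nilpotent. $\sigma_{gD\mathcal{M}}(T)$ (resp. $\sigma_{gD\mathcal{W}+}(T)$) is the set of $\lambda\in\mathbb{C}$ such that $T-\lambda I$ is not generalized Drazin bounded below (resp. not generalized Drazin upper semi-Weyl). $T$ has SVEP (the single valued extension property) at $\lambda_0\in\mathbb{C}$ if for every connected open neighbourhood $U$ of $\lambda_0$ the only analytic function $f:U\to X$ with $(T-zI)f(z)=0$ for all $z\in U$ is $f\equiv 0$. *)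

theory Defs
  imports "HOL-Analysis.Analysis"
begin

section \<open>Complex Banach spaces\<close>

class complex_banach = banach +
  fixes scaleC :: "complex \<Rightarrow> 'a \<Rightarrow> 'a"  (infixr "*\<^sub>C" 75)
  assumes scaleC_add_right: "a *\<^sub>C (x + y) = a *\<^sub>C x + a *\<^sub>C y"
    and scaleC_add_left: "(a + b) *\<^sub>C x = a *\<^sub>C x + b *\<^sub>C x"
    and scaleC_scaleC: "a *\<^sub>C (b *\<^sub>C x) = (a * b) *\<^sub>C x"
    and scaleC_of_real: "complex_of_real r *\<^sub>C x = r *\<^sub>R x"
    and norm_scaleC: "norm (a *\<^sub>C x) = cmod a * norm x"

instantiation complex :: complex_banach
begin

definition scaleC_complex_def: "scaleC (a::complex) (x::complex) = a * x"

instance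
  by standard (auto simp: scaleC_complex_def algebra_simps norm_mult scaleR_conv_of_real)

end

global_interpretation cvec: vector_space "scaleC :: complex \<Rightarrow> 'a \<Rightarrow> 'a::complex_banach"
proof
  fix a b :: complex and x y :: 'a
  show "a *\<^sub>C (x + y) = a *\<^sub>C x + a *\<^sub>C y" by (rule scaleC_add_right)
  show "(a + b) *\<^sub>C x = a *\<^sub>C x + b *\<^sub>C x" by (rule scaleC_add_left)
  show "a *\<^sub>C (b *\<^sub>C x) = (a * b) *\<^sub>C x" by (rule scaleC_scaleC)
  show "1 *\<^sub>C x = x" using scaleC_of_real[of 1 x] by simp
qed

definition bounded_clinear :: "('a::complex_banach \<Rightarrow> 'a) \<Rightarrow> bool" where
  "bounded_clinear T \<longleftrightarrow> bounded_linear T \<and> (\<forall>c x. T (c *\<^sub>C x) = c *\<^sub>C T x)"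

text \<open>\<open>shift T \<mu>\<close> is \<open>T - \<mu>I\<close>.\<close>

definition shift :: "('a::complex_banach \<Rightarrow> 'a) \<Rightarrow> complex \<Rightarrow> 'a \<Rightarrow> 'a" where
  "shift T \<mu> = (\<lambda>x. T x - \<mu> *\<^sub>C x)"

definition kernel :: "('a::complex_banach \<Rightarrow> 'a) \<Rightarrow> 'a set" where
  "kernel T = {x. T x = 0}"

section \<open>Dimension and codimension\<close>

text \<open>The library's dimension is 0 on infinite-dimensional spaces, hence the case distinction.\<close>

definition ecdim :: "'a::complex_banach set \<Rightarrow> enat" where
  "ecdim V = (if \<exists>B. finite B \<and> V \<subseteq> cvec.span B then enat (cvec.dim V) else \<infinity>)"

text \<open>
  \<open>ecodim M R\<close> is the dimension of the quotient space \<open>M / R\<close>, for subspaces \<open>R \<subseteq> M\<close>: the supremum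
  of the sizes of finite families in \<open>M\<close> whose cosets modulo \<open>R\<close> are linearly independent.
\<close>

definition ecodim :: "'a::complex_banach set \<Rightarrow> 'a set \<Rightarrow> enat" where
  "ecodim M R = (SUP B \<in> {B. finite B \<and> B \<subseteq> M \<and>
      (\<forall>u. (\<Sum>b\<in>B. u b *\<^sub>C b) \<in> R \<longrightarrow> (\<forall>b\<in>B. u b = 0))}. enat (card B))"

section \<open>Restrictions to invariant subspaces\<close>

text \<open>
  A predicate with suffix \<open>_on\<close> speaks about the restriction of \<open>T\<close> to a closed \<open>T\<close>-invariant
  subspace \<open>M\<close>, regarded as an operator on the Banach space \<open>M\<close>; the operator on the whole space is
  the case \<open>M = UNIV\<close>.
\<close>

definition upper_semi_Fredholm_on :: "('a::complex_banach \<Rightarrow> 'a) \<Rightarrow> 'a set \<Rightarrow> bool" where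
  "upper_semi_Fredholm_on T M \<longleftrightarrow>
     ecdim (kernel T \<inter> M) < \<infinity> \<and> closedin (top_of_set M) (T ` M)"

text \<open>Only meaningful for semi-Fredholm restrictions (\<open>\<infinity> - \<infinity>\<close> is a junk value).\<close>

definition index_on :: "('a::complex_banach \<Rightarrow> 'a) \<Rightarrow> 'a set \<Rightarrow> ereal" where
  "index_on T M = ereal_of_enat (ecdim (kernel T \<inter> M)) - ereal_of_enat (ecodim M (T ` M))"

definition upper_semi_Weyl_on :: "('a::complex_banach \<Rightarrow> 'a) \<Rightarrow> 'a set \<Rightarrow> bool" where
  "upper_semi_Weyl_on T M \<longleftrightarrow> upper_semi_Fredholm_on T M \<and> index_on T M \<le> 0"

definition bounded_below_on :: "('a::complex_banach \<Rightarrow> 'a) \<Rightarrow> 'a set \<Rightarrow> bool" where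
  "bounded_below_on T M \<longleftrightarrow> (\<exists>c>0. \<forall>x\<in>M. c * norm x \<le> norm (T x))"

text \<open>The inverse \<open>S\<close> is automatically linear on \<open>M\<close>, so only boundedness is required.\<close>

definition invertible_op_on :: "('a::complex_banach \<Rightarrow> 'a) \<Rightarrow> 'a set \<Rightarrow> bool" where
  "invertible_op_on T M \<longleftrightarrow>
     (\<exists>S K. (\<forall>x\<in>M. S x \<in> M \<and> T (S x) = x \<and> S (T x) = x \<and> norm (S x) \<le> K * norm x))"

definition spectrum_on :: "('a::complex_banach \<Rightarrow> 'a) \<Rightarrow> 'a set \<Rightarrow> complex set" where
  "spectrum_on T M = {\<mu>. \<not> invertible_op_on (shift T \<mu>) M}"

text \<open>Inclusion rather than equality: the spectrum is empty on the zero space.\<close>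

definition quasinilpotent_on :: "('a::complex_banach \<Rightarrow> 'a) \<Rightarrow> 'a set \<Rightarrow> bool" where
  "quasinilpotent_on T M \<longleftrightarrow> spectrum_on T M \<subseteq> {0}"

definition Red :: "('a::complex_banach \<Rightarrow> 'a) \<Rightarrow> ('a set \<times> 'a set) set" where
  "Red T = {(M, N).
     cvec.subspace M \<and> closed M \<and> T ` M \<subseteq> M \<and>
     cvec.subspace N \<and> closed N \<and> T ` N \<subseteq> N \<and>
     {m + n | m n. m \<in> M \<and> n \<in> N} = UNIV \<and> M \<inter> N = {0}}"

section \<open>Spectra and Browder-type theorems\<close>

definition ascent :: "('a::complex_banach \<Rightarrow> 'a) \<Rightarrow> enat" where
  "ascent T = (INF p \<in> {p. kernel (T ^^ p) = kernel (T ^^ Suc p)}. enat p)"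

definition upper_semi_Weyl :: "('a::complex_banach \<Rightarrow> 'a) \<Rightarrow> bool" where
  "upper_semi_Weyl T \<longleftrightarrow> upper_semi_Weyl_on T UNIV"

definition upper_semi_Browder :: "('a::complex_banach \<Rightarrow> 'a) \<Rightarrow> bool" where
  "upper_semi_Browder T \<longleftrightarrow> upper_semi_Fredholm_on T UNIV \<and> ascent T < \<infinity>"

definition spectrum_uW :: "('a::complex_banach \<Rightarrow> 'a) \<Rightarrow> complex set" where
  "spectrum_uW T = {\<mu>. \<not> upper_semi_Weyl (shift T \<mu>)}"

definition spectrum_uB :: "('a::complex_banach \<Rightarrow> 'a) \<Rightarrow> complex set" where
  "spectrum_uB T = {\<mu>. \<not> upper_semi_Browder (shift T \<mu>)}"

definition a_Browder_theorem :: "('a::complex_banach \<Rightarrow> 'a) \<Rightarrow> bool" where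
  "a_Browder_theorem T \<longleftrightarrow> spectrum_uW T = spectrum_uB T"

definition upper_semi_B_Weyl :: "('a::complex_banach \<Rightarrow> 'a) \<Rightarrow> bool" where
  "upper_semi_B_Weyl T \<longleftrightarrow>
     (\<exists>n. closed (range (T ^^ n)) \<and> upper_semi_Weyl_on T (range (T ^^ n)))"

definition left_Drazin_invertible :: "('a::complex_banach \<Rightarrow> 'a) \<Rightarrow> bool" where
  "left_Drazin_invertible T \<longleftrightarrow>
     ascent T < \<infinity> \<and> closed (range (T ^^ (the_enat (ascent T) + 1)))"

definition spectrum_ap :: "('a::complex_banach \<Rightarrow> 'a) \<Rightarrow> complex set" where
  "spectrum_ap T = {\<mu>. \<not> bounded_below_on (shift T \<mu>) UNIV}"

definition left_poles :: "('a::complex_banach \<Rightarrow> 'a) \<Rightarrow> complex set" where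
  "left_poles T = {\<mu> \<in> spectrum_ap T. left_Drazin_invertible (shift T \<mu>)}"

definition generalized_a_Browder_theorem :: "('a::complex_banach \<Rightarrow> 'a) \<Rightarrow> bool" where
  "generalized_a_Browder_theorem T \<longleftrightarrow>
     {\<mu>. \<not> upper_semi_B_Weyl (shift T \<mu>)} = spectrum_ap T - left_poles T"

definition gD_bounded_below :: "('a::complex_banach \<Rightarrow> 'a) \<Rightarrow> bool" where
  "gD_bounded_below T \<longleftrightarrow>
     (\<exists>(M, N) \<in> Red T. bounded_below_on T M \<and> quasinilpotent_on T N)"

definition gD_upper_semi_Weyl :: "('a::complex_banach \<Rightarrow> 'a) \<Rightarrow> bool" where
  "gD_upper_semi_Weyl T \<longleftrightarrow>
     (\<exists>(M, N) \<in> Red T. upper_semi_Weyl_on T M \<and> quasinilpotent_on T N)"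

definition spectrum_gDM :: "('a::complex_banach \<Rightarrow> 'a) \<Rightarrow> complex set" where
  "spectrum_gDM T = {\<mu>. \<not> gD_bounded_below (shift T \<mu>)}"

definition spectrum_gDW_plus :: "('a::complex_banach \<Rightarrow> 'a) \<Rightarrow> complex set" where
  "spectrum_gDW_plus T = {\<mu>. \<not> gD_upper_semi_Weyl (shift T \<mu>)}"

section \<open>The single valued extension property\<close>

text \<open>The library's \<open>holomorphic_on\<close> is restricted to functions with values in a field.\<close>

definition vector_analytic_on :: "(complex \<Rightarrow> 'a::complex_banach) \<Rightarrow> complex set \<Rightarrow> bool" where
  "vector_analytic_on f U \<longleftrightarrow> (\<forall>z\<in>U. \<exists>D. (f has_derivative (\<lambda>h. h *\<^sub>C D)) (at z))"

definition SVEP_at :: "('a::complex_banach \<Rightarrow> 'a) \<Rightarrow> complex \<Rightarrow> bool" where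
  "SVEP_at T \<mu>\<^sub>0 \<longleftrightarrow>
     (\<forall>U f. open U \<and> connected U \<and> \<mu>\<^sub>0 \<in> U \<and> vector_analytic_on f U \<and>
        (\<forall>z\<in>U. shift T z (f z) = 0) \<longrightarrow> (\<forall>z\<in>U. f z = 0))"

end

theory Submission
  imports Defs "HOL-Complex_Analysis.Conformal_Mappings"
begin

text \<open>
  Each of the four conditions amounts to this: for every \<mu>, the upper semi-Weyl restrictions of
  \<open>S = T - \<mu>I\<close> to certain subspaces have finite ascent.  For a-Browder's theorem
  the subspace is the whole space, for the generalized theorem the range of a power of
  \<open>S\<close>, and for SVEP and the equality of the generalized Drazin spectra the first space
  of a reducing pair with quasi-nilpotent second part.  What relates the conditions is a dichotomy
  for an upper semi-Fredholm restriction of \<open>S\<close> to a closed invariant subspace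
  \<open>M\<close>.

  \<^item> If the ascent is finite, then \<open>M\<close> is the direct sum of an invariant subspace
    on which \<open>S\<close> is bounded below and a finite-dimensional one on which
    \<open>S\<close> is nilpotent (\<open>kato_decomposition\<close>). When \<open>M\<close> belongs
    to a reducing pair, this makes \<open>S\<close> generalized Drazin bounded below
    (\<open>gD_bounded_belowI\<close>), and then \<open>S - \<nu>I\<close> is injective for all
    small \<open>\<nu> \<noteq> 0\<close>.

  \<^item> If the ascent is infinite, then \<open>S\<close> maps the intersection \<open>R\<close>
    of the ranges of its iterates on \<open>M\<close> onto \<open>R\<close>, and \<open>R\<close>
    contains an eigenvector for 0.  Taking preimages of this eigenvector again and again, with norms
    under control, gives the Taylor coefficients of an analytic \<open>f\<close> with \<open>(S -
    zI) f(z) = 0\<close> and \<open>f(0) \<noteq> 0\<close>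
    (\<open>eigenfunction_if_infinite_ascent\<close>).

  The function \<open>f\<close> contradicts SVEP at \<mu>, so SVEP implies a-Browder's theorem.  It
  has no zeros near 0, so its existence also means that \<open>S - zI\<close> is injective for no
  \<open>z\<close> close to 0.  Under a-Browder's theorem this is impossible, which yields the
  generalized theorem and the equality of spectra.  Indeed, an upper semi-Weyl operator is a bounded
  below one up to a finite rank perturbation, and conversely, so that small shifts stay upper
  semi-Weyl on \<open>M\<close> (\<open>upper_semi_Weyl_on_shift\<close>).  For small \<open>\<nu>
  \<noteq> 0\<close> the operator \<open>S - \<nu>I\<close> is then upper semi-Weyl even on the
  whole space (\<open>upper_semi_Weyl_shift_of_range\<close>,
  \<open>upper_semi_Weyl_Red_shift\<close>); by a-Browder's theorem it is upper semi-Browder, hence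
  \<open>S - zI\<close> is injective for all \<open>z \<noteq> \<nu>\<close> near \<nu>.  Thus
  \<open>f\<close> cannot exist and the ascent is finite.

  The equality of spectra implies SVEP because a local eigenfunction of a generalized Drazin bounded
  below operator vanishes on a punctured disc, hence everywhere by the identity theorem.  The
  generalized theorem implies a-Browder's theorem since upper semi-Weyl operators are upper semi
  B-Weyl and left Drazin invertible operators have finite ascent.
\<close>

section \<open>The open mapping theorem\<close>

text \<open>
  By Baire, the closure of the image of some ball of \<open>D\<close> has an interior point in the range; taking
  differences moves this point to the origin, and homogeneity then gives approximate preimages.
\<close>

lemma open_mapping_approximate:
  fixes f :: "'b::real_normed_vector \<Rightarrow> 'c::banach"
  assumes f: "bounded_linear f" and D: "subspace D" and W: "closed (f ` D)"
  obtains K where "\<And>w. w \<in> f ` D \<Longrightarrow> \<exists>x\<in>D. norm x \<le> K * norm w \<and> norm (w - f x) \<le> norm w / 2"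
proof -
  interpret f: bounded_linear f by fact
  let ?W = "f ` D" and ?F = "\<lambda>n::nat. closure (f ` (D \<inter> cball 0 (real n)))"
  have "0 \<in> D" using D subspace_0 by blast
  have F_sub: "?F n \<subseteq> ?W" for n
    by (rule closure_minimal) (use W in auto)
  have "?W \<subseteq> (\<Union>n. ?F n)"
  proof
    fix w assume "w \<in> ?W"
    then obtain x where x: "x \<in> D" "w = f x" by auto
    obtain n :: nat where "norm x \<le> n" using real_arch_simple by blast
    then show "w \<in> (\<Union>n. ?F n)"
      using x by (intro UN_I[of n] subsetD[OF closure_subset]) auto
  qed
  with F_sub have Un: "(\<Union>n. ?F n) = ?W" by blast
  have cm: "completely_metrizable_space (top_of_set ?W)"
    using W by (meson closed_closedin completely_metrizable_space_closedin completely_metrizable_space_euclidean)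
  have "\<exists>n. top_of_set ?W interior_of ?F n \<noteq> {}"
  proof (rule ccontr)
    assume "\<not> ?thesis"
    then have "top_of_set ?W interior_of \<Union>(range ?F) = {}"
      by (intro Baire_category_alt) (use cm in \<open>auto intro!: closed_subset F_sub\<close>)
    moreover have "top_of_set ?W interior_of ?W = ?W"
      by (metis interior_of_topspace topspace_euclidean_subtopology)
    ultimately show False using Un \<open>0 \<in> D\<close> by auto
  qed
  then obtain n V w0 where V: "openin (top_of_set ?W) V" "w0 \<in> V" "V \<subseteq> ?F n"
    unfolding interior_of_def by blast
  then obtain r where r: "r > 0" "ball w0 r \<inter> ?W \<subseteq> V"
    by (meson openin_contains_ball)
  have w0: "w0 \<in> ?W" using V F_sub by blast
  \<comment> \<open>A vector of norm \<open>r / 2\<close> has an approximate preimage of norm at most \<open>2 n\<close>, with error \<open>r / 4\<close>; scaling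
    it to norm \<open>norm w\<close> multiplies by \<open>2 * norm w / r\<close>.\<close>
  show ?thesis
  proof (rule that[of "4 * real n / r"])
    fix w assume w: "w \<in> ?W"
    show "\<exists>x\<in>D. norm x \<le> 4 * real n / r * norm w \<and> norm (w - f x) \<le> norm w / 2"
    proof (cases "w = 0")
      case True
      then show ?thesis using \<open>0 \<in> D\<close> by (intro bexI[of _ 0]) auto
    next
      case False
      define u where "u = (r / 2 / norm w) *\<^sub>R w"
      have nu: "norm u = r / 2" using False r by (simp add: u_def)
      have sW: "subspace ?W" using linear_subspace_image[OF f.linear_axioms] D by blast
      have "w0 + u \<in> ?W" using w w0 sW unfolding u_def
        by (meson subspace_add subspace_scale)
      then have "w0 + u \<in> ?F n" using r V nu by (intro subsetD[OF V(3)] subsetD[OF r(2)]) (auto simp: dist_norm)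
      moreover have "w0 \<in> ?F n" using V by auto
      moreover have "r / 8 > 0" using r by simp
      ultimately obtain x1 x2 where x: "x1 \<in> D" "x2 \<in> D" "norm x1 \<le> n" "norm x2 \<le> n"
        "dist (f x1) (w0 + u) < r / 8" "dist (f x2) w0 < r / 8"
        unfolding closure_approachable by (smt (verit) Int_iff imageE mem_cball_0)
      define x where "x = (2 * norm w / r) *\<^sub>R (x1 - x2)"
      have "norm (f (x1 - x2) - u) \<le> r / 4"
      proof -
        have "f (x1 - x2) - u = (f x1 - (w0 + u)) - (f x2 - w0)" by (simp add: f.diff)
        then have "norm (f (x1 - x2) - u) \<le> norm (f x1 - (w0 + u)) + norm (f x2 - w0)"
          using norm_triangle_ineq4[of "f x1 - (w0 + u)" "f x2 - w0"] by (simp only:)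
        then show ?thesis using x(5,6) unfolding dist_norm by linarith
      qed
      moreover have "w - f x = - ((2 * norm w / r) *\<^sub>R (f (x1 - x2) - u))"
        using r False by (simp add: x_def f.scaleR f.diff u_def scaleR_diff_right)
      ultimately have 1: "norm (w - f x) \<le> norm w / 2"
        using r mult_left_mono[of "norm (f (x1 - x2) - u)" "r/4" "2 * norm w / r"]
        by (simp add: abs_mult)
      have "norm (x1 - x2) \<le> 2 * real n" using x norm_triangle_ineq4[of x1 x2] by linarith
      then have 2: "norm x \<le> 4 * real n / r * norm w"
        using r mult_left_mono[of "norm (x1 - x2)" "2 * real n" "2 * norm w / r"]
        by (simp add: x_def abs_mult mult_ac)
      have "x \<in> D" using x D unfolding x_def by (meson subspace_diff subspace_scale)
      then show ?thesis using 1 2 by blast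
    qed
  qed
qed

text \<open>
  The open mapping theorem in the form of a norm-controlled preimage.  Stating it on a closed
  subspace avoids quotients and subspace types: it applies to restrictions of operators, and to sum
  maps on products of subspaces.  The error of an approximate preimage is halved at every step, so
  the corrections form a convergent series.
\<close>

lemma open_mapping_closed_range:
  fixes f :: "'b::banach \<Rightarrow> 'c::banach"
  assumes f: "bounded_linear f" and D: "subspace D" "closed D" and W: "closed (f ` D)"
  obtains C where "C > 0" "\<And>w. w \<in> f ` D \<Longrightarrow> \<exists>x\<in>D. f x = w \<and> norm x \<le> C * norm w"
proof -
  interpret f: bounded_linear f by fact
  obtain K where "\<And>w. w \<in> f ` D \<Longrightarrow> \<exists>x\<in>D. norm x \<le> K * norm w \<and> norm (w - f x) \<le> norm w / 2"
    using open_mapping_approximate[OF f D(1) W] by blast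
  then obtain g where g: "\<And>w. w \<in> f ` D \<Longrightarrow> g w \<in> D"
    "\<And>w. w \<in> f ` D \<Longrightarrow> norm (g w) \<le> K * norm w"
    "\<And>w. w \<in> f ` D \<Longrightarrow> norm (w - f (g w)) \<le> norm w / 2" by metis
  have "\<exists>x\<in>D. f x = w \<and> norm x \<le> (2 * \<bar>K\<bar> + 1) * norm w" if w: "w \<in> f ` D" for w
  proof -
    \<comment> \<open>\<open>ws n\<close> is what is left of \<open>w\<close> after \<open>n\<close> corrections.\<close>
    define ws where "ws = rec_nat w (\<lambda>_ v. v - f (g v))"
    have ws0: "ws 0 = w" and wsS: "ws (Suc n) = ws n - f (g (ws n))" for n
      by (auto simp: ws_def)
    have sW: "subspace (f ` D)" using linear_subspace_image[OF f.linear_axioms] D by blast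
    have wsW: "ws n \<in> f ` D" for n
      by (induction n) (auto simp: ws0 wsS w intro!: subspace_diff[OF sW] imageI g)
    have nws: "norm (ws n) \<le> norm w * (1/2) ^ n" for n
    proof (induction n)
      case (Suc n)
      then show ?case using g(3)[OF wsW[of n]] by (simp add: wsS)
    qed (simp add: ws0)
    define xs where "xs n = g (ws n)" for n
    have nxs: "norm (xs n) \<le> \<bar>K\<bar> * norm w * (1/2) ^ n" for n
    proof -
      have "norm (xs n) \<le> \<bar>K\<bar> * norm (ws n)" using g(2)[OF wsW[of n]]
        by (smt (verit) mult_right_mono norm_ge_zero xs_def)
      also have "\<dots> \<le> \<bar>K\<bar> * (norm w * (1/2) ^ n)" by (intro mult_left_mono nws) auto
      finally show ?thesis by (simp add: mult_ac)
    qed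
    have sg: "(\<lambda>n. \<bar>K\<bar> * norm w * (1/2) ^ n) sums (\<bar>K\<bar> * norm w * 2)"
      using sums_mult[OF geometric_sums[of "1/2::real"], of "\<bar>K\<bar> * norm w"] by simp
    have sn: "summable (\<lambda>n. norm (xs n))"
      by (rule summable_comparison_test[OF _ sums_summable[OF sg]]) (use nxs in auto)
    then have sx: "summable xs" by (rule summable_norm_cancel)
    have "norm (suminf xs) \<le> (\<Sum>n. norm (xs n))" by (rule summable_norm[OF sn])
    also have "\<dots> \<le> \<bar>K\<bar> * norm w * 2"
      using suminf_le[OF nxs sn sums_summable[OF sg]] sums_unique[OF sg] by simp
    finally have n: "norm (suminf xs) \<le> (2 * \<bar>K\<bar> + 1) * norm w"
      by (simp add: algebra_simps) (smt (verit) norm_ge_zero)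
    have part: "(\<lambda>n. sum xs {..<n}) \<longlonglongrightarrow> suminf xs"
      using sx summable_LIMSEQ by blast
    have "sum xs {..<n} \<in> D" for n
      by (rule subspace_sum[OF D(1)]) (auto simp: xs_def g wsW)
    then have inD: "suminf xs \<in> D" using closed_sequentially[OF D(2) _ part] by blast
    have "f (sum xs {..<n}) = w - ws n" for n
      by (induction n) (auto simp: ws0 wsS f.add f.zero xs_def)
    moreover have "ws \<longlonglongrightarrow> 0"
    proof (rule Lim_null_comparison)
      show "\<forall>\<^sub>F n in sequentially. norm (ws n) \<le> norm w * (1/2) ^ n" using nws by simp
      show "(\<lambda>n. norm w * (1/2) ^ n) \<longlonglongrightarrow> 0" using tendsto_mult_right_zero[OF LIMSEQ_power_zero[of "1/2::real"]] by simp
    qed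
    ultimately have "(\<lambda>n. f (sum xs {..<n})) \<longlonglongrightarrow> w" using tendsto_diff[of "\<lambda>_. w" w _ ws 0] by simp
    moreover have "(\<lambda>n. f (sum xs {..<n})) \<longlonglongrightarrow> f (suminf xs)" using part by (rule f.tendsto)
    ultimately have "f (suminf xs) = w" using LIMSEQ_unique by blast
    then show ?thesis using n inD by blast
  qed
  then show ?thesis by (intro that[of "2 * \<bar>K\<bar> + 1"]) auto
qed

section \<open>The Hahn-Banach theorem\<close>

text \<open>
  Only one inequality is required for scalars, because that is what survives infima over chains;
  equality follows.
\<close>

definition sublinear :: "('a::real_vector \<Rightarrow> real) \<Rightarrow> bool" where
  "sublinear p \<longleftrightarrow> (\<forall>x y. p (x + y) \<le> p x + p y) \<and> (\<forall>t>0. \<forall>x. p (t *\<^sub>R x) \<le> t * p x)"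

lemma sublinear_add: "sublinear p \<Longrightarrow> p (x + y) \<le> p x + p y"
  by (simp add: sublinear_def)

lemma sublinear_scaleR:
  assumes "sublinear p" "t > 0" shows "p (t *\<^sub>R x) = t * p x"
proof -
  have "p ((1/t) *\<^sub>R (t *\<^sub>R x)) \<le> (1/t) * p (t *\<^sub>R x)"
    using assms unfolding sublinear_def by (meson zero_less_divide_1_iff)
  then have "t * p x \<le> p (t *\<^sub>R x)" using assms by (simp add: field_simps)
  then show ?thesis using assms unfolding sublinear_def by (meson antisym)
qed

lemma sublinear_zero: "sublinear p \<Longrightarrow> p 0 = 0"
  using sublinear_scaleR[of p 2 0] by simp

lemma sublinear_ge: "sublinear p \<Longrightarrow> - p (- x) \<le> p x"
  using sublinear_add[of p x "- x"] sublinear_zero[of p] by simp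

text \<open>
  The infimum is finite since sublinearity gives the lower bound \<open>- p (- x)\<close>.  The chain condition is
  what makes the infimum subadditive: of two members, the smaller one can be used for both summands.
\<close>

lemma sublinear_INF_chain:
  fixes p :: "'a::real_vector \<Rightarrow> real"
  assumes C: "C \<noteq> {}" "\<And>q. q \<in> C \<Longrightarrow> sublinear q" "\<And>q. q \<in> C \<Longrightarrow> q \<le> p"
    and chain: "\<And>q r. q \<in> C \<Longrightarrow> r \<in> C \<Longrightarrow> q \<le> r \<or> r \<le> q"
  shows "sublinear (\<lambda>x. INF q\<in>C. q x)" "q \<in> C \<Longrightarrow> (INF q\<in>C. q x) \<le> q x"
proof -
  have bdd: "bdd_below ((\<lambda>q. q x) ` C)" for x
  proof (rule bdd_belowI2)
    fix q assume q: "q \<in> C"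
    show "- p (- x) \<le> q x" using sublinear_ge[OF C(2)[OF q], of x] C(3)[OF q] by (meson le_funD neg_le_iff_le order_trans)
  qed
  show low: "(INF q\<in>C. q x) \<le> q x" if "q \<in> C" for q x
    using bdd that by (rule cINF_lower)
  let ?u = "\<lambda>x. INF q\<in>C. q x"
  have "?u (x + y) \<le> ?u x + ?u y" for x y
  proof -
    have "?u (x + y) \<le> q x + r y" if qr: "q \<in> C" "r \<in> C" for q r
    proof (cases "q \<le> r")
      case True
      then show ?thesis using low[OF qr(1), of "x + y"] sublinear_add[OF C(2)[OF qr(1)], of x y]
        by (smt (verit) le_funD)
    next
      case False
      then have "r \<le> q" using chain qr by blast
      then show ?thesis using low[OF qr(2), of "x + y"] sublinear_add[OF C(2)[OF qr(2)], of x y]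
        by (smt (verit) le_funD)
    qed
    then have "?u (x + y) - q x \<le> r y" if "q \<in> C" "r \<in> C" for q r
      using that by (simp add: diff_le_eq) (metis add.commute)
    then have "?u (x + y) - q x \<le> ?u y" if "q \<in> C" for q
      using C(1) that by (intro cINF_greatest) auto
    then have "?u (x + y) - ?u y \<le> q x" if "q \<in> C" for q
      using that by (smt (verit))
    then have "?u (x + y) - ?u y \<le> ?u x"
      using C(1) by (intro cINF_greatest)
    then show ?thesis by simp
  qed
  moreover have "?u (t *\<^sub>R x) \<le> t * ?u x" if "t > 0" for t x
  proof -
    have "?u (t *\<^sub>R x) / t \<le> q x" if "q \<in> C" for q
      using low[OF that, of "t *\<^sub>R x"] sublinear_scaleR[OF C(2)[OF that] \<open>t > 0\<close>, of x] \<open>t > 0\<close>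
      by (simp add: field_simps)
    then have "?u (t *\<^sub>R x) / t \<le> ?u x" using C(1) by (intro cINF_greatest)
    then show ?thesis using that by (simp add: field_simps)
  qed
  ultimately show "sublinear ?u" by (simp add: sublinear_def)
qed

lemma minimal_sublinear_exists:
  fixes p :: "'a::real_vector \<Rightarrow> real"
  assumes "sublinear p"
  obtains q where "sublinear q" "q \<le> p" "\<And>r. sublinear r \<Longrightarrow> r \<le> q \<Longrightarrow> r = q"
proof -
  let ?A = "{q. sublinear q \<and> q \<le> p}"
  have "\<exists>m\<in>?A. \<forall>a\<in>?A. a \<le> m \<longrightarrow> a = m"
  proof (rule predicate_Zorn)
    show "partial_order_on ?A (relation_of (\<lambda>q r. r \<le> q) ?A)"
      by (rule partial_order_on_relation_ofI) auto
    fix C assume "C \<in> Chains (relation_of (\<lambda>q r. r \<le> q) ?A)"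
    then have CA: "C \<subseteq> ?A" and chain: "\<And>q r. q \<in> C \<Longrightarrow> r \<in> C \<Longrightarrow> q \<le> r \<or> r \<le> q"
      unfolding Chains_def relation_of_def by auto
    show "\<exists>u\<in>?A. \<forall>a\<in>C. u \<le> a"
    proof (cases "C = {}")
      case False
      then obtain q0 where q0: "q0 \<in> C" by blast
      let ?u = "\<lambda>x. INF q\<in>C. q x"
      have u: "sublinear ?u" "\<And>q x. q \<in> C \<Longrightarrow> ?u x \<le> q x"
        using sublinear_INF_chain[of C p] False CA chain by blast+
      have uq: "?u \<le> q" if "q \<in> C" for q using u(2)[OF that] by (rule le_funI)
      have "q0 \<le> p" using q0 CA by blast
      with uq[OF q0] have "?u \<le> p" by (rule order_trans)
      then show ?thesis using u(1) uq by (intro bexI[of _ ?u]) blast+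
    qed (use assms in auto)
  qed
  then obtain m where m: "sublinear m" "m \<le> p" "\<And>a. sublinear a \<Longrightarrow> a \<le> p \<Longrightarrow> a \<le> m \<Longrightarrow> a = m"
    by blast
  then show ?thesis using that[of m] order_trans[of _ m p] by blast
qed

text \<open>
  The infimum over \<open>t \<ge> 0\<close> of \<open>q (x + t y) - t q y\<close> is again sublinear and becomes odd in the direction
  \<open>y\<close>.  Hence a minimal sublinear functional is odd in every direction, that is, linear.
\<close>

lemma sublinear_below_in_direction:
  fixes q :: "'a::real_vector \<Rightarrow> real"
  assumes q: "sublinear q"
  obtains r where "sublinear r" "r \<le> q" "r (- y) \<le> - q y"
proof -
  define h where "h x t = q (x + t *\<^sub>R y) - t * q y" for x t
  define r where "r x = (INF t\<in>{0..}. h x t)" for x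
  have nn: "t * q y = q (t *\<^sub>R y)" if "t \<ge> 0" for t
    using that sublinear_scaleR[OF q, of t y] sublinear_zero[OF q] by (cases "t = 0") auto
  have bdd: "bdd_below (h x ` {0..})" for x
  proof (rule bdd_belowI2)
    fix t :: real assume "t \<in> {0..}"
    then show "- q (- x) \<le> h x t"
      using sublinear_add[OF q, of "x + t *\<^sub>R y" "- x"] nn[of t] by (simp add: h_def)
  qed
  have low: "r x \<le> h x t" if "t \<ge> 0" for x t
    unfolding r_def using bdd that by (intro cINF_lower) auto
  have great: "c \<le> r x" if "\<And>t. t \<ge> 0 \<Longrightarrow> c \<le> h x t" for c x
    unfolding r_def using that by (intro cINF_greatest) auto
  have "r (x + x') \<le> r x + r x'" for x x'
  proof -
    have "r (x + x') \<le> h x s + h x' t" if "s \<ge> 0" "t \<ge> 0" for s t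
    proof -
      have "x + x' + (s + t) *\<^sub>R y = (x + s *\<^sub>R y) + (x' + t *\<^sub>R y)"
        by (simp add: scaleR_add_left)
      then have "h (x + x') (s + t) \<le> h x s + h x' t"
        using sublinear_add[OF q, of "x + s *\<^sub>R y" "x' + t *\<^sub>R y"] by (simp add: h_def algebra_simps)
      then show ?thesis using low[of "s + t" "x + x'"] that by linarith
    qed
    then have "r (x + x') - h x s \<le> h x' t" if "s \<ge> 0" "t \<ge> 0" for s t
      using that by (smt (verit))
    then have "r (x + x') - h x s \<le> r x'" if "s \<ge> 0" for s
      using that by (intro great) auto
    then have "r (x + x') - r x' \<le> h x s" if "s \<ge> 0" for s
      using that by (smt (verit))
    then have "r (x + x') - r x' \<le> r x" by (rule great)
    then show ?thesis by simp
  qed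
  moreover have "r (c *\<^sub>R x) \<le> c * r x" if c: "c > 0" for c x
  proof -
    have "r (c *\<^sub>R x) / c \<le> h x t" if "t \<ge> 0" for t
    proof -
      have "h (c *\<^sub>R x) (c * t) = c * h x t"
        using sublinear_scaleR[OF q c, of "x + t *\<^sub>R y"] by (simp add: h_def algebra_simps)
      then show ?thesis using low[of "c * t" "c *\<^sub>R x"] c that by (simp add: field_simps)
    qed
    then have "r (c *\<^sub>R x) / c \<le> r x" by (rule great)
    then show ?thesis using c by (simp add: field_simps)
  qed
  ultimately have "sublinear r" by (simp add: sublinear_def)
  moreover have "r \<le> q" using low[of 0] by (auto simp: h_def intro: le_funI)
  moreover have "r (- y) \<le> - q y"
    using low[of 1 "- y"] sublinear_zero[OF q] by (simp add: h_def)
  ultimately show ?thesis by (rule that)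
qed

text \<open>
  Minimal sublinear functionals are linear, so Zorn's lemma applied to functionals on the whole space
  replaces the usual extension from subspace to subspace.
\<close>

theorem hahn_banach_sublinear:
  fixes p :: "'a::real_vector \<Rightarrow> real"
  assumes p: "sublinear p"
  obtains u where "linear u" "\<And>x. u x \<le> p x" "u x0 = p x0"
proof -
  obtain p' where p': "sublinear p'" "p' \<le> p" "p' (- x0) \<le> - p x0"
    using sublinear_below_in_direction[OF p] by blast
  obtain q where q: "sublinear q" "q \<le> p'" and min: "\<And>r. sublinear r \<Longrightarrow> r \<le> q \<Longrightarrow> r = q"
    using minimal_sublinear_exists[OF p'(1)] by metis
  have neg: "q (- y) = - q y" for y
  proof -
    obtain r where "sublinear r" "r \<le> q" "r (- y) \<le> - q y"
      using sublinear_below_in_direction[OF q(1)] by blast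
    then have "q (- y) \<le> - q y" using min by metis
    then show ?thesis using sublinear_ge[OF q(1), of y] by simp
  qed
  have "linear q"
  proof (rule linearI)
    show "q (x + y) = q x + q y" for x y
      using sublinear_add[OF q(1), of x y] sublinear_add[OF q(1), of "- x" "- y"] neg[of "x + y"] neg[of x] neg[of y]
      by simp
    show "q (c *\<^sub>R x) = c *\<^sub>R q x" for c x
      using sublinear_scaleR[OF q(1), of c x] sublinear_scaleR[OF q(1), of "- c" x] neg[of "c *\<^sub>R x"] sublinear_zero[OF q(1)]
      by (cases c "0::real" rule: linorder_cases) auto
  qed
  moreover have le: "q x \<le> p x" for x using q(2) p'(2) by (meson le_funD order_trans)
  moreover have "q x0 = p x0"
    using le[of x0] le_funD[OF q(2), of "- x0"] p'(3) neg[of x0] by simp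
  ultimately show ?thesis by (rule that)
qed

definition cfunctional :: "('a::complex_banach \<Rightarrow> complex) \<Rightarrow> bool" where
  "cfunctional \<phi> \<longleftrightarrow> bounded_linear \<phi> \<and> (\<forall>c x. \<phi> (c *\<^sub>C x) = c * \<phi> x)"

lemma scaleR_eq_scaleC: "r *\<^sub>R x = complex_of_real r *\<^sub>C (x::'a::complex_banach)"
  by (simp add: scaleC_of_real)

lemma csubspace_imp_subspace: "cvec.subspace L \<Longrightarrow> subspace L"
  by (auto simp: cvec.subspace_def subspace_def scaleR_eq_scaleC)

text \<open>
  Hahn-Banach for the seminorm distance to \<open>L\<close> gives a real functional \<open>u\<close> that vanishes on \<open>L\<close>; its
  complexification is \<open>u x - \<i> u (\<i> x)\<close>.
\<close>

theorem separating_functional: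
  assumes L: "cvec.subspace L" "closed L" and x0: "x0 \<notin> (L :: 'a::complex_banach set)"
  obtains \<phi> where "cfunctional \<phi>" "\<And>x. x \<in> L \<Longrightarrow> \<phi> x = 0" "\<phi> x0 = 1"
proof -
  have zL: "0 \<in> L" using L cvec.subspace_0 by blast
  have ne: "L \<noteq> {}" using zL by blast
  define p where "p x = infdist x L" for x
  have pl: "p x \<le> norm (x - a)" if "a \<in> L" for x a
    using infdist_le[OF that, of x] by (simp add: p_def dist_norm)
  have pg: "c \<le> p x" if "\<And>a. a \<in> L \<Longrightarrow> c \<le> norm (x - a)" for c x
    unfolding p_def infdist_notempty[OF ne] using ne that by (intro cINF_greatest) (auto simp: dist_norm)
  have "sublinear p"
    unfolding sublinear_def
  proof (intro conjI allI impI)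
    fix x y
    have "p (x + y) \<le> norm (x - a) + norm (y - b)" if "a \<in> L" "b \<in> L" for a b
    proof -
      have "p (x + y) \<le> norm (x + y - (a + b))" using that L by (intro pl cvec.subspace_add)
      also have "\<dots> \<le> norm (x - a) + norm (y - b)"
        using norm_triangle_ineq[of "x - a" "y - b"] by (simp add: algebra_simps)
      finally show ?thesis .
    qed
    then have "p (x + y) - norm (x - a) \<le> norm (y - b)" if "a \<in> L" "b \<in> L" for a b
      using that by (smt (verit))
    then have "p (x + y) - norm (x - a) \<le> p y" if "a \<in> L" for a
      using that by (intro pg) auto
    then have "p (x + y) - p y \<le> norm (x - a)" if "a \<in> L" for a
      using that by (smt (verit))
    then have "p (x + y) - p y \<le> p x" by (rule pg)
    then show "p (x + y) \<le> p x + p y" by simp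
  next
    fix t :: real and x assume t: "t > 0"
    have "p (t *\<^sub>R x) / t \<le> norm (x - a)" if "a \<in> L" for a
    proof -
      have "p (t *\<^sub>R x) \<le> norm (t *\<^sub>R x - t *\<^sub>R a)"
        using that L by (intro pl) (simp add: scaleR_eq_scaleC cvec.subspace_scale)
      also have "\<dots> = t * norm (x - a)" using t by (simp flip: scaleR_diff_right)
      finally show ?thesis using t by (simp add: field_simps)
    qed
    then have "p (t *\<^sub>R x) / t \<le> p x" by (rule pg)
    then show "p (t *\<^sub>R x) \<le> t * p x" using t by (simp add: field_simps)
  qed
  then obtain u where u: "linear u" "\<And>x. u x \<le> p x" "u x0 = p x0"
    using hahn_banach_sublinear by blast
  interpret u: linear u by fact
  have ub: "\<bar>u x\<bar> \<le> norm x" for x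
    using u(2)[of x] u(2)[of "- x"] pl[OF zL, of x] pl[OF zL, of "- x"] u.neg[of x] by simp
  have uL: "u x = 0" if "x \<in> L" for x
    using u(2)[of x] u(2)[of "- x"] pl[OF that, of x] pl[of "- x" "- x"] u.neg[of x]
      cvec.subspace_neg[OF L(1) that] by simp
  have pos: "u x0 > 0"
    using u(3) x0 L(2) ne in_closed_iff_infdist_zero[of L x0] infdist_nonneg[of x0 L] by (simp add: p_def)
  define \<psi> where "\<psi> x = Complex (u x) (- u (\<i> *\<^sub>C x))" for x
  have scl: "\<psi> (c *\<^sub>C x) = c * \<psi> x" for c x
  proof -
    have c: "c *\<^sub>C x = Re c *\<^sub>R x + Im c *\<^sub>R (\<i> *\<^sub>C x)" for c and x :: 'a
    proof -
      have "c *\<^sub>C x = (complex_of_real (Re c) + complex_of_real (Im c) * \<i>) *\<^sub>C x"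
        using arg_cong[OF complex_eq[of c], of "\<lambda>c. c *\<^sub>C x"] by (simp only: mult.commute)
      then show ?thesis by (simp only: scaleR_eq_scaleC scaleC_scaleC scaleC_add_left)
    qed
    have ii: "\<i> *\<^sub>C (\<i> *\<^sub>C x) = - x"
      using scaleR_eq_scaleC[of "-1" x] by (simp add: scaleC_scaleC)
    have "\<i> *\<^sub>C (c *\<^sub>C x) = Re c *\<^sub>R (\<i> *\<^sub>C x) + Im c *\<^sub>R (- x)"
      using c[of c "\<i> *\<^sub>C x"] ii by (simp add: scaleC_scaleC mult.commute)
    then show ?thesis
      unfolding \<psi>_def c[of c x] by (simp add: u.add u.scaleR u.neg complex_eq_iff u.scale u.diff)
  qed
  have blin: "bounded_linear \<psi>"
  proof (rule bounded_linear_intro[where K=2])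
    show "\<psi> (x + y) = \<psi> x + \<psi> y" for x y
      by (simp add: \<psi>_def u.add scaleC_add_right complex_eq_iff)
    show "\<psi> (r *\<^sub>R x) = r *\<^sub>R \<psi> x" for r x
      using scl[of "complex_of_real r" x] by (simp add: scaleC_of_real scaleR_conv_of_real)
    show "norm (\<psi> x) \<le> norm x * 2" for x
      using cmod_le[of "\<psi> x"] ub[of x] ub[of "\<i> *\<^sub>C x"] by (simp add: \<psi>_def norm_scaleC)
  qed
  have nz: "\<psi> x0 \<noteq> 0" using pos by (auto simp: \<psi>_def complex_eq_iff)
  show ?thesis
  proof (rule that[of "\<lambda>x. \<psi> x / \<psi> x0"])
    show "cfunctional (\<lambda>x. \<psi> x / \<psi> x0)"
      unfolding cfunctional_def by (auto simp: scl intro: bounded_linear_compose[OF bounded_linear_divide blin])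
    show "\<psi> x / \<psi> x0 = 0" if "x \<in> L" for x
      using uL[OF that] uL[of "\<i> *\<^sub>C x"] that L by (simp add: \<psi>_def cvec.subspace_scale flip: zero_complex.code)
  qed (use nz in auto)
qed

section \<open>Linear independence modulo a subspace\<close>

text \<open>
  The families counted by \<open>ecodim\<close>; for \<open>R = {0}\<close> this is linear independence of a finite set.  Working
  with such families instead of quotient spaces turns every index computation into an exchange
  argument.
\<close>

definition indep_mod :: "'a::complex_banach set \<Rightarrow> 'a set \<Rightarrow> bool" where
  "indep_mod R B \<longleftrightarrow> finite B \<and> (\<forall>u. (\<Sum>b\<in>B. u b *\<^sub>C b) \<in> R \<longrightarrow> (\<forall>b\<in>B. u b = 0))"

lemma indep_modI:
  "finite B \<Longrightarrow> (\<And>u. (\<Sum>b\<in>B. u b *\<^sub>C b) \<in> R \<Longrightarrow> \<forall>b\<in>B. u b = 0) \<Longrightarrow> indep_mod R B"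
  by (simp add: indep_mod_def)

lemma indep_modD: "indep_mod R B \<Longrightarrow> (\<Sum>b\<in>B. u b *\<^sub>C b) \<in> R \<Longrightarrow> b \<in> B \<Longrightarrow> u b = 0"
  by (simp add: indep_mod_def)

lemma indep_mod_finite: "indep_mod R B \<Longrightarrow> finite B"
  by (simp add: indep_mod_def)

lemma indep_mod_empty [simp]: "indep_mod R {}"
  by (simp add: indep_mod_def)

lemma indep_mod_antimono: "indep_mod R B \<Longrightarrow> R' \<subseteq> R \<Longrightarrow> indep_mod R' B"
  by (auto simp: indep_mod_def)

lemma indep_mod_subset:
  assumes "indep_mod R B" "B' \<subseteq> B"
  shows "indep_mod R B'"
proof (rule indep_modI)
  show "finite B'" using assms finite_subset indep_mod_finite by blast
  fix u assume u: "(\<Sum>b\<in>B'. u b *\<^sub>C b) \<in> R"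
  have "(\<Sum>b\<in>B. (if b \<in> B' then u b else 0) *\<^sub>C b) = (\<Sum>b\<in>B'. u b *\<^sub>C b)"
    by (rule sum.mono_neutral_cong_right) (use assms indep_mod_finite in auto)
  then have "\<And>b. b \<in> B \<Longrightarrow> (if b \<in> B' then u b else 0) = 0"
    using indep_modD[OF assms(1), of "\<lambda>b. if b \<in> B' then u b else 0"] u by simp
  then show "\<forall>b\<in>B'. u b = 0" using assms(2) by (meson subsetD)
qed

lemma indep_mod_not_in:
  assumes "indep_mod R B" "b \<in> B"
  shows "b \<notin> R"
proof
  assume "b \<in> R"
  then have "(\<Sum>x\<in>{b}. 1 *\<^sub>C x) \<in> R" by simp
  moreover have "indep_mod R {b}" using assms by (intro indep_mod_subset[OF assms(1)]) auto
  ultimately show False using indep_modD[of R "{b}" "\<lambda>_. 1" b] by simp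
qed

lemma indep_mod_zero_iff: "indep_mod {0} B \<longleftrightarrow> finite B \<and> cvec.independent B"
  by (cases "finite B") (simp add: indep_mod_def cvec.dependent_finite, blast, simp add: indep_mod_def)

lemma indep_mod_insert:
  assumes R: "cvec.subspace R" and B: "indep_mod R B" and b: "b \<notin> cvec.span (R \<union> B)"
  shows "indep_mod R (insert b B)"
proof (rule indep_modI)
  have fin: "finite B" using B by (rule indep_mod_finite)
  then show "finite (insert b B)" by simp
  have bB: "b \<notin> B" using b cvec.span_base[of b "R \<union> B"] by blast
  fix u assume u: "(\<Sum>x\<in>insert b B. u x *\<^sub>C x) \<in> R"
  let ?s = "\<Sum>x\<in>B. u x *\<^sub>C x"
  have us: "u b *\<^sub>C b + ?s \<in> R" using u fin bB by simp
  have ub: "u b = 0"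
  proof (rule ccontr)
    assume "u b \<noteq> 0"
    have "u b *\<^sub>C b + ?s \<in> cvec.span (R \<union> B)" using us by (intro cvec.span_base) simp
    moreover have "?s \<in> cvec.span (R \<union> B)"
      by (intro cvec.span_sum cvec.span_scale cvec.span_base) simp
    ultimately have "(u b *\<^sub>C b + ?s) - ?s \<in> cvec.span (R \<union> B)" by (rule cvec.span_diff)
    then have "inverse (u b) *\<^sub>C (u b *\<^sub>C b) \<in> cvec.span (R \<union> B)" using cvec.span_scale by force
    moreover have "inverse (u b) *\<^sub>C (u b *\<^sub>C b) = b" using \<open>u b \<noteq> 0\<close> by (simp add: scaleC_scaleC del: cvec.scale_cancel_left)
    ultimately show False using b by simp
  qed
  then have "\<forall>x\<in>B. u x = 0" using us B by (auto simp: indep_mod_def)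
  with ub show "\<forall>x\<in>insert b B. u x = 0" by simp
qed

text \<open>
  If adding \<open>v\<close> to \<open>R\<close> creates a relation, then this relation involves some \<open>b0\<close> of the family
  essentially, and it expresses \<open>v\<close> modulo \<open>R\<close>; without \<open>b0\<close> no relation can be left.
\<close>

lemma indep_mod_exchange_one:
  assumes R: "cvec.subspace R" and B: "indep_mod R B"
  obtains B' where "B' \<subseteq> B" "card B \<le> Suc (card B')" "indep_mod (cvec.span (insert v R)) B'"
proof (cases "indep_mod (cvec.span (insert v R)) B")
  case True
  then show ?thesis by (intro that[of B]) auto
next
  case False
  have fin: "finite B" using B by (rule indep_mod_finite)
  have sp: "x \<in> cvec.span (insert v R) \<longleftrightarrow> (\<exists>k. x - k *\<^sub>C v \<in> R)" for x
    using R by (simp add: cvec.span_insert cvec.span_eq_iff[THEN iffD2])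
  obtain u b0 c where u: "(\<Sum>b\<in>B. u b *\<^sub>C b) - c *\<^sub>C v \<in> R" and b0: "b0 \<in> B" "u b0 \<noteq> 0"
    using False fin by (auto simp: indep_mod_def sp)
  let ?s = "\<Sum>b\<in>B. u b *\<^sub>C b"
  have c: "c \<noteq> 0" using indep_modD[OF B, of u b0] u b0 by auto
  have "indep_mod (cvec.span (insert v R)) (B - {b0})"
  proof (rule indep_modI)
    show "finite (B - {b0})" using fin by simp
    fix w assume "(\<Sum>b\<in>B - {b0}. w b *\<^sub>C b) \<in> cvec.span (insert v R)"
    then obtain k where k: "(\<Sum>b\<in>B - {b0}. w b *\<^sub>C b) - k *\<^sub>C v \<in> R" using sp by blast
    \<comment> \<open>Subtracting the multiple \<open>k / c\<close> of the given relation eliminates \<open>v\<close>.\<close>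
    define w' where "w' b = (if b = b0 then 0 else w b)" for b
    have "(\<Sum>b\<in>B. w' b *\<^sub>C b) = (\<Sum>b\<in>B - {b0}. w b *\<^sub>C b)"
      by (rule sum.mono_neutral_cong_right) (use fin in \<open>auto simp: w'_def\<close>)
    then have 1: "(\<Sum>b\<in>B. w' b *\<^sub>C b) - k *\<^sub>C v \<in> R" using k by simp
    have 2: "(k / c) *\<^sub>C (?s - c *\<^sub>C v) \<in> R" using u R by (intro cvec.subspace_scale)
    have "((\<Sum>b\<in>B. w' b *\<^sub>C b) - k *\<^sub>C v) - (k / c) *\<^sub>C (?s - c *\<^sub>C v) = (\<Sum>b\<in>B. (w' b - k / c * u b) *\<^sub>C b)"
      using c by (simp add: cvec.scale_right_diff_distrib cvec.scale_left_diff_distrib cvec.scale_sum_right sum_subtractf)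
    then have "(\<Sum>b\<in>B. (w' b - k / c * u b) *\<^sub>C b) \<in> R"
      using cvec.subspace_diff[OF R 1 2] by simp
    then have z: "w' b - k / c * u b = 0" if "b \<in> B" for b
      using indep_modD[OF B, of "\<lambda>b. w' b - k / c * u b" b] that by simp
    from z[OF b0(1)] have "k = 0" using b0 c by (simp add: w'_def)
    with z have "w' b = 0" if "b \<in> B" for b using that by simp
    then show "\<forall>b\<in>B - {b0}. w b = 0" by (metis DiffE insertI1 w'_def)
  qed
  moreover have "card B \<le> Suc (card (B - {b0}))" using fin b0 by (simp add: card_Diff_singleton)
  ultimately show ?thesis by (intro that[of "B - {b0}"]) auto
qed

text \<open>
  Enlarging the modulus by \<open>card V\<close> vectors costs at most \<open>card V\<close> members of an independent family:
  the codimension drops by at most the number of vectors added.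
\<close>

lemma indep_mod_exchange:
  assumes "finite V" "cvec.subspace R" "indep_mod R B"
  obtains B' where "B' \<subseteq> B" "card B \<le> card B' + card V" "indep_mod (cvec.span (R \<union> V)) B'"
  using assms
proof (induction V arbitrary: thesis rule: finite_induct)
  case empty
  then show ?case by (metis Un_empty_right add.right_neutral card.empty cvec.span_eq_iff order_refl)
next
  case (insert v V)
  obtain B1 where B1: "B1 \<subseteq> B" "card B \<le> card B1 + card V" "indep_mod (cvec.span (R \<union> V)) B1"
    using insert by blast
  obtain B2 where B2: "B2 \<subseteq> B1" "card B1 \<le> Suc (card B2)"
      "indep_mod (cvec.span (insert v (cvec.span (R \<union> V)))) B2"
    using indep_mod_exchange_one[OF cvec.subspace_span B1(3)] by blast
  have "cvec.span (R \<union> insert v V) \<subseteq> cvec.span (insert v (cvec.span (R \<union> V)))"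
    by (intro cvec.span_mono) (auto intro: cvec.span_base)
  then have "indep_mod (cvec.span (R \<union> insert v V)) B2"
    using B2 indep_mod_antimono by blast
  then show ?case using B1 B2 insert by (intro insert.prems(1)[of B2]) auto
qed

lemma indep_mod_card_le:
  assumes "finite V" "cvec.subspace R" "indep_mod R B" "B \<subseteq> cvec.span (R \<union> V)"
  shows "card B \<le> card V"
proof -
  obtain B' where B': "B' \<subseteq> B" "card B \<le> card B' + card V" "indep_mod (cvec.span (R \<union> V)) B'"
    using indep_mod_exchange assms by blast
  then have "B' = {}" using indep_mod_not_in assms(4) by blast
  then show ?thesis using B' by simp
qed

text \<open>
  The basis extension theorem modulo \<open>R\<close>.
\<close>

lemma indep_mod_extend:
  assumes "finite G" "cvec.subspace R" "indep_mod R K"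
  obtains G' where "G' \<subseteq> G" "K \<inter> G' = {}" "indep_mod R (K \<union> G')" "G \<subseteq> cvec.span (R \<union> (K \<union> G'))"
  using assms
proof (induction G arbitrary: thesis rule: finite_induct)
  case empty
  then show ?case by (intro empty.prems(1)[of "{}"]) auto
next
  case (insert g G)
  obtain G' where G': "G' \<subseteq> G" "K \<inter> G' = {}" "indep_mod R (K \<union> G')" "G \<subseteq> cvec.span (R \<union> (K \<union> G'))"
    using insert by blast
  show ?case
  proof (cases "g \<in> cvec.span (R \<union> (K \<union> G'))")
    case True
    then show ?thesis using G' by (intro insert.prems(1)[of G']) auto
  next
    case False
    have "indep_mod R (insert g (K \<union> G'))"
      by (rule indep_mod_insert[OF insert.prems(2) G'(3) False])
    moreover have "g \<notin> K" using False cvec.span_base[of g "R \<union> (K \<union> G')"] by blast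
    moreover have "G \<subseteq> cvec.span (R \<union> (K \<union> insert g G'))"
      using G'(4) cvec.span_mono[of "R \<union> (K \<union> G')" "R \<union> (K \<union> insert g G')"] by auto
    ultimately show ?thesis using G'
      by (intro insert.prems(1)[of "insert g G'"]) (auto intro: cvec.span_base)
  qed
qed

section \<open>Finite dimension and codimension\<close>

definition fdim :: "'a::complex_banach set \<Rightarrow> bool" where
  "fdim V \<longleftrightarrow> (\<exists>B. finite B \<and> V \<subseteq> cvec.span B)"

lemma ecdim_finite_iff: "ecdim V < \<infinity> \<longleftrightarrow> fdim V"
  by (simp add: ecdim_def fdim_def)

lemma fdim_subset: "fdim V \<Longrightarrow> W \<subseteq> V \<Longrightarrow> fdim W"
  unfolding fdim_def by blast

lemma fdim_basis:
  assumes "cvec.subspace V" "fdim V"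
  obtains B where "B \<subseteq> V" "cvec.span B = V" "indep_mod {0} B" "ecdim V = enat (card B)"
proof -
  obtain F where F: "finite F" "V \<subseteq> cvec.span F" using assms by (auto simp: fdim_def)
  obtain B where B: "B \<subseteq> V" "cvec.independent B" "V \<subseteq> cvec.span B" "card B = cvec.dim V"
    using cvec.basis_exists by blast
  have "finite B" using cvec.independent_span_bound[of F B] F B by blast
  moreover have "ecdim V = enat (card B)"
    using assms(2) B(4) by (auto simp: ecdim_def fdim_def)
  ultimately show ?thesis
    using B that[of B] cvec.span_subspace[OF B(1,3) assms(1)] by (simp add: indep_mod_zero_iff)
qed

lemma fdimI:
  assumes "\<And>B. B \<subseteq> V \<Longrightarrow> indep_mod {0} B \<Longrightarrow> card B \<le> n"
  shows "fdim V"
proof -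
  obtain B where B: "B \<subseteq> V" "cvec.independent B" "V \<subseteq> cvec.span B"
    using cvec.basis_exists by metis
  have "finite B"
  proof (rule ccontr)
    assume "infinite B"
    then obtain C where C: "C \<subseteq> B" "finite C" "card C = Suc n" using infinite_arbitrarily_large by metis
    then have "indep_mod {0} C" using cvec.independent_mono[OF B(2) C(1)] by (simp add: indep_mod_zero_iff)
    then show False using assms[of C] C B by auto
  qed
  then show ?thesis using B by (auto simp: fdim_def)
qed

lemma ecodim_indep_mod: "ecodim M R = (SUP B \<in> {B. B \<subseteq> M \<and> indep_mod R B}. enat (card B))"
  unfolding ecodim_def indep_mod_def by (rule arg_cong[where f = Sup]) auto

lemma ecodim_ge: "indep_mod R B \<Longrightarrow> B \<subseteq> M \<Longrightarrow> enat (card B) \<le> ecodim M R"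
  unfolding ecodim_indep_mod by (intro SUP_upper) auto

lemma ecodim_geE:
  assumes "enat n \<le> ecodim M R"
  obtains B where "B \<subseteq> M" "indep_mod R B" "card B = n"
proof (cases n)
  case 0
  then show ?thesis using that[of "{}"] by simp
next
  case (Suc m)
  then have "enat m < ecodim M R" using assms Suc_ile_eq by blast
  then obtain B where B: "B \<subseteq> M" "indep_mod R B" "m < card B"
    unfolding ecodim_indep_mod less_SUP_iff by auto
  then obtain C where "C \<subseteq> B" "card C = n" using obtain_subset_with_card_n Suc by (metis Suc_leI)
  then show ?thesis using that[of C] B indep_mod_subset by (meson order_trans)
qed

text \<open>
  The hypotheses say that the inclusion induces an injection of \<open>M / R\<close> into \<open>M' / R'\<close>.
\<close>

lemma ecodim_mono:
  assumes "M \<subseteq> M'" "cvec.subspace M" "R' \<inter> M \<subseteq> R"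
  shows "ecodim M R \<le> ecodim M' R'"
  unfolding ecodim_indep_mod[of M R]
proof (rule SUP_least)
  fix B assume "B \<in> {B. B \<subseteq> M \<and> indep_mod R B}"
  then have B: "B \<subseteq> M" "indep_mod R B" by auto
  have "indep_mod R' B"
  proof (rule indep_modI)
    fix u assume u: "(\<Sum>b\<in>B. u b *\<^sub>C b) \<in> R'"
    have "(\<Sum>b\<in>B. u b *\<^sub>C b) \<in> M"
      using B assms by (intro cvec.subspace_sum cvec.subspace_scale) auto
    then show "\<forall>b\<in>B. u b = 0" using u assms B indep_modD by blast
  qed (use B indep_mod_finite in blast)
  then show "enat (card B) \<le> ecodim M' R'" using ecodim_ge B assms by blast
qed

text \<open>
  With a finite-dimensional kernel the index is never the meaningless difference of two infinities.
\<close>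

lemma upper_semi_Weyl_on_iff:
  "upper_semi_Weyl_on T M \<longleftrightarrow>
     upper_semi_Fredholm_on T M \<and> ecdim (kernel T \<inter> M) \<le> ecodim M (T ` M)"
proof -
  have "(ereal_of_enat a - ereal_of_enat b \<le> 0) \<longleftrightarrow> a \<le> b" if "a < \<infinity>" for a b
    using that by (cases a; cases b) (auto simp: zero_ereal_def)
  then show ?thesis
    by (auto simp: upper_semi_Weyl_on_def index_on_def upper_semi_Fredholm_on_def)
qed

section \<open>Bounded complex linear operators\<close>

lemma bounded_clinear_imp_bounded_linear: "bounded_clinear T \<Longrightarrow> bounded_linear T"
  by (simp add: bounded_clinear_def)

lemma bounded_clinear_module_hom: "bounded_clinear T \<Longrightarrow> module_hom scaleC scaleC T"
  unfolding module_hom_iff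
  by (auto simp: bounded_clinear_def linear_simps intro: cvec.module_axioms)

lemmas bounded_clinear_add = bounded_clinear_imp_bounded_linear[THEN linear_simps(1)]
lemmas bounded_clinear_diff = bounded_clinear_imp_bounded_linear[THEN linear_simps(2)]
lemmas bounded_clinear_0 = bounded_clinear_imp_bounded_linear[THEN linear_simps(3)]

lemma bounded_clinear_scaleC: "bounded_clinear T \<Longrightarrow> T (c *\<^sub>C x) = c *\<^sub>C T x"
  by (simp add: bounded_clinear_def)

lemma bounded_clinear_sum: "bounded_clinear T \<Longrightarrow> T (\<Sum>b\<in>B. u b *\<^sub>C f b) = (\<Sum>b\<in>B. u b *\<^sub>C T (f b))"
  using module_hom.sum[OF bounded_clinear_module_hom, of T "\<lambda>b. u b *\<^sub>C f b" B]
  by (simp add: bounded_clinear_scaleC)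

lemma subspace_clinear_image: "bounded_clinear T \<Longrightarrow> cvec.subspace M \<Longrightarrow> cvec.subspace (T ` M)"
  by (rule module_hom.subspace_image[OF bounded_clinear_module_hom])

lemma span_clinear_image: "bounded_clinear T \<Longrightarrow> cvec.span (T ` S) = T ` cvec.span S"
  by (rule module_hom.span_image[OF bounded_clinear_module_hom])

lemma subspace_kernel: "bounded_clinear T \<Longrightarrow> cvec.subspace (kernel T)"
  unfolding kernel_def by (rule module_hom.subspace_kernel[OF bounded_clinear_module_hom])

lemma closed_kernel:
  assumes "bounded_clinear T" shows "closed (kernel T)"
proof -
  have "continuous_on UNIV T"
    using assms by (intro linear_continuous_on bounded_clinear_imp_bounded_linear)
  then show ?thesis
    unfolding kernel_def by (intro closed_Collect_eq) auto
qed

lemma bounded_linear_scaleC: "bounded_linear (\<lambda>x::'a::complex_banach. c *\<^sub>C x)"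
  by (rule bounded_linear_intro[where K = "cmod c"])
     (auto simp: scaleC_add_right scaleR_eq_scaleC scaleC_scaleC norm_scaleC mult.commute)

lemma bounded_clinear_shift: "bounded_clinear T \<Longrightarrow> bounded_clinear (shift T \<mu>)"
  unfolding bounded_clinear_def shift_def
  by (auto intro!: bounded_linear_sub bounded_linear_scaleC
      simp: cvec.scale_right_diff_distrib scaleC_scaleC mult.commute)

lemma bounded_clinear_plus:
  "bounded_clinear S \<Longrightarrow> bounded_clinear T \<Longrightarrow> bounded_clinear (\<lambda>x. S x + T x)"
  unfolding bounded_clinear_def by (auto intro: bounded_linear_add simp: scaleC_add_right)

lemma bounded_clinear_zero: "bounded_clinear (\<lambda>x. 0)"
  by (simp add: bounded_clinear_def bounded_linear_zero)

lemma bounded_clinear_id: "bounded_clinear (\<lambda>x. x)"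
  by (simp add: bounded_clinear_def bounded_linear_ident)

lemma bounded_clinear_compose:
  "bounded_clinear S \<Longrightarrow> bounded_clinear T \<Longrightarrow> bounded_clinear (\<lambda>x. S (T x))"
  unfolding bounded_clinear_def by (auto intro: bounded_linear_compose)

lemma bounded_clinear_funpow: "bounded_clinear T \<Longrightarrow> bounded_clinear (T ^^ n)"
  by (induction n) (auto simp: bounded_clinear_id bounded_clinear_compose o_def id_def)

lemma bounded_clinear_rank_one:
  assumes "cfunctional \<phi>" shows "bounded_clinear (\<lambda>x. \<phi> x *\<^sub>C v)"
proof -
  have "bounded_linear (\<lambda>c. c *\<^sub>C v)"
    by (rule bounded_linear_intro[where K = "norm v"])
       (auto simp: scaleC_add_left scaleR_eq_scaleC[of _ v] scaleR_eq_scaleC[of _ "_ *\<^sub>C v"] scaleC_scaleC norm_scaleC scaleR_conv_of_real)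
  then show ?thesis using assms
    unfolding bounded_clinear_def cfunctional_def
    by (auto intro: bounded_linear_compose simp: scaleC_scaleC)
qed

lemma bounded_clinear_finite_sum:
  "(\<And>i. i \<in> I \<Longrightarrow> bounded_clinear (f i)) \<Longrightarrow> bounded_clinear (\<lambda>x. \<Sum>i\<in>I. f i x)"
  by (induction I rule: infinite_finite_induct) (auto simp: bounded_clinear_zero bounded_clinear_plus)

text \<open>
  Preimages of a basis of the finite-dimensional image span a complement of the kernel.
\<close>

lemma finite_complement_of_kernel:
  assumes T: "bounded_clinear T" and M: "cvec.subspace M" and fd: "fdim (T ` M)"
  obtains G where "finite G" "G \<subseteq> M" "M \<subseteq> cvec.span ((kernel T \<inter> M) \<union> G)"
proof -
  obtain B where B: "B \<subseteq> T ` M" "cvec.span B = T ` M" "indep_mod {0} B"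
    using fdim_basis[OF subspace_clinear_image[OF T M] fd] by metis
  obtain G where G: "G \<subseteq> M" "B = T ` G" "finite G"
    using finite_subset_image[OF indep_mod_finite[OF B(3)] B(1)] by blast
  have "M \<subseteq> cvec.span ((kernel T \<inter> M) \<union> G)"
  proof
    fix x assume x: "x \<in> M"
    then have "T x \<in> T ` cvec.span G" using B G by (simp add: span_clinear_image[OF T, symmetric])
    then obtain y where y: "y \<in> cvec.span G" "T x = T y" by auto
    have "y \<in> M" using y cvec.span_minimal[OF G(1) M] by blast
    then have "x - y \<in> kernel T \<inter> M"
      using x y M by (auto simp: kernel_def bounded_clinear_diff[OF T] intro: cvec.subspace_diff)
    then have "x - y \<in> cvec.span ((kernel T \<inter> M) \<union> G)" by (auto intro: cvec.span_base)
    moreover have "y \<in> cvec.span ((kernel T \<inter> M) \<union> G)" using y cvec.span_mono[of G "(kernel T \<inter> M) \<union> G"] by auto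
    ultimately show "x \<in> cvec.span ((kernel T \<inter> M) \<union> G)"
      by (metis cvec.span_add diff_add_cancel)
  qed
  then show ?thesis using G that by blast
qed

section \<open>Closed subspaces and finite-dimensional perturbations\<close>

text \<open>
  A functional with value 1 at \<open>v\<close> and 0 on \<open>L\<close> reads off the coefficient of \<open>v\<close>, so the sum is the
  preimage of \<open>L\<close> under a continuous map.
\<close>

lemma closed_span_insert:
  assumes L: "cvec.subspace L" "closed L"
  shows "closed (cvec.span (insert v L))"
proof (cases "v \<in> L")
  case True
  then have "cvec.span (insert v L) = L"
    using L by (simp add: insert_absorb cvec.span_eq_iff[THEN iffD2])
  then show ?thesis using L by simp
next
  case False
  obtain \<phi> where \<phi>: "cfunctional \<phi>" "\<And>x. x \<in> L \<Longrightarrow> \<phi> x = 0" "\<phi> v = 1"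
    using separating_functional[OF L False] by blast
  have lin: "\<phi> (x - k *\<^sub>C v) = \<phi> x - k" for x k
    using \<phi>(1,3) by (simp add: cfunctional_def linear_simps)
  have "x \<in> cvec.span (insert v L) \<longleftrightarrow> x - \<phi> x *\<^sub>C v \<in> L" for x
  proof -
    have "k = \<phi> x" if "x - k *\<^sub>C v \<in> L" for k
      using \<phi>(2)[OF that] lin[of x k] by simp
    then show ?thesis
      using L by (auto simp: cvec.span_insert cvec.span_eq_iff[THEN iffD2])
  qed
  then have eq: "cvec.span (insert v L) = (\<lambda>x. x - \<phi> x *\<^sub>C v) -` L" by auto
  have "bounded_linear (\<lambda>x. x - \<phi> x *\<^sub>C v)"
    by (intro bounded_linear_sub bounded_linear_ident bounded_clinear_imp_bounded_linear bounded_clinear_rank_one \<phi>)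
  then have "continuous_on UNIV (\<lambda>x. x - \<phi> x *\<^sub>C v)" by (rule linear_continuous_on)
  then show ?thesis unfolding eq using L(2) by (rule closed_vimage[rotated])
qed

lemma closed_span_Un_finite:
  assumes "finite V" "cvec.subspace L" "closed L"
  shows "closed (cvec.span (L \<union> V))"
  using assms(1)
proof induction
  case empty
  then show ?case using assms by (simp add: cvec.span_eq_iff[THEN iffD2])
next
  case (insert v V)
  have "cvec.span (L \<union> insert v V) = cvec.span (insert v (cvec.span (L \<union> V)))"
    unfolding cvec.span_eq
  proof
    show "L \<union> insert v V \<subseteq> cvec.span (insert v (cvec.span (L \<union> V)))"
      using cvec.span_superset[of "L \<union> V"] cvec.span_superset[of "insert v (cvec.span (L \<union> V))"] by blast
    show "insert v (cvec.span (L \<union> V)) \<subseteq> cvec.span (L \<union> insert v V)"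
      using cvec.span_mono[of "L \<union> V" "L \<union> insert v V"] cvec.span_superset[of "L \<union> insert v V"] by blast
  qed
  then show ?case using closed_span_insert[OF cvec.subspace_span insert.IH, of v] by simp
qed

lemma closed_span_finite: "finite V \<Longrightarrow> closed (cvec.span V)"
  using closed_span_Un_finite[of V "{0}"] by (simp add: cvec.span_insert_0)

text \<open>
  The dual functionals provide the continuous projection onto \<open>V\<close>.
\<close>

lemma fdim_dual_basis:
  assumes "cvec.subspace V" "fdim V"
  obtains E \<phi> where "indep_mod {0} E" "cvec.span E = V" "ecdim V = enat (card E)"
    "\<And>e. e \<in> E \<Longrightarrow> cfunctional (\<phi> e)"
    "\<And>e e'. e \<in> E \<Longrightarrow> e' \<in> E \<Longrightarrow> \<phi> e e' = (if e = e' then 1 else 0)"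
    "\<And>x. x \<in> V \<Longrightarrow> (\<And>e. e \<in> E \<Longrightarrow> \<phi> e x = 0) \<Longrightarrow> x = 0"
proof -
  obtain E where E: "E \<subseteq> V" "cvec.span E = V" "indep_mod {0} E" "ecdim V = enat (card E)"
    using fdim_basis[OF assms] by blast
  have fin: "finite E" and ind: "cvec.independent E" using E by (auto simp: indep_mod_zero_iff)
  have "\<exists>\<phi>. cfunctional \<phi> \<and> (\<forall>e'\<in>E. \<phi> e' = (if e = e' then 1 else 0))" if "e \<in> E" for e
  proof -
    have "e \<notin> cvec.span (E - {e})" using ind that by (auto simp: cvec.dependent_def)
    moreover have "closed (cvec.span (E - {e}))" using fin by (intro closed_span_finite) auto
    ultimately obtain \<phi> where "cfunctional \<phi>" "\<And>x. x \<in> cvec.span (E - {e}) \<Longrightarrow> \<phi> x = 0" "\<phi> e = 1"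
      using separating_functional[OF cvec.subspace_span] by metis
    then show ?thesis by (intro exI[of _ \<phi>]) (auto intro: cvec.span_base)
  qed
  then obtain \<phi> where \<phi>: "\<And>e. e \<in> E \<Longrightarrow> cfunctional (\<phi> e)"
    "\<And>e e'. e \<in> E \<Longrightarrow> e' \<in> E \<Longrightarrow> \<phi> e e' = (if e = e' then 1 else 0)" by metis
  have "x = 0" if x: "x \<in> V" "\<And>e. e \<in> E \<Longrightarrow> \<phi> e x = 0" for x
  proof -
    obtain u where u: "x = (\<Sum>e\<in>E. u e *\<^sub>C e)" using x E cvec.span_finite[OF fin] by auto
    have "u e = 0" if e: "e \<in> E" for e
    proof -
      have "\<phi> e x = (\<Sum>e'\<in>E. u e' * \<phi> e e')"
        using \<phi>(1)[OF e] u by (simp add: cfunctional_def bounded_linear.linear linear_sum)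
      also have "\<dots> = (\<Sum>e'\<in>E. if e = e' then u e' else 0)"
        using \<phi>(2)[OF e] by (intro sum.cong) auto
      also have "\<dots> = u e" using fin e by simp
      finally show ?thesis using x(2)[OF e] by simp
    qed
    then show ?thesis using u by simp
  qed
  then show ?thesis using that[of E \<phi>] E \<phi> by blast
qed

lemma bounded_below_on_kernel:
  assumes "bounded_below_on T M"
  shows "kernel T \<inter> M \<subseteq> {0}"
proof
  fix x assume x: "x \<in> kernel T \<inter> M"
  obtain c where c: "c > 0" "\<forall>x\<in>M. c * norm x \<le> norm (T x)"
    using assms by (auto simp: bounded_below_on_def)
  then have "c * norm x \<le> 0" using x by (auto simp: kernel_def)
  then show "x \<in> {0}" using c(1) by (simp add: mult_le_0_iff)
qed

text \<open>
  The preimage provided by the open mapping theorem is the only one.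
\<close>

lemma bounded_below_onI_closed_range:
  assumes T: "bounded_clinear T" and M: "cvec.subspace M" "closed M"
    and cl: "closed (T ` M)" and inj: "kernel T \<inter> M \<subseteq> {0}"
  shows "bounded_below_on T M"
proof -
  obtain C where C: "C > 0" "\<And>w. w \<in> T ` M \<Longrightarrow> \<exists>x\<in>M. T x = w \<and> norm x \<le> C * norm w"
    using open_mapping_closed_range[OF bounded_clinear_imp_bounded_linear[OF T]
        csubspace_imp_subspace[OF M(1)] M(2) cl] by blast
  have "inverse C * norm x \<le> norm (T x)" if x: "x \<in> M" for x
  proof -
    obtain y where y: "y \<in> M" "T y = T x" "norm y \<le> C * norm (T x)" using C(2) x by blast
    have "y - x \<in> kernel T \<inter> M"
      using x y M by (auto simp: kernel_def bounded_clinear_diff[OF T] intro: cvec.subspace_diff)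
    then have "y = x" using inj by auto
    then show ?thesis using y C by (simp add: field_simps)
  qed
  then show ?thesis using C unfolding bounded_below_on_def by (intro exI[of _ "inverse C"]) auto
qed

lemma bounded_below_closed_image:
  assumes T: "bounded_clinear T" and bb: "bounded_below_on T M"
    and Z: "cvec.subspace Z" "closed Z" "Z \<subseteq> M"
  shows "closed (T ` Z)"
proof -
  obtain c where c: "c > 0" "\<forall>x\<in>M. c * norm x \<le> norm (T x)"
    using bb by (auto simp: bounded_below_on_def)
  then have "complete (T ` Z)"
    using Z by (intro complete_isometric_image[of c] csubspace_imp_subspace
        bounded_clinear_imp_bounded_linear T) (auto simp: complete_eq_closed)
  then show ?thesis by (simp add: complete_eq_closed)
qed

lemma upper_semi_Fredholm_on_iff:
  assumes "closed M" "T ` M \<subseteq> M"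
  shows "upper_semi_Fredholm_on T M \<longleftrightarrow> fdim (kernel T \<inter> M) \<and> closed (T ` M)"
  using assms by (simp add: upper_semi_Fredholm_on_def closedin_closed_eq flip: ecdim_finite_iff)

text \<open>
  On a closed complement \<open>L\<close> of the kernel the operator is bounded below, hence maps closed subspaces to
  closed ones; adding the finite-dimensional kernel to \<open>Z\<close> keeps \<open>Z\<close> closed, does not change the image,
  and allows to cut back to \<open>L\<close>.
\<close>

lemma closed_image_finite_kernel:
  assumes T: "bounded_clinear T" and M: "cvec.subspace M" "closed M"
    and fd: "fdim (kernel T \<inter> M)" and cl: "closed (T ` M)"
    and Z: "cvec.subspace Z" "closed Z" "Z \<subseteq> M"
  shows "closed (T ` Z)"
proof -
  let ?K = "kernel T \<inter> M"
  have sK: "cvec.subspace ?K" by (intro cvec.subspace_inter subspace_kernel T M)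
  obtain E \<phi> where E: "indep_mod {0} E" "cvec.span E = ?K"
    and \<phi>: "\<And>e. e \<in> E \<Longrightarrow> cfunctional (\<phi> e)"
    "\<And>e e'. e \<in> E \<Longrightarrow> e' \<in> E \<Longrightarrow> \<phi> e e' = (if e = e' then 1 else 0)"
    "\<And>x. x \<in> ?K \<Longrightarrow> (\<And>e. e \<in> E \<Longrightarrow> \<phi> e x = 0) \<Longrightarrow> x = 0"
    using fdim_dual_basis[OF sK fd] by metis
  have fin: "finite E" using E indep_mod_finite by blast
  have EK: "E \<subseteq> ?K" using E cvec.span_superset by blast
  define P where "P x = x - (\<Sum>e\<in>E. \<phi> e x *\<^sub>C e)" for x
  define L where "L = {x \<in> M. \<forall>e\<in>E. \<phi> e x = 0}"
  have s_in: "(\<Sum>e\<in>E. \<phi> e x *\<^sub>C e) \<in> cvec.span E" for x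
    by (intro cvec.span_sum cvec.span_scale cvec.span_base)
  have TP: "T (P x) = T x" for x
  proof -
    have "(\<Sum>e\<in>E. \<phi> e x *\<^sub>C e) \<in> ?K" using s_in E(2) by blast
    then show ?thesis by (simp add: P_def bounded_clinear_diff[OF T] kernel_def)
  qed
  have \<phi>P: "\<phi> e (P x) = 0" if e: "e \<in> E" for e x
  proof -
    have "\<phi> e (P x) = \<phi> e x - (\<Sum>e'\<in>E. \<phi> e' x * \<phi> e e')"
      using \<phi>(1)[OF e] by (simp add: P_def cfunctional_def bounded_linear.linear linear_diff linear_sum)
    also have "(\<Sum>e'\<in>E. \<phi> e' x * \<phi> e e') = (\<Sum>e'\<in>E. if e = e' then \<phi> e' x else 0)"
      using \<phi>(2)[OF e] by (intro sum.cong) auto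
    also have "\<dots> = \<phi> e x" using fin e by simp
    finally show ?thesis by simp
  qed
  have PL: "P x \<in> L" if "x \<in> M" for x
  proof -
    have "(\<Sum>e\<in>E. \<phi> e x *\<^sub>C e) \<in> M" using s_in E(2) by blast
    then show ?thesis using \<phi>P that M unfolding L_def by (auto simp: P_def intro: cvec.subspace_diff)
  qed
  have sL: "cvec.subspace L"
    using M(1) \<phi>(1) unfolding L_def cvec.subspace_def cfunctional_def
    by (auto simp: linear_simps)
  have clL: "closed L"
  proof -
    have "closed {x. \<phi> e x = 0}" if "e \<in> E" for e
      using \<phi>(1)[OF that] unfolding cfunctional_def
      by (intro closed_Collect_eq) (auto intro: linear_continuous_on)
    moreover have "L = M \<inter> (\<Inter>e\<in>E. {x. \<phi> e x = 0})" by (auto simp: L_def)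
    ultimately show ?thesis using M by auto
  qed
  have "T ` L = T ` M"
  proof
    show "T ` L \<subseteq> T ` M" by (auto simp: L_def)
    show "T ` M \<subseteq> T ` L" using PL TP by (metis image_eqI image_subsetI)
  qed
  moreover have "kernel T \<inter> L \<subseteq> {0}" using \<phi>(3) by (auto simp: L_def)
  ultimately have bb: "bounded_below_on T L"
    using bounded_below_onI_closed_range[OF T sL clL] cl by simp
  \<comment> \<open>The projection \<open>P\<close> maps \<open>Z\<close> into \<open>?Z \<inter> L\<close>; this is where the kernel has to be added.\<close>
  let ?Z = "cvec.span (Z \<union> E)"
  have "T ` Z = T ` (?Z \<inter> L)"
  proof
    show "T ` Z \<subseteq> T ` (?Z \<inter> L)"
    proof
      fix y assume "y \<in> T ` Z"
      then obtain z where z: "z \<in> Z" "y = T z" by auto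
      have "P z \<in> ?Z"
        unfolding P_def using z cvec.span_mono[of E "Z \<union> E"] s_in[of z]
        by (intro cvec.span_diff) (auto intro: cvec.span_base)
      then show "y \<in> T ` (?Z \<inter> L)" using z TP PL Z by (metis IntI image_eqI subsetD)
    qed
    have "T ` ?Z = cvec.span (T ` Z \<union> T ` E)" by (simp add: span_clinear_image[OF T, symmetric] image_Un)
    also have "\<dots> \<subseteq> T ` Z"
      using EK subspace_clinear_image[OF T Z(1)] cvec.subspace_0[of "T ` Z"]
      by (intro cvec.span_minimal) (auto simp: kernel_def)
    finally show "T ` (?Z \<inter> L) \<subseteq> T ` Z" by blast
  qed
  moreover have "closed (T ` (?Z \<inter> L))"
    using closed_span_Un_finite[OF fin Z(1,2)] clL
    by (intro bounded_below_closed_image[OF T bb] cvec.subspace_inter cvec.subspace_span sL closed_Int) auto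
  ultimately show ?thesis by simp
qed

text \<open>
  Since the kernel has at most the dimension of the cokernel, a basis of the kernel can be mapped
  bijectively onto vectors that are independent modulo the range; the projection onto the kernel
  followed by this map is \<open>F\<close>.
\<close>

theorem upper_semi_Weyl_on_bounded_below_perturbation:
  assumes T: "bounded_clinear T" and M: "cvec.subspace M" "closed M" "T ` M \<subseteq> M"
    and W: "upper_semi_Weyl_on T M"
  obtains F where "bounded_clinear F" "fdim (F ` M)" "F ` M \<subseteq> M"
    "bounded_below_on (\<lambda>x. T x + F x) M"
proof -
  let ?K = "kernel T \<inter> M"
  have fd: "fdim ?K" and cl: "closed (T ` M)" and ec: "ecdim ?K \<le> ecodim M (T ` M)"
    using W M by (auto simp: upper_semi_Weyl_on_iff upper_semi_Fredholm_on_iff)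
  have sK: "cvec.subspace ?K" by (intro cvec.subspace_inter subspace_kernel T M)
  obtain E \<phi> where E: "indep_mod {0} E" "cvec.span E = ?K" "ecdim ?K = enat (card E)"
    and \<phi>: "\<And>e. e \<in> E \<Longrightarrow> cfunctional (\<phi> e)"
    "\<And>e e'. e \<in> E \<Longrightarrow> e' \<in> E \<Longrightarrow> \<phi> e e' = (if e = e' then 1 else 0)"
    "\<And>x. x \<in> ?K \<Longrightarrow> (\<And>e. e \<in> E \<Longrightarrow> \<phi> e x = 0) \<Longrightarrow> x = 0"
    using fdim_dual_basis[OF sK fd] by metis
  have finE: "finite E" using E indep_mod_finite by blast
  have EK: "E \<subseteq> ?K" using E cvec.span_superset by blast
  obtain B where B: "B \<subseteq> M" "indep_mod (T ` M) B" "card B = card E"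
    using ec E by (metis ecodim_geE)
  have finB: "finite B" using B indep_mod_finite by blast
  obtain h where h: "bij_betw h E B" using finite_same_card_bij[OF finE finB] B by auto
  have hB: "h e \<in> B" if "e \<in> E" for e using h that bij_betwE by blast
  define F where "F x = (\<Sum>e\<in>E. \<phi> e x *\<^sub>C h e)" for x
  have F: "bounded_clinear F"
    unfolding F_def using \<phi> by (intro bounded_clinear_finite_sum bounded_clinear_rank_one) auto
  have FB: "F x \<in> cvec.span B" for x
    unfolding F_def using hB by (intro cvec.span_sum cvec.span_scale cvec.span_base)
  have FM: "F x \<in> M" for x using FB cvec.span_minimal[OF B(1) M(1)] by blast
  have sTM: "cvec.subspace (T ` M)" using T M by (intro subspace_clinear_image)
  let ?D = "\<lambda>x. T x + F x"
  have D: "bounded_clinear ?D" using T F by (rule bounded_clinear_plus)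
  have sDM: "cvec.subspace (?D ` M)" using D M by (intro subspace_clinear_image)
  have inj: "kernel ?D \<inter> M \<subseteq> {0}"
  proof
    fix x assume "x \<in> kernel ?D \<inter> M"
    then have x: "x \<in> M" "T x + F x = 0" by (auto simp: kernel_def)
    then have "F x = T (- x)" using bounded_clinear_diff[OF T, of 0 x] bounded_clinear_0[OF T]
      by (simp add: add_eq_0_iff)
    then have "F x \<in> T ` M" using x M cvec.subspace_neg by blast
    moreover have "F x = (\<Sum>b\<in>B. \<phi> (inv_into E h b) x *\<^sub>C b)"
      unfolding F_def using h by (intro sum.reindex_bij_witness[of _ "inv_into E h" h])
        (auto simp: bij_betw_def inv_into_into f_inv_into_f)
    ultimately have "(\<Sum>b\<in>B. \<phi> (inv_into E h b) x *\<^sub>C b) \<in> T ` M" by metis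
    note z = indep_modD[OF B(2) this]
    have z: "\<phi> e x = 0" if "e \<in> E" for e
      using z[OF hB[OF that]] h that by (simp add: bij_betw_def inv_into_f_f)
    then have "F x = 0" by (simp add: F_def)
    then have "x \<in> ?K" using x by (auto simp: kernel_def)
    then show "x \<in> {0}" using \<phi>(3) z by blast
  qed
  have Fe: "F e = h e" if "e \<in> E" for e
  proof -
    have "F e = (\<Sum>e'\<in>E. if e = e' then h e' else 0)"
      unfolding F_def using \<phi>(2) that by (intro sum.cong) auto
    then show ?thesis using finE that by simp
  qed
  have "?D ` M = cvec.span (T ` M \<union> B)"
  proof
    show "?D ` M \<subseteq> cvec.span (T ` M \<union> B)"
      using FB cvec.span_mono[of B "T ` M \<union> B"] by (auto intro!: cvec.span_add intro: cvec.span_base)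
    show "cvec.span (T ` M \<union> B) \<subseteq> ?D ` M"
    proof (rule cvec.span_minimal[OF _ sDM])
      have BD: "b \<in> ?D ` M" if b: "b \<in> B" for b
      proof -
        obtain e where e: "e \<in> E" "b = h e" using bij_betw_imp_surj_on[OF h] b by blast
        then have "?D e = b" using Fe EK by (auto simp: kernel_def)
        moreover have "e \<in> M" using e EK by blast
        ultimately show ?thesis using image_eqI[of b ?D e M] by simp
      qed
      have "T y \<in> ?D ` M" if y: "y \<in> M" for y
      proof -
        have "?D y \<in> ?D ` M" using y by blast
        moreover have "F y \<in> ?D ` M" using FB[of y] cvec.span_minimal[OF _ sDM, of B] BD by blast
        ultimately have "?D y - F y \<in> ?D ` M" using sDM cvec.subspace_diff by blast
        then show ?thesis by simp
      qed
      with BD show "T ` M \<union> B \<subseteq> ?D ` M" by blast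
    qed
  qed
  then have "closed (?D ` M)" using closed_span_Un_finite[OF finB sTM cl] by simp
  then have "bounded_below_on ?D M" by (rule bounded_below_onI_closed_range[OF D M(1,2) _ inj])
  moreover have "fdim (F ` M)" unfolding fdim_def using FB finB by blast
  ultimately show ?thesis using that F FM by blast
qed

text \<open>
  The converse.  \<open>C\<close> and \<open>D\<close> agree on a subspace \<open>Z\<close> of finite codimension, so the kernel \<open>K\<close> of \<open>C\<close> meets
  \<open>Z\<close> trivially and \<open>M\<close> has a complement of \<open>Z\<close> with a basis \<open>K \<union> G'\<close>.  The injection \<open>D\<close> maps this basis
  to a family independent modulo \<open>D Z\<close>, whereas the range of \<open>C\<close> exceeds \<open>D Z = C Z\<close> by at most
  \<open>card G'\<close> dimensions, because \<open>C\<close> annihilates \<open>K\<close>.  At least \<open>card K\<close> members of the family thus remain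
  independent modulo the range of \<open>C\<close>.
\<close>

theorem upper_semi_Weyl_on_if_finite_perturbation:
  assumes C: "bounded_clinear C" and D: "bounded_clinear D"
    and M: "cvec.subspace M" "closed M" "C ` M \<subseteq> M" "D ` M \<subseteq> M"
    and Z: "cvec.subspace Z" "closed Z" "Z \<subseteq> M" "\<And>x. x \<in> Z \<Longrightarrow> C x = D x"
    and G: "finite G" "G \<subseteq> M" "M \<subseteq> cvec.span (Z \<union> G)"
    and bb: "bounded_below_on D M"
  shows "upper_semi_Weyl_on C M"
proof -
  have MZ: "M = cvec.span (Z \<union> G)" using G Z cvec.span_minimal[OF _ M(1), of "Z \<union> G"] by blast
  have CZ: "C ` Z = D ` Z" using Z(4) by simp
  have sDZ: "cvec.subspace (D ` Z)" using D Z by (intro subspace_clinear_image)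
  have CM: "C ` M = cvec.span (D ` Z \<union> C ` G)"
    unfolding MZ by (simp add: span_clinear_image[OF C, symmetric] image_Un CZ)
  have cl: "closed (C ` M)"
    unfolding CM using G bounded_below_closed_image[OF D bb Z(1-3)] sDZ
    by (intro closed_span_Un_finite) auto
  let ?K = "kernel C \<inter> M"
  have sK: "cvec.subspace ?K" by (intro cvec.subspace_inter subspace_kernel C M)
  have KZ: "?K \<inter> Z \<subseteq> {0}"
    using bounded_below_on_kernel[OF bb] Z by (auto simp: kernel_def)
  have indep: "indep_mod Z B" if B: "B \<subseteq> ?K" "indep_mod {0} B" for B
  proof (rule indep_modI)
    fix u assume "(\<Sum>b\<in>B. u b *\<^sub>C b) \<in> Z"
    moreover have "(\<Sum>b\<in>B. u b *\<^sub>C b) \<in> ?K"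
      using B sK by (intro cvec.subspace_sum cvec.subspace_scale) auto
    ultimately have "(\<Sum>b\<in>B. u b *\<^sub>C b) \<in> {0}" using KZ by blast
    then show "\<forall>b\<in>B. u b = 0" using B indep_modD by blast
  qed (use B indep_mod_finite in blast)
  have fd: "fdim ?K"
  proof (rule fdimI)
    fix B assume B: "B \<subseteq> ?K" "indep_mod {0} B"
    then show "card B \<le> card G"
      using G by (intro indep_mod_card_le[OF G(1) Z(1) indep]) auto
  qed
  obtain K where K: "K \<subseteq> ?K" "indep_mod {0} K" "ecdim ?K = enat (card K)"
    using fdim_basis[OF sK fd] by metis
  obtain G' where G': "G' \<subseteq> G" "K \<inter> G' = {}" "indep_mod Z (K \<union> G')" "G \<subseteq> cvec.span (Z \<union> (K \<union> G'))"
    using indep_mod_extend[OF G(1) Z(1) indep[OF K(1,2)]] by blast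
  have finK: "finite K" and finG': "finite G'" using K G' G indep_mod_finite finite_subset by blast+
  have sub: "K \<union> G' \<subseteq> M" using K G' G by blast
  have injD: "inj_on D M"
  proof (rule inj_onI)
    fix x y assume "x \<in> M" "y \<in> M" "D x = D y"
    then have "x - y \<in> kernel D \<inter> M"
      using M by (auto simp: kernel_def bounded_clinear_diff[OF D] intro: cvec.subspace_diff)
    then show "x = y" using bounded_below_on_kernel[OF bb] by auto
  qed
  have inj: "inj_on D (K \<union> G')" using injD sub inj_on_subset by blast
  have ind: "indep_mod (D ` Z) (D ` (K \<union> G'))"
  proof (rule indep_modI)
    show "finite (D ` (K \<union> G'))" using finK finG' by simp
    fix u assume "(\<Sum>b\<in>D ` (K \<union> G'). u b *\<^sub>C b) \<in> D ` Z"
    then have "D (\<Sum>x\<in>K \<union> G'. u (D x) *\<^sub>C x) \<in> D ` Z"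
      by (simp add: bounded_clinear_sum[OF D] sum.reindex[OF inj])
    moreover have "(\<Sum>x\<in>K \<union> G'. u (D x) *\<^sub>C x) \<in> M"
      using sub M by (intro cvec.subspace_sum cvec.subspace_scale) auto
    ultimately have "(\<Sum>x\<in>K \<union> G'. u (D x) *\<^sub>C x) \<in> Z"
      using inj_on_image_mem_iff[OF injD _ Z(3)] by blast
    then have "u (D x) = 0" if "x \<in> K \<union> G'" for x
      using indep_modD[OF G'(3), of "\<lambda>x. u (D x)"] that by blast
    then show "\<forall>b\<in>D ` (K \<union> G'). u b = 0" by blast
  qed
  obtain B where B: "B \<subseteq> D ` (K \<union> G')" "card (D ` (K \<union> G')) \<le> card B + card (C ` G')"
     "indep_mod (cvec.span (D ` Z \<union> C ` G')) B"
    using indep_mod_exchange[OF _ sDZ ind, of "C ` G'"] finG' by blast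
  have "C ` M \<subseteq> cvec.span (D ` Z \<union> C ` G')"
  proof -
    have "M \<subseteq> cvec.span (Z \<union> (K \<union> G'))"
      unfolding MZ using G'(4) cvec.span_superset[of "Z \<union> (K \<union> G')"] by (intro cvec.span_minimal) auto
    then have "C ` M \<subseteq> cvec.span (C ` (Z \<union> (K \<union> G')))" by (auto simp: span_clinear_image[OF C])
    also have "\<dots> \<subseteq> cvec.span (D ` Z \<union> C ` G')"
    proof (rule cvec.span_minimal)
      have "C ` K \<subseteq> {0}" using K by (auto simp: kernel_def)
      then show "C ` (Z \<union> (K \<union> G')) \<subseteq> cvec.span (D ` Z \<union> C ` G')"
        using cvec.span_superset[of "D ` Z \<union> C ` G'"] subset_trans[of "C ` K" "{0}"]
        by (simp add: image_Un CZ cvec.span_zero)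
    qed simp
    finally show ?thesis .
  qed
  then have "indep_mod (C ` M) B" using B(3) indep_mod_antimono by blast
  moreover have "B \<subseteq> M" using B(1) sub M(4) by blast
  ultimately have "enat (card B) \<le> ecodim M (C ` M)" by (rule ecodim_ge)
  moreover have "card K \<le> card B"
  proof -
    have "card (D ` (K \<union> G')) = card K + card G'"
      using card_image[OF inj] card_Un_disjoint[OF finK finG' G'(2)] by simp
    moreover have "card (C ` G') \<le> card G'" using finG' by (rule card_image_le)
    ultimately show ?thesis using B(2) by linarith
  qed
  ultimately have "ecdim ?K \<le> ecodim M (C ` M)" unfolding K(3)
    by (meson enat_ord_simps(1) order_trans)
  then show ?thesis using fd cl M by (simp add: upper_semi_Weyl_on_iff upper_semi_Fredholm_on_iff)
qed

lemma bounded_below_imp_upper_semi_Weyl_on: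
  assumes "bounded_clinear T" "cvec.subspace M" "closed M" "T ` M \<subseteq> M" "bounded_below_on T M"
  shows "upper_semi_Weyl_on T M"
  by (rule upper_semi_Weyl_on_if_finite_perturbation[of T T M M "{}"])
     (use assms in \<open>auto intro: cvec.span_base\<close>)

lemma shift_image_subset:
  assumes "cvec.subspace M" "T ` M \<subseteq> M"
  shows "shift T \<mu> ` M \<subseteq> M"
  using assms by (auto simp: shift_def intro!: cvec.subspace_diff cvec.subspace_scale)

lemma bounded_below_on_shift:
  assumes "bounded_below_on T M"
  obtains \<epsilon> where "\<epsilon> > 0" "\<And>\<mu>. cmod \<mu> < \<epsilon> \<Longrightarrow> bounded_below_on (shift T \<mu>) M"
proof -
  obtain c where c: "c > 0" "\<forall>x\<in>M. c * norm x \<le> norm (T x)"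
    using assms by (auto simp: bounded_below_on_def)
  have "bounded_below_on (shift T \<mu>) M" if \<mu>: "cmod \<mu> < c" for \<mu>
    unfolding bounded_below_on_def
  proof (intro exI[of _ "c - cmod \<mu>"] conjI ballI)
    fix x assume "x \<in> M"
    then have "c * norm x \<le> norm (T x)" using c by blast
    also have "\<dots> \<le> norm (shift T \<mu> x) + cmod \<mu> * norm x"
      using norm_triangle_sub[of "T x" "\<mu> *\<^sub>C x"] by (simp add: shift_def norm_scaleC)
    finally show "(c - cmod \<mu>) * norm x \<le> norm (shift T \<mu> x)" by (simp add: algebra_simps)
  qed (use \<mu> in simp)
  then show ?thesis using c(1) that by blast
qed

text \<open>
  Stability of upper semi-Weyl operators without any index theory: if \<open>T + F\<close> is bounded below, so is
  \<open>T + F - \<mu>I\<close> for small \<mu>, and this differs from \<open>T - \<mu>I\<close> by \<open>F\<close> only.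
\<close>

theorem upper_semi_Weyl_on_shift:
  assumes T: "bounded_clinear T" and M: "cvec.subspace M" "closed M" "T ` M \<subseteq> M"
    and W: "upper_semi_Weyl_on T M"
  obtains \<epsilon> where "\<epsilon> > 0" "\<And>\<mu>. cmod \<mu> < \<epsilon> \<Longrightarrow> upper_semi_Weyl_on (shift T \<mu>) M"
proof -
  obtain F where F: "bounded_clinear F" "fdim (F ` M)" "F ` M \<subseteq> M"
    "bounded_below_on (\<lambda>x. T x + F x) M"
    using upper_semi_Weyl_on_bounded_below_perturbation[OF T M W] by blast
  obtain \<epsilon> where \<epsilon>: "\<epsilon> > 0" "\<And>\<mu>. cmod \<mu> < \<epsilon> \<Longrightarrow> bounded_below_on (shift (\<lambda>x. T x + F x) \<mu>) M"
    using bounded_below_on_shift[OF F(4)] by blast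
  obtain G where G: "finite G" "G \<subseteq> M" "M \<subseteq> cvec.span ((kernel F \<inter> M) \<union> G)"
    using finite_complement_of_kernel[OF F(1) M(1) F(2)] by blast
  have "upper_semi_Weyl_on (shift T \<mu>) M" if "cmod \<mu> < \<epsilon>" for \<mu>
  proof (rule upper_semi_Weyl_on_if_finite_perturbation[OF _ _ M(1,2) _ _ _ _ _ _ G])
    show "bounded_below_on (shift (\<lambda>x. T x + F x) \<mu>) M" using \<epsilon> that by blast
    show "bounded_clinear (shift (\<lambda>x. T x + F x) \<mu>)" "bounded_clinear (shift T \<mu>)"
      by (intro bounded_clinear_shift bounded_clinear_plus T F)+
    show "shift T \<mu> ` M \<subseteq> M" using M by (intro shift_image_subset)
    show "shift (\<lambda>x. T x + F x) \<mu> ` M \<subseteq> M"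
      using M F by (intro shift_image_subset) (auto intro: cvec.subspace_add)
    show "cvec.subspace (kernel F \<inter> M)" "closed (kernel F \<inter> M)"
      using M F by (auto intro: cvec.subspace_inter subspace_kernel closed_kernel)
    show "shift T \<mu> x = shift (\<lambda>x. T x + F x) \<mu> x" if "x \<in> kernel F \<inter> M" for x
      using that by (simp add: shift_def kernel_def)
  qed auto
  then show ?thesis using \<epsilon> that by blast
qed

section \<open>Iterates on an invariant subspace\<close>

lemma funpow_image_subset: "T ` M \<subseteq> M \<Longrightarrow> (T ^^ n) ` M \<subseteq> M"
  by (induction n) auto

lemma funpow_Suc_image: "(T ^^ Suc n) ` M = T ` ((T ^^ n) ` M)"
  by auto

lemma funpow_image_antimono:
  assumes "T ` M \<subseteq> M" "m \<le> n"
  shows "(T ^^ n) ` M \<subseteq> (T ^^ m) ` M"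
proof -
  have "(T ^^ (m + (n - m))) ` M = (T ^^ m) ` ((T ^^ (n - m)) ` M)"
    by (simp only: funpow_add image_comp)
  then show ?thesis using assms funpow_image_subset[OF assms(1), of "n - m"] by auto
qed

lemma kernel_funpow_mono:
  assumes "bounded_clinear T" "m \<le> n"
  shows "kernel (T ^^ m) \<subseteq> kernel (T ^^ n)"
proof
  fix x assume x: "x \<in> kernel (T ^^ m)"
  have "(T ^^ ((n - m) + m)) x = (T ^^ (n - m)) ((T ^^ m) x)" by (simp only: funpow_add o_apply)
  then show "x \<in> kernel (T ^^ n)"
    using x assms(2) bounded_clinear_0[OF bounded_clinear_funpow[OF assms(1)]] by (simp add: kernel_def)
qed

lemma kernel_funpow_stable:
  assumes T: "bounded_clinear T" "T ` M \<subseteq> M" "kernel (T ^^ Suc p) \<inter> M \<subseteq> kernel (T ^^ p)" and "n \<ge> p"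
  shows "kernel (T ^^ n) \<inter> M \<subseteq> kernel (T ^^ p)"
  using \<open>n \<ge> p\<close>
proof (induction n rule: dec_induct)
  case (step n)
  show ?case
  proof
    fix x assume x: "x \<in> kernel (T ^^ Suc n) \<inter> M"
    have "(T ^^ (n - p)) x \<in> M" using x funpow_image_subset[OF T(2)] by blast
    moreover have "(T ^^ Suc p) ((T ^^ (n - p)) x) = (T ^^ Suc n) x"
      using step by (simp flip: funpow_add comp_apply[of "T ^^ p"])
    ultimately have "(T ^^ (n - p)) x \<in> kernel (T ^^ p)" using T(3) x by (auto simp: kernel_def)
    moreover have "(T ^^ p) ((T ^^ (n - p)) x) = (T ^^ n) x"
      using step by (simp flip: funpow_add comp_apply[of "T ^^ p"])
    ultimately have "x \<in> kernel (T ^^ n)" by (simp add: kernel_def)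
    then show "x \<in> kernel (T ^^ p)" using step x by blast
  qed
qed auto

lemma injective_on_funpow:
  assumes "bounded_clinear T" "T ` M \<subseteq> M" "kernel T \<inter> M \<subseteq> {0}"
  shows "kernel (T ^^ n) \<inter> M \<subseteq> {0}"
  using kernel_funpow_stable[of T M 0 n] assms by (simp add: kernel_def)

text \<open>
  \<open>T\<close> maps the kernel of \<open>T ^^ Suc n\<close> into that of \<open>T ^^ n\<close>, with finite-dimensional fibres.
\<close>

lemma fdim_kernel_funpow:
  assumes T: "bounded_clinear T" and M: "cvec.subspace M" "T ` M \<subseteq> M" and fd: "fdim (kernel T \<inter> M)"
  shows "fdim (kernel (T ^^ n) \<inter> M)"
proof (induction n)
  case 0
  have "kernel (T ^^ 0) \<inter> M \<subseteq> cvec.span {}" by (auto simp: kernel_def)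
  then show ?case unfolding fdim_def by blast
next
  case (Suc n)
  let ?V = "kernel (T ^^ Suc n) \<inter> M"
  have sV: "cvec.subspace ?V"
    by (intro cvec.subspace_inter subspace_kernel bounded_clinear_funpow T M)
  have "(T ^^ n) (T x) = (T ^^ Suc n) x" for x by (simp add: funpow_swap1)
  then have "T x \<in> kernel (T ^^ n) \<inter> M" if "x \<in> ?V" for x
    using that M(2) unfolding kernel_def by (simp only: Int_iff mem_Collect_eq) blast
  then have "T ` ?V \<subseteq> kernel (T ^^ n) \<inter> M" by blast
  then have "fdim (T ` ?V)" using Suc fdim_subset by blast
  then obtain G where G: "finite G" "?V \<subseteq> cvec.span ((kernel T \<inter> ?V) \<union> G)"
    by (rule finite_complement_of_kernel[OF T sV])
  obtain B where B: "finite B" "kernel T \<inter> M \<subseteq> cvec.span B" using fd by (auto simp: fdim_def)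
  have "cvec.span ((kernel T \<inter> ?V) \<union> G) \<subseteq> cvec.span (B \<union> G)"
    using B(2) cvec.span_mono[of B "B \<union> G"] cvec.span_superset[of "B \<union> G"]
    by (intro cvec.span_minimal) auto
  then show ?case using G B unfolding fdim_def by (intro exI[of _ "B \<union> G"]) auto
qed

text \<open>
  An operator with finite-dimensional kernel and closed range preserves closedness of subspaces, in
  particular of the ranges of its iterates.
\<close>

lemma closed_funpow_image:
  assumes T: "bounded_clinear T" and M: "cvec.subspace M" "closed M" "T ` M \<subseteq> M"
    and fd: "fdim (kernel T \<inter> M)" and cl: "closed (T ` M)"
  shows "closed ((T ^^ n) ` M)"
proof (induction n)
  case (Suc n)
  have "cvec.subspace ((T ^^ n) ` M)" by (intro subspace_clinear_image bounded_clinear_funpow T M)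
  then show ?case
    unfolding funpow_Suc_image
    using closed_image_finite_kernel[OF T M(1,2) fd cl _ Suc funpow_image_subset[OF M(3)]] by blast
qed (use M in simp)

lemma fdim_card_bound:
  assumes "fdim V"
  obtains n where "\<And>B. B \<subseteq> V \<Longrightarrow> indep_mod {0} B \<Longrightarrow> card B \<le> n"
proof -
  obtain F where F: "finite F" "V \<subseteq> cvec.span F" using assms by (auto simp: fdim_def)
  have "card B \<le> card F" if "B \<subseteq> V" "indep_mod {0} B" for B
    using that F by (intro indep_mod_card_le[of F "{0}"]) (auto simp: cvec.span_insert_0)
  then show ?thesis using that by blast
qed

lemma fdim_subspace_eq:
  assumes V: "cvec.subspace V" and W: "cvec.subspace W" "fdim W" and "V \<subseteq> W" "ecdim W \<le> ecdim V"
  shows "V = W"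
proof (rule ccontr)
  assume "V \<noteq> W"
  then obtain x where x: "x \<in> W" "x \<notin> V" using \<open>V \<subseteq> W\<close> by blast
  obtain B where B: "B \<subseteq> V" "cvec.span B = V" "indep_mod {0} B" "ecdim V = enat (card B)"
    using fdim_basis V W fdim_subset \<open>V \<subseteq> W\<close> by metis
  obtain C where C: "cvec.span C = W" "indep_mod {0} C" "ecdim W = enat (card C)"
    using fdim_basis W by metis
  have "indep_mod {0} (insert x B)"
    using B x by (intro indep_mod_insert) auto
  moreover have "insert x B \<subseteq> cvec.span ({0} \<union> C)" using x B \<open>V \<subseteq> W\<close> C by simp
  ultimately have "card (insert x B) \<le> card C"
    using C indep_mod_finite by (intro indep_mod_card_le[of C "{0}"]) auto
  moreover have "x \<notin> B" "finite B" using x B indep_mod_finite by auto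
  ultimately show False using assms(5) B C by simp
qed

lemma decreasing_subspaces_stabilise:
  assumes D: "\<And>n. cvec.subspace (D n)" "decseq D" and fd: "fdim (D (0::nat))"
  obtains p where "\<And>n. n \<ge> p \<Longrightarrow> D n = D p"
proof -
  define e where "e = (LEAST e. \<exists>p. ecdim (D p) = e)"
  obtain p where p: "ecdim (D p) = e"
    using LeastI_ex[of "\<lambda>e. \<exists>p. ecdim (D p) = e"] unfolding e_def by blast
  have "D n = D p" if "n \<ge> p" for n
  proof (rule fdim_subspace_eq)
    show "ecdim (D p) \<le> ecdim (D n)" unfolding p e_def by (rule Least_le) blast
    show "D n \<subseteq> D p" using D(2) that by (rule decseqD)
    show "fdim (D p)" using fd fdim_subset decseqD[OF D(2), of 0 p] by blast
  qed (rule D)+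
  then show ?thesis by (rule that)
qed

section \<open>Finite ascent: the Kato decomposition\<close>

text \<open>
  The vectors \<open>(T ^^ i) e\<close> with \<open>i \<le> r\<close> form a Jordan chain in the kernel of \<open>T ^^ Suc r\<close>.  The subspace \<open>N\<close>
  consists of the vectors whose whole orbit is annihilated by \<phi>, hence it is invariant.  Only the
  functionals \<open>\<phi> \<circ> T ^^ j\<close> with \<open>j \<le> r\<close> matter, and their pairing with the chain is triangular with ones
  on the antidiagonal, so \<open>N\<close> and the chain together span \<open>M\<close>.
\<close>

lemma chain_complement:
  assumes T: "bounded_clinear T" and M: "cvec.subspace M" "closed M" "T ` M \<subseteq> M"
    and \<phi>: "cfunctional \<phi>" "\<And>x. x \<in> (T ^^ Suc r) ` M \<Longrightarrow> \<phi> x = 0" "\<phi> ((T ^^ r) e) = 1"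
    and e: "e \<in> M" "(T ^^ Suc r) e = 0"
  defines "N \<equiv> {x \<in> M. \<forall>j. \<phi> ((T ^^ j) x) = 0}"
  shows "cvec.subspace N" "closed N" "T ` N \<subseteq> N" "N \<subseteq> M" "e \<notin> N"
    "\<And>x. x \<in> M \<Longrightarrow> \<exists>y \<in> kernel (T ^^ Suc r) \<inter> M. x - y \<in> N"
proof -
  have Tn: "bounded_clinear (T ^^ j)" for j using T by (rule bounded_clinear_funpow)
  have lin: "linear \<phi>" using \<phi>(1) by (simp add: cfunctional_def bounded_linear.linear)
  have \<phi>s: "\<phi> (c *\<^sub>C x) = c * \<phi> x" for c x using \<phi>(1) by (simp add: cfunctional_def)
  show "cvec.subspace N"
    using M(1) unfolding N_def cvec.subspace_def
    by (auto simp: bounded_clinear_add[OF Tn] bounded_clinear_0[OF Tn] bounded_clinear_scaleC[OF Tn]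
        \<phi>s linear_add[OF lin] linear_0[OF lin])
  have "closed {x. \<phi> ((T ^^ j) x) = 0}" for j
  proof -
    have "bounded_linear (\<lambda>x. \<phi> ((T ^^ j) x))"
      using \<phi>(1) bounded_clinear_imp_bounded_linear[OF Tn]
      by (auto simp: cfunctional_def intro: bounded_linear_compose)
    then show ?thesis by (intro closed_Collect_eq) (auto intro: linear_continuous_on)
  qed
  moreover have "N = M \<inter> (\<Inter>j. {x. \<phi> ((T ^^ j) x) = 0})" by (auto simp: N_def)
  ultimately show "closed N" using M by auto
  show "T ` N \<subseteq> N"
  proof
    fix y assume "y \<in> T ` N"
    then obtain x where x: "x \<in> M" "\<And>j. \<phi> ((T ^^ j) x) = 0" "y = T x" by (auto simp: N_def)
    have "\<phi> ((T ^^ j) y) = 0" for j using x(2)[of "Suc j"] x(3) by (simp add: funpow_swap1)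
    then show "y \<in> N" using x M by (auto simp: N_def)
  qed
  show "N \<subseteq> M" by (auto simp: N_def)
  show "e \<notin> N" using \<phi>(3) by (auto simp: N_def intro!: exI[of _ r])
  have big: "\<phi> ((T ^^ j) x) = 0" if "j \<ge> Suc r" "x \<in> M" for j x
    using \<phi>(2) funpow_image_antimono[OF M(3) that(1)] that(2) by blast
  have e0: "(T ^^ j) e = 0" if "j \<ge> Suc r" for j
    using kernel_funpow_mono[OF T that] e by (auto simp: kernel_def)
  fix x assume x: "x \<in> M"
  \<comment> \<open>Solve the triangular system from the highest power downwards; beyond \<open>r\<close> nothing is to be done.\<close>
  have "\<exists>y \<in> kernel (T ^^ Suc r) \<inter> M. \<forall>j \<ge> Suc r - k. \<phi> ((T ^^ j) (x - y)) = 0" for k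
  proof (induction k)
    case 0
    have z: "0 \<in> kernel (T ^^ Suc r) \<inter> M"
      using M(1) bounded_clinear_0[OF Tn, of "Suc r"] cvec.subspace_0 by (simp add: kernel_def)
    show ?case by (rule bexI[OF _ z]) (use big x in auto)
  next
    case (Suc k)
    then obtain y where y: "y \<in> kernel (T ^^ Suc r) \<inter> M" "\<And>j. j \<ge> Suc r - k \<Longrightarrow> \<phi> ((T ^^ j) (x - y)) = 0"
      by blast
    show ?case
    proof (cases "k \<le> r")
      case False
      then show ?thesis using y(2) by (intro bexI[OF _ y(1)]) auto
    next
      case True
      let ?c = "\<phi> ((T ^^ (r - k)) (x - y))"
      let ?y = "y + ?c *\<^sub>C (T ^^ k) e"
      have add: "(T ^^ j) ((T ^^ k) e) = (T ^^ (j + k)) e" for j by (simp add: funpow_add)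
      have "(T ^^ k) e \<in> kernel (T ^^ Suc r) \<inter> M"
        using e funpow_image_subset[OF M(3), of k] e0[of "Suc r + k"] add[of "Suc r"]
        by (auto simp: kernel_def)
      then have "?y \<in> kernel (T ^^ Suc r) \<inter> M"
        using y M by (intro cvec.subspace_add cvec.subspace_scale cvec.subspace_inter subspace_kernel Tn) auto
      moreover have "\<phi> ((T ^^ j) (x - ?y)) = 0" if j: "j \<ge> Suc r - Suc k" for j
      proof -
        have *: "\<phi> ((T ^^ j) (x - ?y)) = \<phi> ((T ^^ j) (x - y)) - ?c * \<phi> ((T ^^ (j + k)) e)"
          unfolding diff_diff_eq[symmetric] bounded_clinear_diff[OF Tn, of j "x - y"]
          by (simp add: linear_diff[OF lin] bounded_clinear_scaleC[OF Tn] \<phi>s add)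
        show ?thesis
        proof (cases "j = r - k")
          case True
          then show ?thesis unfolding * using \<open>k \<le> r\<close> \<phi>(3) by simp
        next
          case False
          then have "j \<ge> Suc r - k" "j + k \<ge> Suc r" using j \<open>k \<le> r\<close> by auto
          then show ?thesis unfolding * using y(2) e0 linear_0[OF lin] by simp
        qed
      qed
      ultimately show ?thesis by blast
    qed
  qed
  from this[of "Suc r"] obtain y where y: "y \<in> kernel (T ^^ Suc r) \<inter> M" "\<And>j. \<phi> ((T ^^ j) (x - y)) = 0"
    by auto
  then show "\<exists>y \<in> kernel (T ^^ Suc r) \<inter> M. x - y \<in> N"
    using x M by (intro bexI[of _ y]) (auto simp: N_def intro: cvec.subspace_diff)
qed

text \<open>
  The generalized kernel \<open>kernel (T ^^ p)\<close> is finite-dimensional and meets the range of \<open>T ^^ p\<close>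
  trivially, but it must have an invariant closed complement; an arbitrary complement containing that
  range need not be invariant.  The complement is found by splitting off one longest Jordan chain at a
  time with \<open>chain_complement\<close>, which lowers the dimension of the generalized kernel.
\<close>

theorem kato_decomposition:
  assumes T: "bounded_clinear T" and M: "cvec.subspace M" "closed M" "T ` M \<subseteq> M"
    and F: "upper_semi_Fredholm_on T M" and asc: "kernel (T ^^ Suc p) \<inter> M \<subseteq> kernel (T ^^ p)"
  obtains M1 where "cvec.subspace M1" "closed M1" "T ` M1 \<subseteq> M1" "M1 \<subseteq> M" "bounded_below_on T M1"
    "M1 \<inter> kernel (T ^^ p) \<subseteq> {0}" "\<forall>x \<in> M. \<exists>y \<in> kernel (T ^^ p) \<inter> M. x - y \<in> M1"
proof -
  have fd: "fdim (kernel T \<inter> M)" and cl: "closed (T ` M)"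
    using F M by (auto simp: upper_semi_Fredholm_on_iff)
  obtain n where n: "\<And>B. B \<subseteq> kernel (T ^^ p) \<inter> M \<Longrightarrow> indep_mod {0} B \<Longrightarrow> card B \<le> n"
    using fdim_card_bound[OF fdim_kernel_funpow[OF T M(1,3) fd]] by blast
  have "\<exists>M1. cvec.subspace M1 \<and> closed M1 \<and> T ` M1 \<subseteq> M1 \<and> M1 \<subseteq> M \<and> bounded_below_on T M1 \<and>
    M1 \<inter> kernel (T ^^ p) \<subseteq> {0} \<and> (\<forall>x \<in> M. \<exists>y \<in> kernel (T ^^ p) \<inter> M. x - y \<in> M1)"
    using M fd cl asc n
  proof (induction n arbitrary: M rule: less_induct)
    case (less n)
    note M = less.prems(1-3) and fd = less.prems(4) and cl = less.prems(5) and asc = less.prems(6)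
    have z: "0 \<in> kernel (T ^^ p) \<inter> M"
      using M(1) bounded_clinear_0[OF bounded_clinear_funpow[OF T]] cvec.subspace_0 by (simp add: kernel_def)
    show ?case
    proof (cases "kernel T \<inter> M \<subseteq> {0}")
      case True
      then have "bounded_below_on T M" by (rule bounded_below_onI_closed_range[OF T M(1,2) cl])
      moreover have "M \<inter> kernel (T ^^ p) \<subseteq> {0}" using injective_on_funpow[OF T M(3) True] by blast
      moreover have "\<forall>x \<in> M. \<exists>y \<in> kernel (T ^^ p) \<inter> M. x - y \<in> M" using z by (intro ballI bexI[of _ 0]) auto
      ultimately show ?thesis using M by (intro exI[of _ M]) auto
    next
      case False
      \<comment> \<open>The length of the longest Jordan chain.  By minimality some \<open>e\<close> starts a chain of this length, and
        its last vector is not in the range of \<open>T ^^ q\<close>, so that a functional can separate it from there.\<close>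
      define q where "q = (LEAST q. kernel (T ^^ Suc q) \<inter> M \<subseteq> kernel (T ^^ q))"
      have q: "kernel (T ^^ Suc q) \<inter> M \<subseteq> kernel (T ^^ q)" "q \<le> p"
        unfolding q_def
        using LeastI[of "\<lambda>q. kernel (T ^^ Suc q) \<inter> M \<subseteq> kernel (T ^^ q)", OF asc]
          Least_le[of "\<lambda>q. kernel (T ^^ Suc q) \<inter> M \<subseteq> kernel (T ^^ q)", OF asc] by blast+
      have "q \<noteq> 0" using q(1) False by (auto simp: kernel_def intro!: Nat.gr0I)
      then obtain r where r: "q = Suc r" by (cases q) auto
      then have "\<not> kernel (T ^^ Suc r) \<inter> M \<subseteq> kernel (T ^^ r)"
        unfolding q_def using not_less_Least[of r] by (metis lessI)
      then obtain e where e: "e \<in> M" "(T ^^ Suc r) e = 0" "(T ^^ r) e \<noteq> 0" by (auto simp: kernel_def)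
      have "(T ^^ r) e \<notin> (T ^^ Suc r) ` M"
      proof
        assume "(T ^^ r) e \<in> (T ^^ Suc r) ` M"
        then obtain x where x: "x \<in> M" "(T ^^ r) e = (T ^^ Suc r) x" by auto
        then have "(T ^^ Suc q) x = 0" using e r by simp
        then have "(T ^^ q) x = 0" using q(1) x by (auto simp: kernel_def)
        then show False using x e r by simp
      qed
      moreover have "cvec.subspace ((T ^^ Suc r) ` M)"
        by (intro subspace_clinear_image bounded_clinear_funpow T M)
      moreover have "closed ((T ^^ Suc r) ` M)" by (intro closed_funpow_image T M fd cl)
      ultimately obtain \<phi> where \<phi>: "cfunctional \<phi>" "\<And>x. x \<in> (T ^^ Suc r) ` M \<Longrightarrow> \<phi> x = 0" "\<phi> ((T ^^ r) e) = 1"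
        using separating_functional by metis
      define N where "N = {x \<in> M. \<forall>j. \<phi> ((T ^^ j) x) = 0}"
      have N: "cvec.subspace N" "closed N" "T ` N \<subseteq> N" "N \<subseteq> M" "e \<notin> N"
        "\<And>x. x \<in> M \<Longrightarrow> \<exists>y \<in> kernel (T ^^ Suc r) \<inter> M. x - y \<in> N"
        using chain_complement[OF T M \<phi> e(1,2)] unfolding N_def by blast+
      have ep: "e \<in> kernel (T ^^ p) \<inter> M" using e r q(2) kernel_funpow_mono[OF T, of q p] by (auto simp: kernel_def)
      have bound: "Suc (card B) \<le> n" if B: "B \<subseteq> kernel (T ^^ p) \<inter> N" "indep_mod {0} B" for B
      proof -
        have "cvec.span ({0} \<union> B) \<subseteq> N" using B N cvec.subspace_0 by (intro cvec.span_minimal) auto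
        then have "indep_mod {0} (insert e B)" using B N(5) by (intro indep_mod_insert) auto
        moreover have "insert e B \<subseteq> kernel (T ^^ p) \<inter> M" using B ep N by blast
        ultimately have "card (insert e B) \<le> n" using less.prems(7) by blast
        moreover have "e \<notin> B" using B N by blast
        ultimately show ?thesis using B indep_mod_finite by force
      qed
      have "n - 1 < n" using bound[of "{}"] by simp
      moreover have "fdim (kernel T \<inter> N)" using fd by (rule fdim_subset) (use N in blast)
      moreover have "closed (T ` N)" by (rule closed_image_finite_kernel[OF T M(1,2) fd cl N(1,2,4)])
      moreover have "kernel (T ^^ Suc p) \<inter> N \<subseteq> kernel (T ^^ p)" using asc N by blast
      moreover have "card B \<le> n - 1" if "B \<subseteq> kernel (T ^^ p) \<inter> N" "indep_mod {0} B" for B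
        using bound[OF that] by simp
      ultimately obtain M1 where M1: "cvec.subspace M1" "closed M1" "T ` M1 \<subseteq> M1" "M1 \<subseteq> N" "bounded_below_on T M1"
        "M1 \<inter> kernel (T ^^ p) \<subseteq> {0}" "\<And>x. x \<in> N \<Longrightarrow> \<exists>y \<in> kernel (T ^^ p) \<inter> N. x - y \<in> M1"
        using less.IH[of "n - 1" N] N by metis
      have split: "\<exists>y \<in> kernel (T ^^ p) \<inter> M. x - y \<in> M1" if x: "x \<in> M" for x
      proof -
        obtain y where y: "y \<in> kernel (T ^^ Suc r) \<inter> M" "x - y \<in> N" using N(6) x by blast
        obtain y' where y': "y' \<in> kernel (T ^^ p) \<inter> N" "(x - y) - y' \<in> M1" using M1(7) y(2) by blast
        have "y \<in> kernel (T ^^ p) \<inter> M" using y r q(2) kernel_funpow_mono[OF T, of q p] by blast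
        then have "y + y' \<in> kernel (T ^^ p) \<inter> M"
          using y' N M by (intro cvec.subspace_add cvec.subspace_inter subspace_kernel bounded_clinear_funpow T) auto
        then show ?thesis using y' by (intro bexI[of _ "y + y'"]) (simp_all add: diff_diff_eq)
      qed
      have "M1 \<subseteq> M" using M1(4) N(4) by (rule subset_trans)
      with M1(1-3,5,6) split show ?thesis by (intro exI[of _ M1] conjI ballI)
    qed
  qed
  then show ?thesis
  proof (elim exE conjE)
    fix M1
    assume M1: "cvec.subspace M1" "closed M1" "T ` M1 \<subseteq> M1" "M1 \<subseteq> M" "bounded_below_on T M1"
      "M1 \<inter> kernel (T ^^ p) \<subseteq> {0}" and split: "\<forall>x \<in> M. \<exists>y \<in> kernel (T ^^ p) \<inter> M. x - y \<in> M1"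
    show ?thesis by (rule that[OF M1 split])
  qed
qed

section \<open>Infinite ascent: an analytic family of eigenvectors\<close>

text \<open>
  The termwise derivatives are dominated by the convergent series of \<open>n (1/2) ^ (n - 1)\<close>; this is why the
  radius is half of \<open>1 / C\<close>, the radius of convergence guaranteed by the hypothesis.
\<close>

lemma power_series_vector_analytic:
  fixes xs :: "nat \<Rightarrow> 'a::complex_banach"
  assumes C: "C > 0" "\<And>n. norm (xs n) \<le> C ^ n * K"
  obtains g where "\<And>z. cmod z < 1 / (2 * C) \<Longrightarrow> (\<lambda>n. z ^ n *\<^sub>C xs n) sums g z"
    "vector_analytic_on g (ball 0 (1 / (2 * C)))"
proof -
  let ?S = "ball (0::complex) (1 / (2 * C))"
  have K: "K \<ge> 0" using order_trans[OF norm_ge_zero C(2)[of 0]] by simp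
  define a where "a n z = (of_nat n * z ^ (n - 1)) *\<^sub>C xs n" for n z
  have na: "norm (a n z) \<le> real n * (1/2) ^ (n - 1) * (C * K)" if z: "z \<in> ?S" for n z
  proof (cases n)
    case (Suc m)
    have "cmod z ^ m * C ^ m \<le> (1/2) ^ m"
      unfolding power_mult_distrib[symmetric] using z C by (intro power_mono) (auto simp: field_simps)
    then have "cmod z ^ m * C ^ m * (C * K) \<le> (1/2) ^ m * (C * K)"
      using C K by (intro mult_right_mono) auto
    moreover have "norm (a n z) \<le> real n * cmod z ^ m * (C ^ n * K)"
      unfolding a_def norm_scaleC using C(2)[of n] Suc by (auto simp: norm_mult norm_power intro!: mult_left_mono simp del: of_nat_Suc)
    ultimately show ?thesis
      using Suc mult_left_mono[of "cmod z ^ m * C ^ m * (C * K)" "(1/2) ^ m * (C * K)" "real n"]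
      by (simp add: mult_ac del: of_nat_Suc)
  qed (simp add: a_def)
  have "summable (\<lambda>n. real n * (1/2) ^ (n - 1) * (C * K))"
  proof -
    have "summable (\<lambda>n. of_nat (Suc n) * (1/2::real) ^ n)" by (rule geometric_deriv_sums[THEN sums_summable]) simp
    then have "summable (\<lambda>n. real n * (1/2) ^ (n - 1))" by (subst summable_Suc_iff[symmetric]) simp
    then show ?thesis by (rule summable_mult2)
  qed
  then have ul: "uniform_limit ?S (\<lambda>n z. \<Sum>i<n. a i z) (\<lambda>z. \<Sum>i. a i z) sequentially"
    using na by (intro Weierstrass_m_test) auto
  have "\<exists>g. \<forall>z\<in>?S. (\<lambda>n. z ^ n *\<^sub>C xs n) sums (g z) \<and>
      (g has_derivative (\<lambda>h. h *\<^sub>C (\<Sum>i. a i z))) (at z within ?S)"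
  proof (rule has_derivative_series)
    show "convex ?S" by simp
    show "((\<lambda>z. z ^ n *\<^sub>C xs n) has_derivative (\<lambda>h. h *\<^sub>C a n z)) (at z within ?S)" for n z
    proof -
      have "bounded_linear (\<lambda>c. c *\<^sub>C xs n)"
        by (rule bounded_linear_intro[where K = "norm (xs n)"])
           (auto simp: scaleC_add_left scaleR_eq_scaleC[of _ "xs n"] scaleR_eq_scaleC[of _ "_ *\<^sub>C xs n"] scaleC_scaleC norm_scaleC scaleR_conv_of_real)
      moreover have "((\<lambda>z. z ^ n) has_derivative (\<lambda>h. h * (of_nat n * z ^ (n - 1)))) (at z within ?S)"
        by (auto intro!: derivative_eq_intros simp: mult_ac)
      ultimately have "((\<lambda>z. z ^ n *\<^sub>C xs n) has_derivative (\<lambda>h. (h * (of_nat n * z ^ (n - 1))) *\<^sub>C xs n)) (at z within ?S)"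
        by (rule bounded_linear.has_derivative)
      then show ?thesis by (simp add: a_def scaleC_scaleC)
    qed
    show "(0::complex) \<in> ?S" using C by simp
    show "(\<lambda>n. 0 ^ n *\<^sub>C xs n) sums (\<Sum>n\<in>{0}. 0 ^ n *\<^sub>C xs n)" by (rule sums_finite) auto
    fix e :: real assume "e > 0"
    then have "\<forall>\<^sub>F n in sequentially. \<forall>z\<in>?S. dist (\<Sum>i<n. a i z) (\<Sum>i. a i z) < e"
      using ul by (simp add: uniform_limit_iff)
    then show "\<forall>\<^sub>F n in sequentially. \<forall>z\<in>?S. \<forall>h. norm ((\<Sum>i<n. h *\<^sub>C a i z) - h *\<^sub>C (\<Sum>i. a i z)) \<le> e * norm h"
    proof eventually_elim
      case (elim n)
      show ?case
      proof (intro ballI allI)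
        fix z h :: complex assume "z \<in> ?S"
        then have "norm ((\<Sum>i<n. a i z) - (\<Sum>i. a i z)) \<le> e" using elim by (auto simp: dist_norm intro: less_imp_le)
        moreover have "(\<Sum>i<n. h *\<^sub>C a i z) - h *\<^sub>C (\<Sum>i. a i z) = h *\<^sub>C ((\<Sum>i<n. a i z) - (\<Sum>i. a i z))"
          by (simp add: cvec.scale_sum_right cvec.scale_right_diff_distrib)
        ultimately show "norm ((\<Sum>i<n. h *\<^sub>C a i z) - h *\<^sub>C (\<Sum>i. a i z)) \<le> e * norm h"
          by (simp add: norm_scaleC mult_left_mono mult.commute[of e])
      qed
    qed
  qed
  then obtain g where g: "\<And>z. z \<in> ?S \<Longrightarrow> (\<lambda>n. z ^ n *\<^sub>C xs n) sums (g z)"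
    "\<And>z. z \<in> ?S \<Longrightarrow> (g has_derivative (\<lambda>h. h *\<^sub>C (\<Sum>i. a i z))) (at z within ?S)" by blast
  have "vector_analytic_on g ?S"
    unfolding vector_analytic_on_def using g(2) at_within_open[OF _ open_ball] by metis
  then show ?thesis using g(1) that by auto
qed

text \<open>
  The spaces \<open>D p\<close>, where the kernel of \<open>T\<close> meets the range of \<open>T ^^ p\<close>, are nonzero because the ascent is
  infinite, and they decrease inside a finite-dimensional space, hence are eventually constant.  Their
  common value lies in the intersection \<open>R\<close> of all ranges, and it also yields that \<open>T\<close> maps \<open>R\<close> onto
  \<open>R\<close>: two preimages of the same vector, one in a range \<open>p0\<close> and one in a later range, differ by an element
  of \<open>D p0\<close>, hence of the later range.
\<close>

theorem eigenfunction_if_infinite_ascent: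
  assumes T: "bounded_clinear T" and M: "cvec.subspace M" "closed M" "T ` M \<subseteq> M"
    and F: "upper_semi_Fredholm_on T M"
    and asc: "\<And>p. \<not> kernel (T ^^ Suc p) \<inter> M \<subseteq> kernel (T ^^ p)"
  obtains r f where "r > 0" "vector_analytic_on f (ball 0 r)" "f 0 \<noteq> 0"
    "\<And>z. cmod z < r \<Longrightarrow> shift T z (f z) = 0"
proof -
  have fd: "fdim (kernel T \<inter> M)" and cl: "closed (T ` M)"
    using F M by (auto simp: upper_semi_Fredholm_on_iff)
  define D where "D p = kernel T \<inter> (T ^^ p) ` M" for p
  have sP: "cvec.subspace ((T ^^ p) ` M)" for p
    by (intro subspace_clinear_image bounded_clinear_funpow T M)
  have sD: "cvec.subspace (D p)" for p
    unfolding D_def by (intro cvec.subspace_inter subspace_kernel T sP)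
  have "decseq D"
    unfolding decseq_def D_def using funpow_image_antimono[OF M(3)] by blast
  moreover have "fdim (D 0)" using fd by (simp add: D_def)
  ultimately obtain p0 where p0: "\<And>n. n \<ge> p0 \<Longrightarrow> D n = D p0"
    using decreasing_subspaces_stabilise[of D, OF sD] by blast
  define R where "R = (\<Inter>p. (T ^^ p) ` M)"
  have sR: "cvec.subspace R" unfolding R_def using sP by (intro cvec.subspace_Int) auto
  have clR: "closed R" unfolding R_def using closed_funpow_image[OF T M fd cl] by auto
  have DR: "D p0 \<subseteq> R"
  proof
    fix x assume x: "x \<in> D p0"
    have "x \<in> (T ^^ p) ` M" for p
    proof -
      have "x \<in> (T ^^ max p p0) ` M" using x p0[of "max p p0"] by (auto simp: D_def)
      then show ?thesis using funpow_image_antimono[OF M(3), of p "max p p0"] by auto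
    qed
    then show "x \<in> R" by (simp add: R_def)
  qed
  obtain x0 where x0: "x0 \<in> R" "x0 \<noteq> 0" "T x0 = 0"
  proof -
    obtain x where x: "x \<in> M" "(T ^^ Suc p0) x = 0" "(T ^^ p0) x \<noteq> 0"
      using asc[of p0] by (auto simp: kernel_def)
    then have "(T ^^ p0) x \<in> D p0" by (auto simp: D_def kernel_def)
    then show ?thesis using x DR that[of "(T ^^ p0) x"] by auto
  qed
  have TR: "T ` R = R"
  proof
    show "T ` R \<subseteq> R"
    proof
      fix y assume "y \<in> T ` R"
      then obtain x where x: "y = T x" "\<And>p. x \<in> (T ^^ p) ` M" by (auto simp: R_def)
      have "y \<in> (T ^^ Suc p) ` M" for p using x unfolding funpow_Suc_image by blast
      then have "y \<in> (T ^^ p) ` M" for p using funpow_image_antimono[OF M(3), of p "Suc p"] by auto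
      then show "y \<in> R" by (simp add: R_def)
    qed
    show "R \<subseteq> T ` R"
    proof
      fix y assume y: "y \<in> R"
      have "\<exists>x \<in> (T ^^ p) ` M. y = T x" for p
        using y unfolding R_def by (metis (no_types, lifting) INT_iff UNIV_I funpow_Suc_image imageE)
      then obtain x where x: "\<And>p. x p \<in> (T ^^ p) ` M" "\<And>p. y = T (x p)" by metis
      have xR: "x p0 \<in> (T ^^ p) ` M" if "p \<ge> p0" for p
      proof -
        have "x p \<in> (T ^^ p0) ` M" using x(1) funpow_image_antimono[OF M(3) that] by blast
        then have "x p0 - x p \<in> D p0"
          using x sP[of p0] by (auto simp: D_def kernel_def bounded_clinear_diff[OF T] intro: cvec.subspace_diff)
        then have "x p0 - x p \<in> (T ^^ p) ` M" using p0[OF that] by (auto simp: D_def)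
        then show ?thesis using x(1)[of p] sP[of p] by (metis cvec.subspace_add diff_add_cancel)
      qed
      have "x p0 \<in> (T ^^ p) ` M" for p
        using xR[of "max p p0"] funpow_image_antimono[OF M(3), of p "max p p0"] by auto
      then have "x p0 \<in> R" by (simp add: R_def)
      then show "y \<in> T ` R" using x(2) by blast
    qed
  qed
  obtain C where C: "C > 0" "\<And>w. w \<in> T ` R \<Longrightarrow> \<exists>x\<in>R. T x = w \<and> norm x \<le> C * norm w"
    using open_mapping_closed_range[OF bounded_clinear_imp_bounded_linear[OF T] csubspace_imp_subspace[OF sR] clR]
      clR TR by metis
  obtain g where g: "\<And>w. w \<in> R \<Longrightarrow> g w \<in> R \<and> T (g w) = w \<and> norm (g w) \<le> C * norm w"
    using C(2) unfolding TR by metis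
  \<comment> \<open>A chain of preimages with geometrically bounded norms.\<close>
  define xs where "xs n = (g ^^ n) x0" for n
  have xsR: "xs n \<in> R" for n by (induction n) (auto simp: xs_def x0 g)
  have T0: "T (xs 0) = 0" and TS: "T (xs (Suc n)) = xs n" for n
    using x0 g[OF xsR[of n]] by (auto simp: xs_def)
  have nxs: "norm (xs n) \<le> C ^ n * norm x0" for n
  proof (induction n)
    case (Suc n)
    have "norm (xs (Suc n)) \<le> C * norm (xs n)" using g[OF xsR[of n]] by (simp add: xs_def)
    also have "\<dots> \<le> C * (C ^ n * norm x0)" using Suc C by (intro mult_left_mono) auto
    finally show ?case by (simp add: mult.assoc)
  qed (simp add: xs_def)
  obtain f where f: "\<And>z. cmod z < 1 / (2 * C) \<Longrightarrow> (\<lambda>n. z ^ n *\<^sub>C xs n) sums f z"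
    "vector_analytic_on f (ball 0 (1 / (2 * C)))"
    using power_series_vector_analytic[of C xs "norm x0", OF C(1) nxs] by blast
  have "shift T z (f z) = 0" if z: "cmod z < 1 / (2 * C)" for z
  proof -
    have "(\<lambda>n. T (z ^ n *\<^sub>C xs n)) sums T (f z)"
      using bounded_linear.sums[OF bounded_clinear_imp_bounded_linear[OF T] f(1)[OF z]] .
    then have "(\<lambda>n. T (z ^ Suc n *\<^sub>C xs (Suc n))) sums T (f z)"
      using sums_Suc_iff[of "\<lambda>n. T (z ^ n *\<^sub>C xs n)" "T (f z)"] by (simp add: T0)
    moreover have "T (z ^ Suc n *\<^sub>C xs (Suc n)) = z *\<^sub>C (z ^ n *\<^sub>C xs n)" for n
      by (simp add: bounded_clinear_scaleC[OF T] TS scaleC_scaleC)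
    moreover have "(\<lambda>n. z *\<^sub>C (z ^ n *\<^sub>C xs n)) sums (z *\<^sub>C f z)"
      using bounded_linear.sums[OF bounded_linear_scaleC f(1)[OF z]] .
    ultimately have "T (f z) = z *\<^sub>C f z" using sums_unique2 by simp
    then show ?thesis by (simp add: shift_def)
  qed
  moreover have "f 0 = x0"
  proof -
    have "(\<lambda>n. 0 ^ n *\<^sub>C xs n) sums (\<Sum>n\<in>{0}. 0 ^ n *\<^sub>C xs n)" by (rule sums_finite) auto
    then have "(\<lambda>n. 0 ^ n *\<^sub>C xs n) sums x0" by (simp add: xs_def)
    then show ?thesis using f(1)[of 0] C sums_unique2 by force
  qed
  ultimately show ?thesis using that[of "1 / (2 * C)" f] f(2) x0 C by simp
qed

section \<open>Reducing pairs\<close>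

lemma shift_shift: "shift (shift T a) b = shift T (a + b)"
  by (simp add: shift_def fun_eq_iff scaleC_add_left diff_diff_eq)

lemma RedE:
  assumes "(M, N) \<in> Red T"
  obtains "cvec.subspace M" "closed M" "T ` M \<subseteq> M" "cvec.subspace N" "closed N" "T ` N \<subseteq> N"
    "\<And>x. \<exists>m\<in>M. \<exists>n\<in>N. x = m + n" "M \<inter> N = {0}"
proof -
  have "\<exists>m\<in>M. \<exists>n\<in>N. x = m + n" for x
  proof -
    have "x \<in> {m + n | m n. m \<in> M \<and> n \<in> N}" using assms by (simp add: Red_def)
    then show ?thesis by blast
  qed
  then show ?thesis using assms that by (simp add: Red_def)
qed

lemma RedI:
  assumes "cvec.subspace M" "closed M" "T ` M \<subseteq> M" "cvec.subspace N" "closed N" "T ` N \<subseteq> N"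
    "\<And>x. \<exists>m\<in>M. \<exists>n\<in>N. x = m + n" "M \<inter> N \<subseteq> {0}"
  shows "(M, N) \<in> Red T"
proof -
  have "x \<in> {m + n | m n. m \<in> M \<and> n \<in> N}" for x using assms(7)[of x] by blast
  then have "{m + n | m n. m \<in> M \<and> n \<in> N} = UNIV" by blast
  moreover have "M \<inter> N = {0}" using assms cvec.subspace_0 by blast
  ultimately show ?thesis using assms by (simp add: Red_def)
qed

lemma Red_UNIV_zero:
  assumes "bounded_clinear T" shows "(UNIV, {0}) \<in> Red T"
  by (rule RedI) (use bounded_clinear_0[OF assms] in auto)

lemma quasinilpotent_on_zero:
  assumes "bounded_clinear T" shows "quasinilpotent_on T {0}"
proof -
  have "invertible_op_on (shift T \<mu>) {0}" for \<mu>
    unfolding invertible_op_on_def using bounded_clinear_0[OF bounded_clinear_shift[OF assms]]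
    by (intro exI[of _ "\<lambda>x. 0"] exI[of _ 0]) simp
  then show ?thesis by (simp add: quasinilpotent_on_def spectrum_on_def)
qed

lemma direct_sum_zero:
  assumes "cvec.subspace M" "cvec.subspace N" "M \<inter> N = {0}" "m \<in> M" "n \<in> N" "m + n = 0"
  shows "m = 0 \<and> n = 0"
proof -
  have "m = - n" using assms(6) by (simp add: add_eq_0_iff2)
  then have "m \<in> M \<inter> N" using assms cvec.subspace_neg by blast
  then show ?thesis using assms by auto
qed

text \<open>
  By the open mapping theorem for the sum map on \<open>M \<times> N\<close>, the projection onto \<open>M\<close> along \<open>N\<close> is continuous.
\<close>

lemma closed_direct_sum_subspace:
  assumes M: "cvec.subspace M" "closed M" and N: "cvec.subspace N" "closed N"
    and sum: "\<And>x. \<exists>m\<in>M. \<exists>n\<in>N. x = m + n" and MN: "M \<inter> N = {0}"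
    and L: "closed L" "L \<subseteq> M"
  shows "closed {l + n | l n. l \<in> L \<and> n \<in> N}"
proof -
  let ?f = "\<lambda>p. fst p + snd p :: 'a"
  have f: "bounded_linear ?f" by (intro bounded_linear_add bounded_linear_fst bounded_linear_snd)
  have sub: "subspace (M \<times> N)" using M N by (intro subspace_Times csubspace_imp_subspace)
  have "x \<in> ?f ` (M \<times> N)" for x using sum[of x] by force
  then have im: "?f ` (M \<times> N) = UNIV" by blast
  then have "closed (?f ` (M \<times> N))" by simp
  then obtain C where C: "C > 0" "\<And>w. w \<in> ?f ` (M \<times> N) \<Longrightarrow> \<exists>x\<in>M \<times> N. ?f x = w \<and> norm x \<le> C * norm w"
    by (rule open_mapping_closed_range[OF f sub closed_Times[OF M(2) N(2)]]) (rule that; blast)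
  have bound: "norm m \<le> C * norm (m + n)" if mn: "m \<in> M" "n \<in> N" for m n
  proof -
    obtain x where x: "x \<in> M \<times> N" "?f x = m + n" "norm x \<le> C * norm (m + n)"
      using C(2)[of "m + n"] unfolding im by blast
    have "fst x - m \<in> M" "snd x - n \<in> N" using x mn M N by (auto intro: cvec.subspace_diff)
    moreover have "(fst x - m) + (snd x - n) = 0" using x by (simp add: algebra_simps)
    ultimately have "fst x - m = 0" using direct_sum_zero[OF M(1) N(1) MN] by blast
    moreover have "norm (fst x) \<le> norm x" using norm_fst_le[of "fst x" "snd x"] by (simp only: prod.collapse)
    ultimately show ?thesis using x(3) by simp
  qed
  show ?thesis
    unfolding closed_sequential_limits
  proof (intro allI impI, elim conjE)
    fix y l assume y: "\<forall>k. y k \<in> {l + n | l n. l \<in> L \<and> n \<in> N}" and lim: "y \<longlonglongrightarrow> l"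
    then have "\<forall>k. \<exists>a b. a \<in> L \<and> b \<in> N \<and> y k = a + b" by blast
    then obtain a b where ab: "\<And>k. a k \<in> L" "\<And>k. b k \<in> N" "\<And>k. y k = a k + b k" by metis
    obtain m n where mn: "m \<in> M" "n \<in> N" "l = m + n" using sum[of l] by blast
    have "norm (a k - m) \<le> C * norm (y k - l)" for k
    proof -
      have "y k - l = (a k - m) + (b k - n)" using ab mn by simp
      moreover have "a k - m \<in> M" "b k - n \<in> N"
        using cvec.subspace_diff[OF M(1) _ mn(1)] cvec.subspace_diff[OF N(1) _ mn(2)] ab(1,2) L(2) by blast+
      ultimately show ?thesis using bound by metis
    qed
    moreover have "(\<lambda>k. C * norm (y k - l)) \<longlonglongrightarrow> 0"
      using lim by (intro tendsto_mult_right_zero) (simp add: tendsto_norm_zero LIM_zero)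
    ultimately have "(\<lambda>k. a k - m) \<longlonglongrightarrow> 0" by (intro Lim_null_comparison[of "\<lambda>k. a k - m"]) auto
    then have "a \<longlonglongrightarrow> m" by (rule LIM_zero_cancel)
    then have "m \<in> L" using closed_sequentially[OF L(1)] ab(1) by blast
    then show "l \<in> {l + n | l n. l \<in> L \<and> n \<in> N}" using mn by blast
  qed
qed

lemma invertible_op_onI:
  assumes C: "bounded_clinear C" and M: "cvec.subspace M" "closed M"
    and surj: "C ` M = M" and inj: "kernel C \<inter> M \<subseteq> {0}"
  shows "invertible_op_on C M"
proof -
  have "bounded_below_on C M" using M surj inj by (intro bounded_below_onI_closed_range C) auto
  then obtain c where c: "c > 0" "\<And>x. x \<in> M \<Longrightarrow> c * norm x \<le> norm (C x)"
    by (auto simp: bounded_below_on_def)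
  have injC: "inj_on C M"
  proof (rule inj_onI)
    fix x y assume "x \<in> M" "y \<in> M" "C x = C y"
    then have "x - y \<in> kernel C \<inter> M"
      using M by (auto simp: kernel_def bounded_clinear_diff[OF C] intro: cvec.subspace_diff)
    then show "x = y" using inj by auto
  qed
  let ?S = "inv_into M C"
  have "?S x \<in> M \<and> C (?S x) = x \<and> ?S (C x) = x \<and> norm (?S x) \<le> inverse c * norm x" if "x \<in> M" for x
  proof -
    have "?S x \<in> M" "C (?S x) = x" using that surj by (metis inv_into_into, metis f_inv_into_f)
    moreover have "norm (?S x) \<le> inverse c * norm x" using c(2)[OF \<open>?S x \<in> M\<close>] c(1) \<open>C (?S x) = x\<close>
      by (simp add: field_simps)
    ultimately show ?thesis using injC that by (simp add: inv_into_f_f)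
  qed
  then show ?thesis unfolding invertible_op_on_def by blast
qed

lemma quasinilpotent_on_shift:
  assumes T: "bounded_clinear T" and N: "cvec.subspace N" "T ` N \<subseteq> N"
    and q: "quasinilpotent_on T N" and \<mu>: "\<mu> \<noteq> 0"
  shows "shift T \<mu> ` N = N" "kernel (shift T \<mu>) \<inter> N \<subseteq> {0}"
proof -
  have "invertible_op_on (shift T \<mu>) N" using q \<mu> by (auto simp: quasinilpotent_on_def spectrum_on_def)
  then obtain S where S: "\<And>x. x \<in> N \<Longrightarrow> S x \<in> N \<and> shift T \<mu> (S x) = x \<and> S (shift T \<mu> x) = x"
    unfolding invertible_op_on_def by blast
  have "N \<subseteq> shift T \<mu> ` N"
  proof
    fix x assume "x \<in> N"
    then show "x \<in> shift T \<mu> ` N" using S[of x] by (metis image_eqI)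
  qed
  then show "shift T \<mu> ` N = N" using shift_image_subset[OF N] by blast
  have "0 \<in> N" using N(1) by (rule cvec.subspace_0)
  then have S0: "S 0 = 0" using S[of 0] bounded_clinear_0[OF bounded_clinear_shift[OF T], of \<mu>] by simp
  show "kernel (shift T \<mu>) \<inter> N \<subseteq> {0}"
  proof
    fix x assume "x \<in> kernel (shift T \<mu>) \<inter> N"
    then show "x \<in> {0}" using S[of x] S0 by (simp add: kernel_def)
  qed
qed

lemma kernel_Red_shift:
  assumes T: "bounded_clinear T" and R: "(M, N) \<in> Red T"
    and inj: "kernel (shift T \<mu>) \<inter> N \<subseteq> {0}"
  shows "kernel (shift T \<mu>) \<subseteq> M"
proof
  fix x assume x: "x \<in> kernel (shift T \<mu>)"
  from R show "x \<in> M"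
  proof (rule RedE)
    assume M: "cvec.subspace M" "T ` M \<subseteq> M" and N: "cvec.subspace N" "T ` N \<subseteq> N"
      and sum: "\<And>x. \<exists>m\<in>M. \<exists>n\<in>N. x = m + n" and MN: "M \<inter> N = {0}"
    obtain m n where mn: "m \<in> M" "n \<in> N" "x = m + n" using sum by blast
    have "shift T \<mu> m + shift T \<mu> n = 0"
      using x mn by (simp add: kernel_def bounded_clinear_add[OF bounded_clinear_shift[OF T], symmetric])
    moreover have "shift T \<mu> m \<in> M" "shift T \<mu> n \<in> N"
      using mn shift_image_subset[OF M, of \<mu>] shift_image_subset[OF N, of \<mu>] by auto
    ultimately have "shift T \<mu> n = 0" using direct_sum_zero[OF M(1) N(1) MN] by blast
    then have "n = 0" using inj mn by (auto simp: kernel_def)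
    then show "x \<in> M" using mn by simp
  qed
qed

text \<open>
  On \<open>N\<close> the shifted operator is bijective, so passing from \<open>M\<close> to the whole space neither changes the
  kernel nor decreases the codimension of the range.
\<close>

lemma upper_semi_Weyl_Red_shift:
  assumes T: "bounded_clinear T" and R: "(M, N) \<in> Red T"
    and q: "quasinilpotent_on T N" and \<mu>: "\<mu> \<noteq> 0" and W: "upper_semi_Weyl_on (shift T \<mu>) M"
  shows "upper_semi_Weyl (shift T \<mu>)"
  using R
proof (rule RedE)
  assume M: "cvec.subspace M" "closed M" "T ` M \<subseteq> M" and N: "cvec.subspace N" "closed N" "T ` N \<subseteq> N"
    and sum: "\<And>x. \<exists>m\<in>M. \<exists>n\<in>N. x = m + n" and MN: "M \<inter> N = {0}"
  let ?C = "shift T \<mu>"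
  have C: "bounded_clinear ?C" using T by (rule bounded_clinear_shift)
  note CN = quasinilpotent_on_shift[OF T N(1,3) q \<mu>]
  have CM: "?C ` M \<subseteq> M" using M(1,3) by (rule shift_image_subset)
  have ker: "kernel ?C \<inter> UNIV = kernel ?C \<inter> M" using kernel_Red_shift[OF T R CN(2)] by blast
  have ran: "range ?C = {l + n | l n. l \<in> ?C ` M \<and> n \<in> N}"
  proof
    show "range ?C \<subseteq> {l + n | l n. l \<in> ?C ` M \<and> n \<in> N}"
    proof
      fix y assume "y \<in> range ?C"
      then obtain x where "y = ?C x" by blast
      moreover obtain m n where "m \<in> M" "n \<in> N" "x = m + n" using sum by blast
      ultimately show "y \<in> {l + n | l n. l \<in> ?C ` M \<and> n \<in> N}"
        using CN(1) by (auto simp: bounded_clinear_add[OF C])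
    qed
    show "{l + n | l n. l \<in> ?C ` M \<and> n \<in> N} \<subseteq> range ?C"
    proof
      fix y assume "y \<in> {l + n | l n. l \<in> ?C ` M \<and> n \<in> N}"
      then obtain m n where mn: "m \<in> M" "n \<in> N" "y = ?C m + n" by blast
      then obtain n' where "n = ?C n'" using CN(1) by blast
      then have "y = ?C (m + n')" using mn by (simp add: bounded_clinear_add[OF C])
      then show "y \<in> range ?C" by blast
    qed
  qed
  have W': "fdim (kernel ?C \<inter> M)" "closed (?C ` M)" "ecdim (kernel ?C \<inter> M) \<le> ecodim M (?C ` M)"
    using W CM M by (auto simp: upper_semi_Weyl_on_iff upper_semi_Fredholm_on_iff)
  have "closed (range ?C)"
    unfolding ran by (rule closed_direct_sum_subspace[OF M(1,2) N(1,2) sum MN W'(2) CM])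
  moreover have "ecodim M (?C ` M) \<le> ecodim UNIV (range ?C)"
  proof (rule ecodim_mono[OF _ M(1)])
    show "range ?C \<inter> M \<subseteq> ?C ` M"
    proof
      fix y assume y: "y \<in> range ?C \<inter> M"
      then obtain l n where ln: "l \<in> ?C ` M" "n \<in> N" "y = l + n" unfolding ran by blast
      have "n = y - l" using ln by simp
      then have "n \<in> M" using y ln CM M cvec.subspace_diff by blast
      then have "n = 0" using ln MN by blast
      then show "y \<in> ?C ` M" using ln by simp
    qed
  qed simp
  ultimately show ?thesis
    unfolding upper_semi_Weyl_def upper_semi_Weyl_on_iff
    using W' ker by (simp add: upper_semi_Fredholm_on_iff)
qed

section \<open>Commuting with iterates\<close>

text \<open>
  The factorization of \<open>S ^ n - \<mu> ^ n\<close> through \<open>S - \<mu>\<close>.  It replaces the coprimality of the polynomials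
  \<open>t ^ n\<close> and \<open>t - \<mu>\<close> for \<open>\<mu> \<noteq> 0\<close>.
\<close>

lemma funpow_minus_power_factor:
  assumes S: "bounded_clinear S"
  obtains Q where "\<And>x. shift S \<mu> (Q x) = (S ^^ n) x - \<mu> ^ n *\<^sub>C x"
    "\<And>x. Q (shift S \<mu> x) = (S ^^ n) x - \<mu> ^ n *\<^sub>C x"
    "\<And>K. cvec.subspace K \<Longrightarrow> S ` K \<subseteq> K \<Longrightarrow> Q ` K \<subseteq> K"
proof -
  note C = bounded_clinear_shift[OF S, of \<mu>]
  have "\<exists>Q. (\<forall>x. shift S \<mu> (Q x) = (S ^^ n) x - \<mu> ^ n *\<^sub>C x) \<and>
    (\<forall>x. Q (shift S \<mu> x) = (S ^^ n) x - \<mu> ^ n *\<^sub>C x) \<and>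
    (\<forall>K. cvec.subspace K \<longrightarrow> S ` K \<subseteq> K \<longrightarrow> Q ` K \<subseteq> K)"
  proof (induction n)
    case 0
    show ?case
      using bounded_clinear_0[OF C] by (intro exI[of _ "\<lambda>x. 0"]) (auto dest: cvec.subspace_0)
  next
    case (Suc n)
    then obtain Q where Q: "\<And>x. shift S \<mu> (Q x) = (S ^^ n) x - \<mu> ^ n *\<^sub>C x"
      "\<And>x. Q (shift S \<mu> x) = (S ^^ n) x - \<mu> ^ n *\<^sub>C x"
      "\<And>K. cvec.subspace K \<Longrightarrow> S ` K \<subseteq> K \<Longrightarrow> Q ` K \<subseteq> K" by blast
    let ?Q = "\<lambda>x. (S ^^ n) x + \<mu> *\<^sub>C Q x"
    have "shift S \<mu> (?Q x) = (S ^^ Suc n) x - \<mu> ^ Suc n *\<^sub>C x" for x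
    proof -
      have "shift S \<mu> (?Q x) = shift S \<mu> ((S ^^ n) x) + \<mu> *\<^sub>C shift S \<mu> (Q x)"
        by (simp add: bounded_clinear_add[OF C] bounded_clinear_scaleC[OF C])
      also have "\<dots> = (S ^^ Suc n) x - \<mu> ^ Suc n *\<^sub>C x"
        unfolding Q(1) by (simp add: shift_def cvec.scale_right_diff_distrib scaleC_scaleC)
      finally show ?thesis .
    qed
    moreover have "?Q (shift S \<mu> x) = (S ^^ Suc n) x - \<mu> ^ Suc n *\<^sub>C x" for x
    proof -
      note Sn = bounded_clinear_funpow[OF S, of n]
      have "(S ^^ n) (shift S \<mu> x) = (S ^^ Suc n) x - \<mu> *\<^sub>C (S ^^ n) x"
        by (simp add: shift_def bounded_clinear_diff[OF Sn] bounded_clinear_scaleC[OF Sn] funpow_swap1)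
      then show ?thesis
        unfolding Q(2) by (simp add: cvec.scale_right_diff_distrib scaleC_scaleC)
    qed
    moreover have "?Q ` K \<subseteq> K" if "cvec.subspace K" "S ` K \<subseteq> K" for K
    proof -
      have "?Q x \<in> K" if "x \<in> K" for x
        using Q(3)[of K] funpow_image_subset[of S K n] \<open>cvec.subspace K\<close> \<open>S ` K \<subseteq> K\<close> that
        by (intro cvec.subspace_add cvec.subspace_scale) blast+
      then show ?thesis by blast
    qed
    ultimately show ?case by (intro exI[of _ ?Q] conjI allI impI)
  qed
  then show ?thesis
  proof (elim exE conjE)
    fix Q
    assume "\<forall>x. shift S \<mu> (Q x) = (S ^^ n) x - \<mu> ^ n *\<^sub>C x"
      "\<forall>x. Q (shift S \<mu> x) = (S ^^ n) x - \<mu> ^ n *\<^sub>C x"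
      "\<forall>K. cvec.subspace K \<longrightarrow> S ` K \<subseteq> K \<longrightarrow> Q ` K \<subseteq> K"
    then show ?thesis by (intro that[of Q]) simp_all
  qed
qed

text \<open>
  Modulo \<open>S - \<mu>I\<close>, applying \<open>S ^^ n\<close> is multiplication by the nonzero scalar \<open>\<mu> ^ n\<close>.  So \<open>x\<close> is in the range
  of \<open>S ^^ n\<close> as soon as \<open>(S - \<mu>I) x\<close> is, and \<open>y\<close> is in the range of \<open>S - \<mu>I\<close> if and only if \<open>(S ^^ n) y\<close> is.
  Hence kernel, codimension and closedness can be read off from the restriction to the range of
  \<open>S ^^ n\<close>.
\<close>

lemma upper_semi_Weyl_shift_of_range:
  assumes S: "bounded_clinear S" and \<mu>: "\<mu> \<noteq> 0" and cl: "closed (range (S ^^ n))"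
    and W: "upper_semi_Weyl_on (shift S \<mu>) (range (S ^^ n))"
  shows "upper_semi_Weyl (shift S \<mu>)"
proof -
  let ?Y = "range (S ^^ n)" and ?C = "shift S \<mu>"
  have Sn: "bounded_clinear (S ^^ n)" using S by (rule bounded_clinear_funpow)
  have C: "bounded_clinear ?C" using S by (rule bounded_clinear_shift)
  have sY: "cvec.subspace ?Y" by (intro subspace_clinear_image Sn) simp
  have SY: "S ` ?Y \<subseteq> ?Y"
  proof -
    have "S ((S ^^ n) x) = (S ^^ n) (S x)" for x by (simp add: funpow_swap1)
    then show ?thesis by auto
  qed
  have CY: "?C ` ?Y \<subseteq> ?Y" using sY SY by (rule shift_image_subset)
  obtain Q where Q: "\<And>x. ?C (Q x) = (S ^^ n) x - \<mu> ^ n *\<^sub>C x"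
    "\<And>x. Q (?C x) = (S ^^ n) x - \<mu> ^ n *\<^sub>C x"
    "\<And>K. cvec.subspace K \<Longrightarrow> S ` K \<subseteq> K \<Longrightarrow> Q ` K \<subseteq> K"
    using funpow_minus_power_factor[OF S] by metis
  have cancel: "inverse (\<mu> ^ n) *\<^sub>C (\<mu> ^ n *\<^sub>C x) = x" for x :: 'a
    using \<mu> by (simp add: scaleC_scaleC del: cvec.scale_cancel_left)
  have inY: "x \<in> ?Y" if "?C x \<in> ?Y" for x
  proof -
    have "Q (?C x) \<in> ?Y" using Q(3)[OF sY SY] that by blast
    then have "(S ^^ n) x - Q (?C x) \<in> ?Y" using sY by (intro cvec.subspace_diff) auto
    then have "\<mu> ^ n *\<^sub>C x \<in> ?Y" unfolding Q(2) by simp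
    then show ?thesis using cvec.subspace_scale[OF sY, of "\<mu> ^ n *\<^sub>C x" "inverse (\<mu> ^ n)"] cancel by simp
  qed
  have "0 \<in> ?Y" using sY by (rule cvec.subspace_0)
  then have ker: "kernel ?C \<inter> UNIV = kernel ?C \<inter> ?Y"
    using inY by (auto simp: kernel_def)
  have W': "fdim (kernel ?C \<inter> ?Y)" "closed (?C ` ?Y)" "ecdim (kernel ?C \<inter> ?Y) \<le> ecodim ?Y (?C ` ?Y)"
    using W CY cl by (auto simp: upper_semi_Weyl_on_iff upper_semi_Fredholm_on_iff)
  have "range ?C = (S ^^ n) -` (?C ` ?Y)"
  proof
    show "range ?C \<subseteq> (S ^^ n) -` (?C ` ?Y)"
    proof
      fix y assume "y \<in> range ?C"
      then obtain x where x: "y = ?C x" by blast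
      have "(S ^^ n) y = ?C ((S ^^ n) x)"
        by (simp add: x shift_def bounded_clinear_diff[OF Sn] bounded_clinear_scaleC[OF Sn] funpow_swap1)
      then show "y \<in> (S ^^ n) -` (?C ` ?Y)" by blast
    qed
    show "(S ^^ n) -` (?C ` ?Y) \<subseteq> range ?C"
    proof
      fix y assume "y \<in> (S ^^ n) -` (?C ` ?Y)"
      then obtain w where w: "(S ^^ n) y = ?C w" by blast
      have "\<mu> ^ n *\<^sub>C y = ?C w - ?C (Q y)" using w Q(1)[of y] by simp
      then have "y = inverse (\<mu> ^ n) *\<^sub>C ?C (w - Q y)" using cancel[of y] by (simp add: bounded_clinear_diff[OF C])
      then have "y = ?C (inverse (\<mu> ^ n) *\<^sub>C (w - Q y))" by (simp only: bounded_clinear_scaleC[OF C])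
      then show "y \<in> range ?C" by blast
    qed
  qed
  moreover have "continuous_on UNIV (S ^^ n)"
    by (intro linear_continuous_on bounded_clinear_imp_bounded_linear Sn)
  ultimately have "closed (range ?C)" using closed_vimage[OF W'(2)] by simp
  moreover have "ecodim ?Y (?C ` ?Y) \<le> ecodim UNIV (range ?C)"
    using inY by (intro ecodim_mono sY) auto
  ultimately show ?thesis
    unfolding upper_semi_Weyl_def upper_semi_Weyl_on_iff
    using W' ker by (simp add: upper_semi_Fredholm_on_iff)
qed

section \<open>Generalized Drazin bounded below operators\<close>

text \<open>
  The Kato decomposition \<open>M = M1 \<oplus> K\<close> yields the reducing pair \<open>(M1, K \<oplus> N)\<close>: a nilpotent and a
  quasi-nilpotent part add up to a quasi-nilpotent one.
\<close>

theorem gD_bounded_belowI: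
  assumes S: "bounded_clinear S" and R: "(M, N) \<in> Red S" and q: "quasinilpotent_on S N"
    and F: "upper_semi_Fredholm_on S M" and asc: "kernel (S ^^ Suc p) \<inter> M \<subseteq> kernel (S ^^ p)"
  shows "gD_bounded_below S"
  using R
proof (rule RedE)
  assume M: "cvec.subspace M" "closed M" "S ` M \<subseteq> M" and N: "cvec.subspace N" "closed N" "S ` N \<subseteq> N"
    and sum: "\<And>x. \<exists>m\<in>M. \<exists>n\<in>N. x = m + n" and MN: "M \<inter> N = {0}"
  obtain M1 where M1: "cvec.subspace M1" "closed M1" "S ` M1 \<subseteq> M1" "M1 \<subseteq> M" "bounded_below_on S M1"
    "M1 \<inter> kernel (S ^^ p) \<subseteq> {0}" "\<forall>x \<in> M. \<exists>y \<in> kernel (S ^^ p) \<inter> M. x - y \<in> M1"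
    by (rule kato_decomposition[OF S M F asc])
  let ?K = "kernel (S ^^ p) \<inter> M"
  define N' where "N' = {k + n | k n. k \<in> ?K \<and> n \<in> N}"
  have Sp: "bounded_clinear (S ^^ p)" using S by (rule bounded_clinear_funpow)
  have sK: "cvec.subspace ?K" by (intro cvec.subspace_inter subspace_kernel Sp M)
  have SK: "S ` ?K \<subseteq> ?K"
  proof -
    have "(S ^^ p) (S x) = S ((S ^^ p) x)" for x by (simp add: funpow_swap1)
    then show ?thesis using M(3) bounded_clinear_0[OF S] by (auto simp: kernel_def)
  qed
  have sN': "cvec.subspace N'" unfolding N'_def by (rule cvec.subspace_sums[OF sK N(1)])
  have fdK: "fdim ?K"
    using F M by (intro fdim_kernel_funpow S M) (simp add: upper_semi_Fredholm_on_iff)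
  obtain B where B: "cvec.span B = ?K" "indep_mod {0} B" using fdim_basis[OF sK fdK] by metis
  have "N' = cvec.span (N \<union> B)"
    unfolding cvec.span_Un B(1) using N(1) by (auto simp: N'_def cvec.span_eq_iff[THEN iffD2] add.commute)
      (metis add.commute)+
  then have clN': "closed N'" using closed_span_Un_finite[OF indep_mod_finite[OF B(2)] N(1,2)] by simp
  have SN': "S ` N' \<subseteq> N'"
  proof
    fix y assume "y \<in> S ` N'"
    then obtain k n where kn: "k \<in> ?K" "n \<in> N" "y = S (k + n)" unfolding N'_def by blast
    have "y = S k + S n" using kn by (simp add: bounded_clinear_add[OF S])
    moreover have "S k \<in> ?K" "S n \<in> N" using kn SK N by blast+
    ultimately show "y \<in> N'" unfolding N'_def by blast
  qed
  have R': "(M1, N') \<in> Red S"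
  proof (rule RedI[OF M1(1-3) sN' clN' SN'])
    fix x
    obtain m n where mn: "m \<in> M" "n \<in> N" "x = m + n" using sum by blast
    obtain k where k: "k \<in> ?K" "m - k \<in> M1" using M1(7) mn by blast
    have "x = (m - k) + (k + n)" using mn by simp
    moreover have "k + n \<in> N'" using k mn unfolding N'_def by blast
    ultimately show "\<exists>m\<in>M1. \<exists>n\<in>N'. x = m + n" using k by blast
  next
    show "M1 \<inter> N' \<subseteq> {0}"
    proof
      fix x assume x: "x \<in> M1 \<inter> N'"
      then obtain k n where kn: "k \<in> ?K" "n \<in> N" "x = k + n" unfolding N'_def by blast
      have "n = x - k" using kn by simp
      then have "n \<in> M" using x kn M1 M cvec.subspace_diff by blast
      then have "n = 0" using kn MN by blast
      then show "x \<in> {0}" using x kn M1(6) by auto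
    qed
  qed
  have "invertible_op_on (shift S \<mu>) N'" if \<mu>: "\<mu> \<noteq> 0" for \<mu>
  proof (rule invertible_op_onI)
    let ?C = "shift S \<mu>"
    show C: "bounded_clinear ?C" using S by (rule bounded_clinear_shift)
    show "cvec.subspace N'" "closed N'" by fact+
    note CN = quasinilpotent_on_shift[OF S N(1,3) q \<mu>]
    have CK: "?C ` ?K \<subseteq> ?K" using sK SK by (rule shift_image_subset)
    obtain Q where Q: "\<And>x. ?C (Q x) = (S ^^ p) x - \<mu> ^ p *\<^sub>C x"
      "\<And>x. Q (?C x) = (S ^^ p) x - \<mu> ^ p *\<^sub>C x"
      "\<And>K. cvec.subspace K \<Longrightarrow> S ` K \<subseteq> K \<Longrightarrow> Q ` K \<subseteq> K"
      using funpow_minus_power_factor[OF S] by metis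
    have cancel: "inverse (\<mu> ^ p) *\<^sub>C (\<mu> ^ p *\<^sub>C x) = x" for x :: 'a
      using \<mu> by (simp add: scaleC_scaleC del: cvec.scale_cancel_left)
    have "N' \<subseteq> ?C ` N'"
    proof
      fix y assume "y \<in> N'"
      then obtain k n where kn: "k \<in> ?K" "n \<in> N" "y = k + n" unfolding N'_def by blast
      obtain n' where n': "n' \<in> N" "n = ?C n'" using CN(1) kn by blast
      \<comment> \<open>On \<open>?K\<close>, where \<open>S ^^ p\<close> vanishes, \<open>?C (Q k) = - \<mu> ^ p k\<close>, so this is the preimage of \<open>k\<close>.\<close>
      define k' where "k' = - inverse (\<mu> ^ p) *\<^sub>C Q k"
      have "?C k' = - inverse (\<mu> ^ p) *\<^sub>C ?C (Q k)"
        unfolding k'_def by (rule bounded_clinear_scaleC[OF C])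
      also have "\<dots> = k" using kn(1) cancel[of k] by (simp add: Q(1) kernel_def del: cvec.scale_cancel_left)
      finally have "?C k' = k" .
      moreover have "k' \<in> ?K"
        unfolding k'_def using subsetD[OF Q(3)[OF sK SK] imageI[OF kn(1)]] by (rule cvec.subspace_scale[OF sK])
      ultimately show "y \<in> ?C ` N'"
        using kn n' by (intro image_eqI[of _ _ "k' + n'"]) (auto simp: N'_def bounded_clinear_add[OF C])
    qed
    then show "?C ` N' = N'" using shift_image_subset[OF sN' SN'] by blast
    show "kernel ?C \<inter> N' \<subseteq> {0}"
    proof
      fix x assume "x \<in> kernel ?C \<inter> N'"
      then obtain k n where kn: "k \<in> ?K" "n \<in> N" "x = k + n" "?C x = 0" unfolding N'_def kernel_def by blast
      have "?C k + ?C n = 0" using kn by (simp add: bounded_clinear_add[OF C])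
      moreover have "?C k \<in> M" "?C n \<in> N" using kn CK CN(1) by blast+
      ultimately have z: "?C k = 0" "?C n = 0" using direct_sum_zero[OF M(1) N(1) MN] by blast+
      then have "n = 0" using CN(2) kn by (auto simp: kernel_def)
      moreover have "k = 0"
      proof -
        have "Q 0 = 0" using Q(2)[of 0] bounded_clinear_0[OF C] bounded_clinear_0[OF Sp] by simp
        then have "\<mu> ^ p *\<^sub>C k = 0" using Q(2)[of k] z(1) kn(1) by (simp add: kernel_def)
        then show ?thesis using \<mu> by simp
      qed
      ultimately show "x \<in> {0}" using kn by simp
    qed
  qed
  then have "quasinilpotent_on S N'" by (auto simp: quasinilpotent_on_def spectrum_on_def)
  then show ?thesis using R' M1(5) unfolding gD_bounded_below_def by blast
qed

lemma gD_bounded_below_punctured_injective: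
  assumes S: "bounded_clinear S" and g: "gD_bounded_below S"
  obtains \<epsilon> where "\<epsilon> > 0" "\<And>\<mu>. 0 < cmod \<mu> \<Longrightarrow> cmod \<mu> < \<epsilon> \<Longrightarrow> kernel (shift S \<mu>) \<subseteq> {0}"
proof -
  obtain M N where R: "(M, N) \<in> Red S" and bb: "bounded_below_on S M" and q: "quasinilpotent_on S N"
    using g by (auto simp: gD_bounded_below_def)
  obtain \<epsilon> where \<epsilon>: "\<epsilon> > 0" "\<And>\<mu>. cmod \<mu> < \<epsilon> \<Longrightarrow> bounded_below_on (shift S \<mu>) M"
    using bounded_below_on_shift[OF bb] by blast
  have N: "cvec.subspace N" "S ` N \<subseteq> N" using R by (auto simp: Red_def)
  have "kernel (shift S \<mu>) \<subseteq> {0}" if \<mu>: "0 < cmod \<mu>" "cmod \<mu> < \<epsilon>" for \<mu>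
  proof -
    have "kernel (shift S \<mu>) \<subseteq> M"
      using \<mu> by (intro kernel_Red_shift[OF S R] quasinilpotent_on_shift[OF S N q]) auto
    then show ?thesis using bounded_below_on_kernel[OF \<epsilon>(2)[OF \<mu>(2)]] by blast
  qed
  then show ?thesis using \<epsilon> that by blast
qed

lemma gD_bounded_below_imp_gD_upper_semi_Weyl:
  assumes "bounded_clinear S" "gD_bounded_below S"
  shows "gD_upper_semi_Weyl S"
proof -
  obtain M N where R: "(M, N) \<in> Red S" "bounded_below_on S M" "quasinilpotent_on S N"
    using assms by (auto simp: gD_bounded_below_def)
  moreover have "upper_semi_Weyl_on S M"
    using assms R by (intro bounded_below_imp_upper_semi_Weyl_on) (auto simp: Red_def)
  ultimately show ?thesis unfolding gD_upper_semi_Weyl_def by blast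
qed

lemma upper_semi_Weyl_imp_gD_upper_semi_Weyl:
  "bounded_clinear S \<Longrightarrow> upper_semi_Weyl S \<Longrightarrow> gD_upper_semi_Weyl S"
  unfolding gD_upper_semi_Weyl_def upper_semi_Weyl_def
  using Red_UNIV_zero quasinilpotent_on_zero by blast

section \<open>Ascent and Browder operators\<close>

lemma ascent_finiteE:
  assumes "ascent S < \<infinity>"
  obtains p where "ascent S = enat p" "kernel (S ^^ p) = kernel (S ^^ Suc p)"
proof -
  let ?P = "{p. kernel (S ^^ p) = kernel (S ^^ Suc p)}"
  have "?P \<noteq> {}"
  proof
    assume e: "?P = {}"
    have "ascent S = \<infinity>" unfolding ascent_def e by (simp add: top_enat_def)
    then show False using assms by simp
  qed
  then obtain q where "q \<in> ?P" by blast
  then have "enat q \<in> enat ` ?P" by (rule imageI)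
  then have "ascent S \<in> enat ` ?P" unfolding ascent_def by (rule wellorder_InfI)
  then show ?thesis using that by auto
qed

lemma ascent_finiteI:
  assumes "bounded_clinear S" "kernel (S ^^ Suc p) \<subseteq> kernel (S ^^ p)"
  shows "ascent S < \<infinity>"
proof -
  have "kernel (S ^^ p) = kernel (S ^^ Suc p)"
    using assms kernel_funpow_mono[OF assms(1), of p "Suc p"] by auto
  then have "ascent S \<le> enat p" unfolding ascent_def by (intro INF_lower) simp
  then show ?thesis by (meson enat_ord_code(4) order_le_less_trans)
qed

text \<open>
  Let \<open>K\<close> be the generalized kernel.  It is finite-dimensional, invariant and contains the kernel, so
  \<open>S\<close> restricted to \<open>K\<close> has index zero: the codimension of \<open>S K\<close> in \<open>K\<close> equals the dimension of the kernel.
  Finite ascent means that the range of \<open>S\<close> meets \<open>K\<close> in \<open>S K\<close> only, so that the cokernel of \<open>S\<close> is at least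
  as large.
\<close>

theorem upper_semi_Browder_imp_upper_semi_Weyl:
  assumes S: "bounded_clinear S" and B: "upper_semi_Browder S"
  shows "upper_semi_Weyl S"
proof -
  have F: "upper_semi_Fredholm_on S UNIV" using B by (simp add: upper_semi_Browder_def)
  obtain p where p: "kernel (S ^^ p) = kernel (S ^^ Suc p)"
    using B ascent_finiteE[of S] unfolding upper_semi_Browder_def by metis
  have fd: "fdim (kernel S)" using F by (simp add: upper_semi_Fredholm_on_iff)
  let ?K = "kernel (S ^^ p)"
  have Sp: "bounded_clinear (S ^^ p)" using S by (rule bounded_clinear_funpow)
  have sK: "cvec.subspace ?K" using Sp by (rule subspace_kernel)
  have fdK: "fdim ?K" using fdim_kernel_funpow[OF S, of UNIV p] fd by simp
  have SK: "S ` ?K \<subseteq> ?K"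
  proof -
    have "(S ^^ p) (S x) = S ((S ^^ p) x)" for x by (simp add: funpow_swap1)
    then show ?thesis using bounded_clinear_0[OF S] by (auto simp: kernel_def)
  qed
  have sSK: "cvec.subspace (S ` ?K)" using S sK by (rule subspace_clinear_image)
  have kerK: "kernel S \<subseteq> ?K" using kernel_funpow_mono[OF S, of 1 "Suc p"] p by simp
  have ranK: "range S \<inter> ?K \<subseteq> S ` ?K"
  proof
    fix y assume y: "y \<in> range S \<inter> ?K"
    then obtain x where x: "y = S x" by blast
    have "(S ^^ Suc p) x = (S ^^ p) (S x)" by (simp add: funpow_swap1)
    then have "x \<in> kernel (S ^^ Suc p)" using y x by (simp add: kernel_def)
    then show "y \<in> S ` ?K" using p x by blast
  qed
  obtain B where B: "B \<subseteq> kernel S" "cvec.span B = kernel S" "indep_mod {0} B" "ecdim (kernel S) = enat (card B)"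
    by (rule fdim_basis[OF subspace_kernel[OF S] fd])
  obtain E where E: "E \<subseteq> ?K" "cvec.span E = ?K" "indep_mod {0} E" "ecdim ?K = enat (card E)"
    by (rule fdim_basis[OF sK fdK])
  have finE: "finite E" and finB: "finite B" using E(3) B(3) by (simp_all only: indep_mod_finite)
  \<comment> \<open>\<open>B \<union> B'\<close> is a basis of \<open>?K\<close> and \<open>G\<close> one of a complement of \<open>S ` ?K\<close> in \<open>?K\<close>.  As \<open>S ` B'\<close> spans \<open>S ` ?K\<close>,
    comparing the sizes gives \<open>card B \<le> card G\<close>.\<close>
  obtain B' where B': "B' \<subseteq> E" "B \<inter> B' = {}" "indep_mod {0} (B \<union> B')" "E \<subseteq> cvec.span ({0} \<union> (B \<union> B'))"
    by (rule indep_mod_extend[OF finE cvec.subspace_single_0 B(3)])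
  obtain G where "G \<subseteq> E" "{} \<inter> G = {}" "indep_mod (S ` ?K) ({} \<union> G)"
      "E \<subseteq> cvec.span (S ` ?K \<union> ({} \<union> G))"
    by (rule indep_mod_extend[OF finE sSK indep_mod_empty])
  then have G: "G \<subseteq> E" "indep_mod (S ` ?K) G" "E \<subseteq> cvec.span (S ` ?K \<union> G)" by (simp_all only: Un_empty_left)
  have finB': "finite B'" and finG: "finite G" using finite_subset[OF B'(1) finE] finite_subset[OF G(1) finE] .
  have "?K \<subseteq> cvec.span (B \<union> B')"
    using B'(4) cvec.span_minimal[of E "cvec.span (B \<union> B')"] E(2) by (simp add: cvec.span_insert_0)
  then have "S ` ?K \<subseteq> cvec.span (S ` (B \<union> B'))" by (auto simp: span_clinear_image[OF S])
  also have "\<dots> \<subseteq> cvec.span (S ` B')"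
  proof (rule cvec.span_minimal)
    have "S b \<in> cvec.span (S ` B')" if "b \<in> B" for b
      using that B(1) cvec.span_zero[of "S ` B'"] by (auto simp: kernel_def)
    then show "S ` (B \<union> B') \<subseteq> cvec.span (S ` B')" using cvec.span_superset[of "S ` B'"] by blast
  qed simp
  finally have SKB: "S ` ?K \<subseteq> cvec.span (S ` B')" .
  have "?K \<subseteq> cvec.span ({0} \<union> (S ` B' \<union> G))"
  proof -
    have "cvec.span (S ` B') \<subseteq> cvec.span ({0} \<union> (S ` B' \<union> G))" by (rule cvec.span_mono) blast
    then have "S ` ?K \<union> G \<subseteq> cvec.span ({0} \<union> (S ` B' \<union> G))"
      using SKB cvec.span_superset[of "{0} \<union> (S ` B' \<union> G)"] by blast
    then have "cvec.span (S ` ?K \<union> G) \<subseteq> cvec.span ({0} \<union> (S ` B' \<union> G))" by (rule cvec.span_minimal) simp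
    then have "E \<subseteq> cvec.span ({0} \<union> (S ` B' \<union> G))" using G(3) by blast
    then show ?thesis using E(2) cvec.span_minimal[OF _ cvec.subspace_span] by metis
  qed
  moreover have "B \<union> B' \<subseteq> ?K" using B(1) kerK B'(1) E(1) by blast
  ultimately have "card (B \<union> B') \<le> card (S ` B' \<union> G)"
    using finB' finG B'(3) by (intro indep_mod_card_le[of _ "{0}"]) auto
  also have "\<dots> \<le> card (S ` B') + card G" by (rule card_Un_le)
  also have "card (S ` B') \<le> card B'" using finB' by (rule card_image_le)
  finally have "card B \<le> card G" using card_Un_disjoint[OF finB finB' B'(2)] by simp
  moreover have "enat (card G) \<le> ecodim ?K (S ` ?K)" using G E by (intro ecodim_ge) auto
  moreover have "ecodim ?K (S ` ?K) \<le> ecodim UNIV (range S)"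
    by (rule ecodim_mono[OF _ sK ranK]) simp
  ultimately have "ecdim (kernel S) \<le> ecodim UNIV (range S)"
    unfolding B(4) by (meson enat_ord_simps(1) order_trans)
  then show ?thesis using F by (simp add: upper_semi_Weyl_def upper_semi_Weyl_on_iff)
qed

section \<open>The single valued extension property\<close>

text \<open>
  The identity theorem for vector-valued functions: compose with a functional that detects the value
  at \<open>w\<close> and use the scalar identity theorem.
\<close>

lemma vector_analytic_eq_zero:
  assumes f: "vector_analytic_on f U" and U: "open U" "connected U" "\<mu> \<in> U" and e: "e > 0"
    and zero: "\<And>z. z \<in> U \<Longrightarrow> 0 < dist \<mu> z \<Longrightarrow> dist \<mu> z < e \<Longrightarrow> f z = (0 :: 'a::complex_banach)"
    and w: "w \<in> U"
  shows "f w = 0"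
proof (rule ccontr)
  assume "f w \<noteq> 0"
  then obtain \<phi> where \<phi>: "cfunctional \<phi>" "\<phi> (f w) = (1 :: complex)" and \<phi>0: "\<phi> 0 = 0"
    using separating_functional[of "{0}" "f w"] by (metis closed_singleton cvec.subspace_single_0 insertI1 singletonD)
  have hol: "(\<phi> \<circ> f) holomorphic_on U"
    unfolding holomorphic_on_def field_differentiable_def
  proof
    fix z assume "z \<in> U"
    then obtain D where "(f has_derivative (\<lambda>h. h *\<^sub>C D)) (at z)" using f by (auto simp: vector_analytic_on_def)
    then have "(f has_derivative (\<lambda>h. h *\<^sub>C D)) (at z within U)" by (rule has_derivative_at_withinI)
    then have "((\<lambda>z. \<phi> (f z)) has_derivative (\<lambda>h. \<phi> (h *\<^sub>C D))) (at z within U)"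
      by (rule bounded_linear.has_derivative[OF conjunct1[OF \<phi>(1)[unfolded cfunctional_def]]])
    moreover have "(\<lambda>h. \<phi> (h *\<^sub>C D)) = (*) (\<phi> D)"
      using \<phi>(1) by (simp add: cfunctional_def fun_eq_iff mult.commute)
    ultimately show "\<exists>D. (\<phi> \<circ> f has_field_derivative D) (at z within U)"
      unfolding has_field_derivative_def o_def by metis
  qed
  have lim: "\<mu> islimpt (U \<inter> (ball \<mu> e - {\<mu>}))"
  proof -
    have "\<mu> islimpt (U \<inter> ball \<mu> e)" using U e by (intro open_imp_islimpt open_Int) auto
    moreover have "U \<inter> (ball \<mu> e - {\<mu>}) = U \<inter> ball \<mu> e - {\<mu>}" by blast
    ultimately show ?thesis using islimpt_punctured by metis
  qed
  have "(\<phi> \<circ> f) w = 0"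
  proof (rule analytic_continuation[OF hol U(1,2) _ U(3) lim _ w])
    fix z assume "z \<in> U \<inter> (ball \<mu> e - {\<mu>})"
    then have "f z = 0" by (intro zero) auto
    then show "(\<phi> \<circ> f) z = 0" using \<phi>0 by simp
  qed blast
  then show False using \<phi>(2) by simp
qed

text \<open>
  Near \<mu>, but off \<mu>, no eigenvectors exist; the neighbourhood \<open>U\<close> may however be large, and the identity
  theorem is needed to cover it.
\<close>

theorem gD_bounded_below_imp_SVEP:
  assumes T: "bounded_clinear T" and g: "gD_bounded_below (shift T \<mu>)"
  shows "SVEP_at T \<mu>"
  unfolding SVEP_at_def
proof (intro allI impI ballI, elim conjE)
  fix U f w assume U: "open U" "connected U" "\<mu> \<in> U" and f: "vector_analytic_on f U"
    and eig: "\<forall>z\<in>U. shift T z (f z) = 0" and w: "w \<in> U"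
  obtain \<epsilon> where \<epsilon>: "\<epsilon> > 0" "\<And>\<nu>. 0 < cmod \<nu> \<Longrightarrow> cmod \<nu> < \<epsilon> \<Longrightarrow> kernel (shift (shift T \<mu>) \<nu>) \<subseteq> {0}"
    using gD_bounded_below_punctured_injective[OF bounded_clinear_shift[OF T] g] by blast
  have "f z = 0" if z: "z \<in> U" "0 < dist \<mu> z" "dist \<mu> z < \<epsilon>" for z
  proof -
    have "kernel (shift (shift T \<mu>) (z - \<mu>)) \<subseteq> {0}"
      using z by (intro \<epsilon>(2)) (auto simp: dist_norm norm_minus_commute)
    then show ?thesis using eig z by (auto simp: shift_shift kernel_def)
  qed
  then show "f w = 0" using vector_analytic_eq_zero[OF f U \<epsilon>(1)] w by blast
qed

theorem SVEP_imp_finite_ascent_on: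
  assumes T: "bounded_clinear T" and sv: "SVEP_at T \<mu>"
    and M: "cvec.subspace M" "closed M" "shift T \<mu> ` M \<subseteq> M" and F: "upper_semi_Fredholm_on (shift T \<mu>) M"
  shows "\<exists>p. kernel (shift T \<mu> ^^ Suc p) \<inter> M \<subseteq> kernel (shift T \<mu> ^^ p)"
proof (rule ccontr)
  assume "\<not> ?thesis"
  then obtain r f where r: "r > 0" and f: "vector_analytic_on f (ball 0 r)" "f 0 \<noteq> 0"
    "\<And>z. cmod z < r \<Longrightarrow> shift (shift T \<mu>) z (f z) = 0"
    using eigenfunction_if_infinite_ascent[OF bounded_clinear_shift[OF T] M F] by metis
  have "vector_analytic_on (\<lambda>z. f (z - \<mu>)) (ball \<mu> r)"
    unfolding vector_analytic_on_def
  proof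
    fix z assume "z \<in> ball \<mu> r"
    then have "z - \<mu> \<in> ball 0 r" by (simp add: dist_norm norm_minus_commute)
    then obtain D where "(f has_derivative (\<lambda>h. h *\<^sub>C D)) (at (z - \<mu>))"
      using f(1) unfolding vector_analytic_on_def by blast
    moreover have "((\<lambda>z. z - \<mu>) has_derivative (\<lambda>h. h)) (at z)"
      by (auto intro!: derivative_eq_intros)
    ultimately have "((\<lambda>z. f (z - \<mu>)) has_derivative (\<lambda>h. h *\<^sub>C D)) (at z)"
      using has_derivative_compose by blast
    then show "\<exists>D. ((\<lambda>z. f (z - \<mu>)) has_derivative (\<lambda>h. h *\<^sub>C D)) (at z)" by blast
  qed
  moreover have "\<forall>z\<in>ball \<mu> r. shift T z (f (z - \<mu>)) = 0"
  proof
    fix z assume "z \<in> ball \<mu> r"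
    then show "shift T z (f (z - \<mu>)) = 0"
      using f(3)[of "z - \<mu>"] by (simp add: shift_shift dist_norm norm_minus_commute)
  qed
  ultimately have "f (\<mu> - \<mu>) = 0"
    using sv[unfolded SVEP_at_def, rule_format, of "ball \<mu> r" "\<lambda>z. f (z - \<mu>)" \<mu>] r by simp
  then show False using f(2) by simp
qed

text \<open>
  Otherwise the eigenfunction \<open>f\<close> is nonzero on a disc around 0.  At a point \<mu> \<open>\<noteq> 0\<close> of this disc the
  operator \<open>S - \<mu>I\<close> is upper semi-Browder, hence generalized Drazin bounded below, so there are points
  arbitrarily close to \<mu> that are not eigenvalues.
\<close>

theorem finite_ascent_on_if_punctured_Browder:
  assumes S: "bounded_clinear S" and M: "cvec.subspace M" "closed M" "S ` M \<subseteq> M"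
    and F: "upper_semi_Fredholm_on S M" and \<epsilon>: "\<epsilon> > 0"
    and B: "\<And>\<mu>. 0 < cmod \<mu> \<Longrightarrow> cmod \<mu> < \<epsilon> \<Longrightarrow> upper_semi_Browder (shift S \<mu>)"
  shows "\<exists>p. kernel (S ^^ Suc p) \<inter> M \<subseteq> kernel (S ^^ p)"
proof (rule ccontr)
  assume "\<not> ?thesis"
  then obtain r f where r: "r > 0" and f: "vector_analytic_on f (ball 0 r)" "f 0 \<noteq> 0"
    "\<And>z. cmod z < r \<Longrightarrow> shift S z (f z) = 0"
    using eigenfunction_if_infinite_ascent[OF S M F] by metis
  have "isCont f 0"
    using f(1) r unfolding vector_analytic_on_def by (metis centre_in_ball has_derivative_continuous)
  then obtain \<delta> where \<delta>: "\<delta> > 0" "\<And>z. dist z 0 < \<delta> \<Longrightarrow> f z \<noteq> 0"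
    using continuous_at_avoid[of 0 f 0] f(2) by (metis dist_commute)
  \<comment> \<open>Both \<mu> and \<open>\<mu> + \<nu>\<close> have to stay in the disc of radius \<open>m\<close>, with \<nu> so small that \<open>\<mu> + \<nu>\<close> is no eigenvalue.\<close>
  define m where "m = min \<epsilon> (min r \<delta>)"
  have m: "m > 0" "m \<le> \<epsilon>" "m \<le> r" "m \<le> \<delta>" using \<epsilon> r \<delta>(1) by (auto simp: m_def)
  define \<mu> where "\<mu> = complex_of_real (m / 2)"
  let ?C = "shift S \<mu>"
  have n\<mu>: "cmod \<mu> = m / 2" using m by (simp add: \<mu>_def)
  have C: "bounded_clinear ?C" using S by (rule bounded_clinear_shift)
  have Br: "upper_semi_Browder ?C" using n\<mu> m by (intro B) auto
  then obtain p where p: "kernel (?C ^^ p) = kernel (?C ^^ Suc p)"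
    using ascent_finiteE[of ?C] unfolding upper_semi_Browder_def by metis
  have "gD_bounded_below ?C"
  proof (rule gD_bounded_belowI[OF C Red_UNIV_zero[OF C] quasinilpotent_on_zero[OF C]])
    show "upper_semi_Fredholm_on ?C UNIV" using Br by (simp add: upper_semi_Browder_def)
    show "kernel (?C ^^ Suc p) \<inter> UNIV \<subseteq> kernel (?C ^^ p)" unfolding p by blast
  qed
  then obtain \<eta> where \<eta>: "\<eta> > 0" "\<And>\<nu>. 0 < cmod \<nu> \<Longrightarrow> cmod \<nu> < \<eta> \<Longrightarrow> kernel (shift ?C \<nu>) \<subseteq> {0}"
    using gD_bounded_below_punctured_injective[OF C] by blast
  define \<nu> where "\<nu> = complex_of_real (min \<eta> (m / 2) / 2)"
  have \<nu>: "0 < cmod \<nu>" "cmod \<nu> < \<eta>" "cmod \<nu> < m / 2" using \<eta>(1) m(1) by (auto simp: \<nu>_def)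
  have "cmod (\<mu> + \<nu>) < m" using norm_triangle_ineq[of \<mu> \<nu>] \<nu>(3) n\<mu> by simp
  then have "f (\<mu> + \<nu>) \<in> kernel (shift ?C \<nu>)" "f (\<mu> + \<nu>) \<noteq> 0"
    using f(3)[of "\<mu> + \<nu>"] \<delta>(2)[of "\<mu> + \<nu>"] m by (auto simp: kernel_def shift_shift)
  then show False using \<eta>(2)[OF \<nu>(1,2)] by blast
qed

section \<open>Left Drazin invertible operators\<close>

text \<open>
  The sum of the kernel of \<open>S\<close> and the range of \<open>S ^^ m\<close> is the preimage of the range of \<open>S ^^ Suc m\<close>, hence
  closed.  The kernel hypothesis makes the sum direct, and a direct sum of operator ranges can only be
  closed if both are: by the open mapping theorem for the map \<open>(a, u) \<mapsto> a + (S ^^ m) u\<close>, the component in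
  the kernel depends continuously on the sum.
\<close>

lemma closed_range_funpow_descend:
  assumes S: "bounded_clinear S" and cl: "closed (range (S ^^ Suc m))"
    and ker: "kernel (S ^^ Suc m) \<subseteq> kernel (S ^^ m)"
  shows "closed (range (S ^^ m))"
proof -
  have Sm: "bounded_clinear (S ^^ m)" using S by (rule bounded_clinear_funpow)
  have sucm: "S ((S ^^ m) x) = (S ^^ Suc m) x" for x by simp
  let ?W = "S -` range (S ^^ Suc m)"
  let ?f = "\<lambda>p. fst p + (S ^^ m) (snd p)"
  have "continuous_on UNIV S" by (intro linear_continuous_on bounded_clinear_imp_bounded_linear S)
  then have clW: "closed ?W" using closed_vimage[OF cl] by blast
  have f: "bounded_linear ?f"
    by (intro bounded_linear_add bounded_linear_fst bounded_linear_compose[OF bounded_clinear_imp_bounded_linear[OF Sm]]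
        bounded_linear_snd)
  have im: "?f ` (kernel S \<times> UNIV) = ?W"
  proof
    show "?f ` (kernel S \<times> UNIV) \<subseteq> ?W"
      by (auto simp: kernel_def bounded_clinear_add[OF S])
    show "?W \<subseteq> ?f ` (kernel S \<times> UNIV)"
    proof
      fix y assume "y \<in> ?W"
      then obtain x where x: "S y = (S ^^ Suc m) x" by auto
      then have "y - (S ^^ m) x \<in> kernel S" by (simp add: kernel_def bounded_clinear_diff[OF S])
      then show "y \<in> ?f ` (kernel S \<times> UNIV)" by (intro image_eqI[of _ _ "(y - (S ^^ m) x, x)"]) auto
    qed
  qed
  have sub: "subspace (kernel S \<times> (UNIV :: 'a set))"
    by (intro subspace_Times csubspace_imp_subspace subspace_kernel S) simp_all
  have cl': "closed (kernel S \<times> (UNIV :: 'a set))" by (intro closed_Times closed_kernel S closed_UNIV)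
  have "closed (?f ` (kernel S \<times> UNIV))" unfolding im by (rule clW)
  then obtain C where C: "C > 0"
    "\<And>w. w \<in> ?f ` (kernel S \<times> UNIV) \<Longrightarrow> \<exists>x\<in>kernel S \<times> UNIV. ?f x = w \<and> norm x \<le> C * norm w"
    by (rule open_mapping_closed_range[OF f sub cl']) (rule that; blast)
  have inter: "x = 0" if x: "x \<in> kernel S" "x \<in> range (S ^^ m)" for x
  proof -
    obtain v where v: "x = (S ^^ m) v" using x(2) by blast
    then have "v \<in> kernel (S ^^ Suc m)" using x(1) by (simp add: kernel_def)
    then show ?thesis using ker v unfolding kernel_def by blast
  qed
  show ?thesis
    unfolding closed_sequential_limits
  proof (intro allI impI, elim conjE)
    fix y l assume y: "\<forall>k. y k \<in> range (S ^^ m)" and lim: "y \<longlonglongrightarrow> l"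
    have "y k \<in> ?W" for k
    proof -
      obtain v where v: "y k = (S ^^ m) v" using y by blast
      show ?thesis unfolding v vimage_eq sucm by (rule rangeI)
    qed
    then have "l \<in> ?W" using closed_sequentially[OF clW _ lim] by blast
    then obtain a x where a: "a \<in> kernel S" "l = a + (S ^^ m) x" unfolding im[symmetric] by auto
    \<comment> \<open>\<open>y k - l\<close> has the kernel component \<open>- a\<close>, and so has its representation of controlled norm; hence
      \<open>a\<close> is arbitrarily small.\<close>
    have "norm a \<le> C * norm (y k - l)" for k
    proof -
      obtain v where v: "y k = (S ^^ m) v" using y by blast
      have "y k - l = ?f (- a, v - x)" using v a by (simp add: bounded_clinear_diff[OF Sm])
      moreover have "- a \<in> kernel S" using a by (intro cvec.subspace_neg subspace_kernel S)
      ultimately have "y k - l \<in> ?f ` (kernel S \<times> UNIV)" by blast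
      then obtain b u where bu: "b \<in> kernel S" "b + (S ^^ m) u = y k - l" "norm (b, u) \<le> C * norm (y k - l)"
        using C(2) by force
      have "a + b \<in> kernel S" using a bu by (intro cvec.subspace_add subspace_kernel S)
      moreover have "a + b = (S ^^ m) (v - x - u)" using bu(2) v a
        by (simp add: bounded_clinear_diff[OF Sm] bounded_clinear_add[OF Sm] algebra_simps)
      ultimately have "a + b = 0" using inter by blast
      then have "norm a = norm b" by (simp add: add_eq_0_iff)
      then show ?thesis using bu(3) norm_fst_le[of b u] by simp
    qed
    moreover have "(\<lambda>k. C * norm (y k - l)) \<longlonglongrightarrow> 0"
      using lim by (intro tendsto_mult_right_zero) (simp add: tendsto_norm_zero LIM_zero)
    ultimately have "norm a \<le> 0" by (intro LIMSEQ_le_const) auto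
    then show "l \<in> range (S ^^ m)" using a by auto
  qed
qed

text \<open>
  With \<open>p\<close> the ascent, \<open>S\<close> is injective on the range of \<open>S ^^ p\<close> and its range there is closed by
  assumption, so that the restriction is even bounded below.
\<close>

theorem left_Drazin_invertible_imp_upper_semi_B_Weyl:
  assumes S: "bounded_clinear S" and L: "left_Drazin_invertible S"
  shows "upper_semi_B_Weyl S"
proof -
  obtain p where p: "ascent S = enat p" "kernel (S ^^ p) = kernel (S ^^ Suc p)"
    using L ascent_finiteE[of S] unfolding left_Drazin_invertible_def by metis
  have clS: "closed (range (S ^^ Suc p))" using L p(1) by (simp add: left_Drazin_invertible_def)
  have cl: "closed (range (S ^^ p))"
    by (rule closed_range_funpow_descend[OF S clS]) (simp only: p(2) order_refl)
  let ?Y = "range (S ^^ p)"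
  have sY: "cvec.subspace ?Y" by (intro subspace_clinear_image bounded_clinear_funpow S) simp
  have im: "S ` ?Y = range (S ^^ Suc p)" by auto
  have "kernel S \<inter> ?Y \<subseteq> {0}"
  proof
    fix y assume "y \<in> kernel S \<inter> ?Y"
    then obtain x where x: "y = (S ^^ p) x" "x \<in> kernel (S ^^ Suc p)" by (auto simp: kernel_def)
    then show "y \<in> {0}" unfolding p(2)[symmetric] by (simp add: kernel_def)
  qed
  then have "bounded_below_on S ?Y" using clS im by (intro bounded_below_onI_closed_range[OF S sY cl]) auto
  moreover have "S ` ?Y \<subseteq> ?Y"
    unfolding im using funpow_image_antimono[of S UNIV p "Suc p"] by simp
  ultimately have "upper_semi_Weyl_on S ?Y"
    by (intro bounded_below_imp_upper_semi_Weyl_on[OF S sY cl])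
  then show ?thesis using cl unfolding upper_semi_B_Weyl_def by blast
qed

text \<open>
  The ranges of all higher powers are closed since the restriction is upper semi-Fredholm.  The ascent
  may be smaller than \<open>n\<close>; then closedness descends to the power required by the definition.
\<close>

theorem left_Drazin_invertibleI:
  assumes S: "bounded_clinear S" and cl: "closed (range (S ^^ n))"
    and F: "upper_semi_Fredholm_on S (range (S ^^ n))"
    and asc: "kernel (S ^^ Suc q) \<inter> range (S ^^ n) \<subseteq> kernel (S ^^ q)"
  shows "left_Drazin_invertible S"
proof -
  let ?Y = "range (S ^^ n)"
  have sY: "cvec.subspace ?Y" by (intro subspace_clinear_image bounded_clinear_funpow S) simp
  have SY: "S ` ?Y \<subseteq> ?Y"
    using funpow_image_antimono[of S UNIV n "Suc n"] by (simp add: image_comp)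
  have fd: "fdim (kernel S \<inter> ?Y)" "closed (S ` ?Y)"
    using F SY cl by (auto simp: upper_semi_Fredholm_on_iff)
  have big: "closed (range (S ^^ m))" if "m \<ge> n" for m
  proof -
    have "range (S ^^ ((m - n) + n)) = (S ^^ (m - n)) ` ?Y" by (simp only: funpow_add image_comp)
    then show ?thesis using closed_funpow_image[OF S sY cl SY fd, of "m - n"] that by simp
  qed
  have "kernel (S ^^ Suc (q + n)) \<subseteq> kernel (S ^^ (q + n))"
  proof
    fix x assume x: "x \<in> kernel (S ^^ Suc (q + n))"
    have "(S ^^ Suc q) ((S ^^ n) x) = (S ^^ Suc (q + n)) x" by (simp add: funpow_add)
    then have "(S ^^ n) x \<in> kernel (S ^^ Suc q) \<inter> ?Y" using x by (simp add: kernel_def)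
    then have "(S ^^ n) x \<in> kernel (S ^^ q)" using asc by blast
    then show "x \<in> kernel (S ^^ (q + n))" by (simp add: kernel_def funpow_add)
  qed
  then have fin: "ascent S < \<infinity>" by (rule ascent_finiteI[OF S])
  then obtain p where p: "ascent S = enat p" "kernel (S ^^ p) = kernel (S ^^ Suc p)"
    by (rule ascent_finiteE)
  have "kernel (S ^^ Suc m) \<subseteq> kernel (S ^^ m)" if "m \<ge> p" for m
  proof -
    have "kernel (S ^^ Suc m) \<inter> UNIV \<subseteq> kernel (S ^^ p)"
      by (rule kernel_funpow_stable[OF S]) (use that p(2) in auto)
    then show ?thesis using kernel_funpow_mono[OF S that] by blast
  qed
  then have desc: "closed (range (S ^^ m))" if "m \<ge> p" "closed (range (S ^^ Suc m))" for m
    using closed_range_funpow_descend[OF S that(2)] that(1) by blast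
  have "closed (range (S ^^ Suc p))"
  proof (cases "n \<le> Suc p")
    case True
    then show ?thesis by (rule big)
  next
    case False
    then have "Suc p \<le> n" by simp
    then show ?thesis
    proof (induction rule: inc_induct)
      case base
      show ?case by (rule cl)
    next
      case (step m)
      show ?case by (rule desc) (use step in auto)
    qed
  qed
  then show ?thesis using fin p(1) by (simp add: left_Drazin_invertible_def)
qed

section \<open>The equivalences\<close>

lemma a_Browder_theorem_iff:
  assumes T: "bounded_clinear T"
  shows "a_Browder_theorem T \<longleftrightarrow> (\<forall>\<mu>. upper_semi_Weyl (shift T \<mu>) \<longrightarrow> upper_semi_Browder (shift T \<mu>))"
  using upper_semi_Browder_imp_upper_semi_Weyl[OF bounded_clinear_shift[OF T]]
  unfolding a_Browder_theorem_def spectrum_uW_def spectrum_uB_def by blast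

lemma bounded_below_imp_left_Drazin_invertible:
  assumes S: "bounded_clinear S" and bb: "bounded_below_on S UNIV"
  shows "left_Drazin_invertible S"
proof (rule left_Drazin_invertibleI[OF S, of 0 0])
  have "kernel S \<subseteq> {0}" using bounded_below_on_kernel[OF bb] by simp
  then show "kernel (S ^^ Suc 0) \<inter> range (S ^^ 0) \<subseteq> kernel (S ^^ 0)" by (simp add: kernel_def)
  show "upper_semi_Fredholm_on S (range (S ^^ 0))"
    using bounded_below_imp_upper_semi_Weyl_on[OF S _ _ _ bb] by (simp add: upper_semi_Weyl_on_def)
qed simp

lemma generalized_a_Browder_theorem_iff:
  assumes T: "bounded_clinear T"
  shows "generalized_a_Browder_theorem T \<longleftrightarrow>
    (\<forall>\<mu>. upper_semi_B_Weyl (shift T \<mu>) \<longrightarrow> left_Drazin_invertible (shift T \<mu>))"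
proof -
  have S: "bounded_clinear (shift T \<mu>)" for \<mu> using T by (rule bounded_clinear_shift)
  show ?thesis
    using left_Drazin_invertible_imp_upper_semi_B_Weyl[OF S] bounded_below_imp_left_Drazin_invertible[OF S]
    unfolding generalized_a_Browder_theorem_def spectrum_ap_def left_poles_def by blast
qed

lemma spectrum_gDM_eq_iff:
  assumes T: "bounded_clinear T"
  shows "spectrum_gDM T = spectrum_gDW_plus T \<longleftrightarrow>
    (\<forall>\<mu>. gD_upper_semi_Weyl (shift T \<mu>) \<longrightarrow> gD_bounded_below (shift T \<mu>))"
  using gD_bounded_below_imp_gD_upper_semi_Weyl[OF bounded_clinear_shift[OF T]]
  unfolding spectrum_gDM_def spectrum_gDW_plus_def by blast

lemma upper_semi_Browder_shift_shift:
  assumes "bounded_clinear T" "a_Browder_theorem T" "upper_semi_Weyl (shift (shift T \<mu>) \<nu>)"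
  shows "upper_semi_Browder (shift (shift T \<mu>) \<nu>)"
  using assms by (simp add: a_Browder_theorem_iff shift_shift)

lemma a_Browder_imp_generalized_a_Browder:
  assumes T: "bounded_clinear T" and B: "a_Browder_theorem T"
  shows "generalized_a_Browder_theorem T"
  unfolding generalized_a_Browder_theorem_iff[OF T]
proof (intro allI impI)
  fix \<mu> assume "upper_semi_B_Weyl (shift T \<mu>)"
  let ?S = "shift T \<mu>"
  have S: "bounded_clinear ?S" using T by (rule bounded_clinear_shift)
  obtain n where n: "closed (range (?S ^^ n))" "upper_semi_Weyl_on ?S (range (?S ^^ n))"
    using \<open>upper_semi_B_Weyl ?S\<close> by (auto simp: upper_semi_B_Weyl_def)
  let ?Y = "range (?S ^^ n)"
  have sY: "cvec.subspace ?Y" by (intro subspace_clinear_image bounded_clinear_funpow S) simp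
  have SY: "?S ` ?Y \<subseteq> ?Y"
    using funpow_image_antimono[of ?S UNIV n "Suc n"] by (simp add: image_comp)
  obtain \<epsilon> where \<epsilon>: "\<epsilon> > 0" "\<And>\<nu>. cmod \<nu> < \<epsilon> \<Longrightarrow> upper_semi_Weyl_on (shift ?S \<nu>) ?Y"
    using upper_semi_Weyl_on_shift[OF S sY n(1) SY n(2)] by blast
  have F: "upper_semi_Fredholm_on ?S ?Y" using n(2) by (simp add: upper_semi_Weyl_on_def)
  have "upper_semi_Browder (shift ?S \<nu>)" if \<nu>: "0 < cmod \<nu>" "cmod \<nu> < \<epsilon>" for \<nu>
  proof (rule upper_semi_Browder_shift_shift[OF T B])
    show "upper_semi_Weyl (shift ?S \<nu>)"
      using \<nu> by (intro upper_semi_Weyl_shift_of_range[OF S _ n(1)] \<epsilon>(2)) auto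
  qed
  then obtain q where "kernel (?S ^^ Suc q) \<inter> ?Y \<subseteq> kernel (?S ^^ q)"
    using finite_ascent_on_if_punctured_Browder[OF S sY n(1) SY F \<epsilon>(1)] by blast
  then show "left_Drazin_invertible ?S" by (rule left_Drazin_invertibleI[OF S n(1) F])
qed

lemma generalized_a_Browder_imp_a_Browder:
  assumes T: "bounded_clinear T" and G: "generalized_a_Browder_theorem T"
  shows "a_Browder_theorem T"
  unfolding a_Browder_theorem_iff[OF T]
proof (intro allI impI)
  fix \<mu> assume W: "upper_semi_Weyl (shift T \<mu>)"
  then have "upper_semi_B_Weyl (shift T \<mu>)"
    unfolding upper_semi_B_Weyl_def upper_semi_Weyl_def by (intro exI[of _ 0]) simp
  then have "left_Drazin_invertible (shift T \<mu>)" using G by (simp add: generalized_a_Browder_theorem_iff[OF T])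
  then show "upper_semi_Browder (shift T \<mu>)"
    using W by (simp add: upper_semi_Browder_def left_Drazin_invertible_def upper_semi_Weyl_def upper_semi_Weyl_on_def)
qed

lemma a_Browder_imp_spectrum_eq:
  assumes T: "bounded_clinear T" and B: "a_Browder_theorem T"
  shows "spectrum_gDM T = spectrum_gDW_plus T"
  unfolding spectrum_gDM_eq_iff[OF T]
proof (intro allI impI)
  fix \<mu> assume "gD_upper_semi_Weyl (shift T \<mu>)"
  let ?S = "shift T \<mu>"
  have S: "bounded_clinear ?S" using T by (rule bounded_clinear_shift)
  obtain M N where R: "(M, N) \<in> Red ?S" and W: "upper_semi_Weyl_on ?S M" and q: "quasinilpotent_on ?S N"
    using \<open>gD_upper_semi_Weyl ?S\<close> by (auto simp: gD_upper_semi_Weyl_def)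
  have M: "cvec.subspace M" "closed M" "?S ` M \<subseteq> M" using R by (auto simp: Red_def)
  obtain \<epsilon> where \<epsilon>: "\<epsilon> > 0" "\<And>\<nu>. cmod \<nu> < \<epsilon> \<Longrightarrow> upper_semi_Weyl_on (shift ?S \<nu>) M"
    using upper_semi_Weyl_on_shift[OF S M W] by blast
  have F: "upper_semi_Fredholm_on ?S M" using W by (simp add: upper_semi_Weyl_on_def)
  have "upper_semi_Browder (shift ?S \<nu>)" if \<nu>: "0 < cmod \<nu>" "cmod \<nu> < \<epsilon>" for \<nu>
  proof (rule upper_semi_Browder_shift_shift[OF T B])
    show "upper_semi_Weyl (shift ?S \<nu>)"
      using \<nu> by (intro upper_semi_Weyl_Red_shift[OF S R q] \<epsilon>(2)) auto
  qed
  then obtain p where "kernel (?S ^^ Suc p) \<inter> M \<subseteq> kernel (?S ^^ p)"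
    using finite_ascent_on_if_punctured_Browder[OF S M F \<epsilon>(1)] by blast
  then show "gD_bounded_below ?S" by (rule gD_bounded_belowI[OF S R q F])
qed

lemma SVEP_imp_a_Browder:
  assumes T: "bounded_clinear T" and sv: "\<forall>\<mu>. \<mu> \<notin> spectrum_gDW_plus T \<longrightarrow> SVEP_at T \<mu>"
  shows "a_Browder_theorem T"
  unfolding a_Browder_theorem_iff[OF T]
proof (intro allI impI)
  fix \<mu> assume W: "upper_semi_Weyl (shift T \<mu>)"
  have S: "bounded_clinear (shift T \<mu>)" using T by (rule bounded_clinear_shift)
  have F: "upper_semi_Fredholm_on (shift T \<mu>) UNIV"
    using W by (simp add: upper_semi_Weyl_def upper_semi_Weyl_on_def)
  have "SVEP_at T \<mu>"
    using sv upper_semi_Weyl_imp_gD_upper_semi_Weyl[OF S W] by (simp add: spectrum_gDW_plus_def)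
  then obtain p where "kernel (shift T \<mu> ^^ Suc p) \<inter> UNIV \<subseteq> kernel (shift T \<mu> ^^ p)"
    using SVEP_imp_finite_ascent_on[OF T _ _ _ _ F] by auto
  then have "ascent (shift T \<mu>) < \<infinity>" by (intro ascent_finiteI[OF S]) simp
  then show "upper_semi_Browder (shift T \<mu>)" using F by (simp add: upper_semi_Browder_def)
qed

lemma spectrum_eq_imp_SVEP:
  assumes T: "bounded_clinear T" and eq: "spectrum_gDM T = spectrum_gDW_plus T" and \<mu>: "\<mu> \<notin> spectrum_gDW_plus T"
  shows "SVEP_at T \<mu>"
  using \<mu> unfolding eq[symmetric] spectrum_gDM_def
  by (intro gD_bounded_below_imp_SVEP[OF T]) simp

theorem theorem2p3:
  fixes T :: "'a::complex_banach \<Rightarrow> 'a"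
  assumes "bounded_clinear T"
  shows "(a_Browder_theorem T \<longleftrightarrow> generalized_a_Browder_theorem T) \<and>
    (generalized_a_Browder_theorem T \<longleftrightarrow> (\<forall>\<mu>. \<mu> \<notin> spectrum_gDW_plus T \<longrightarrow> SVEP_at T \<mu>)) \<and>
    ((\<forall>\<mu>. \<mu> \<notin> spectrum_gDW_plus T \<longrightarrow> SVEP_at T \<mu>) \<longleftrightarrow> spectrum_gDM T = spectrum_gDW_plus T)"
  using a_Browder_imp_generalized_a_Browder[OF assms] generalized_a_Browder_imp_a_Browder[OF assms]
    a_Browder_imp_spectrum_eq[OF assms] SVEP_imp_a_Browder[OF assms] spectrum_eq_imp_SVEP[OF assms]
  by blast

end
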